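(* Let $X$ be a complex Banach space and let $A,T\in B(X)$ satisfy the following conditions: (i) $A$ is decomposable and $\sigma(A)\subset\{z\in\mathbb{C}:\operatorname{Re} z>0\}$; (ii) for some $0\le\alpha<1$ and some constant $C_T>0$, $\|A^nTA^{-n}\|\le C_T(1+|n|)^{\alpha}$ for all $n\in\mathbb{Z}$. Then $AT=TA$ if and only if $TX_A(F)\subseteq X_A(F)$ for every closed set $F\subset\mathbb{C}$.
   Context: $B(X)$ is the algebra of all bounded linear operators on $X$. An operator $A\in B(X)$ is decomposable if for every open covering $\{U,W\}$ of the complex plane there exist $A$-invariant closed linear subspaces $E$ and $F$ of $X$ such that $E+F=X$, $\sigma(A|_E)\subset U$ and $\sigma(A|_F)\subset W$. For $x\in X$, $\rho_A(x)$ is the set of all $\lambda\in\mathbb{C}$ for which there exist a neighborhood $U_\lambda$ of $\lambda$ and an analytic function $u:U_\lambda\to X$ with $(zI-A)u(z)=x$ for all $z\in U_\lambda$; the local spectrum of $A$ at $x$ is $\sigma_A(x)=\mathbb{C}\setminus\rho_A(x)$. For a closed set $F\subset\mathbb{C}$, the local spectral subspace is $X_A(F)=\{x\in X:\sigma_A(x)\subseteq F\}$. *)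

theory Defs
  imports "HOL-Analysis.Analysis"
begin

section \<open>Complex Banach spaces\<close>

class scaleC = scaleR +
  fixes scaleC :: "complex \<Rightarrow> 'a \<Rightarrow> 'a" (infixr \<open>*\<^sub>C\<close> 75)
  assumes scaleR_scaleC: "scaleR r x = complex_of_real r *\<^sub>C x"

class complex_vector = scaleC + real_vector +
  assumes scaleC_add_right: "a *\<^sub>C (x + y) = a *\<^sub>C x + a *\<^sub>C y"
    and scaleC_add_left: "(a + b) *\<^sub>C x = a *\<^sub>C x + b *\<^sub>C x"
    and scaleC_scaleC: "a *\<^sub>C b *\<^sub>C x = (a * b) *\<^sub>C x"
    and scaleC_one: "1 *\<^sub>C x = x"

class complex_normed_vector = complex_vector + real_normed_vector +
  assumes norm_scaleC: "norm (a *\<^sub>C x) = cmod a * norm x"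

class complex_banach = complex_normed_vector + banach

global_interpretation complex_vector: vector_space "scaleC :: complex \<Rightarrow> 'a \<Rightarrow> 'a::complex_vector"
  by unfold_locales (simp_all add: scaleC_add_right scaleC_add_left scaleC_scaleC scaleC_one)

instantiation complex :: complex_banach
begin

definition scaleC_complex :: "complex \<Rightarrow> complex \<Rightarrow> complex" where
  "scaleC_complex a x = a * x"

instance
  by standard
    (simp_all add: scaleC_complex_def scaleR_conv_of_real algebra_simps norm_mult)

end

section \<open>Bounded operators and their spectra\<close>

definition bounded_clinear :: "('a::complex_normed_vector \<Rightarrow> 'a) \<Rightarrow> bool" where
  "bounded_clinear A \<longleftrightarrow> bounded_linear A \<and> (\<forall>c x. A (c *\<^sub>C x) = c *\<^sub>C A x)"

text \<open>
  A bounded operator on a subspace \<open>E\<close> is represented by a function on the whole type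
  of which only the values on \<open>E\<close> matter. In particular, the restriction of \<open>A\<close> to an invariant
  subspace \<open>E\<close> is represented by \<open>A\<close> itself.
\<close>

definition bounded_clinear_on :: "'a set \<Rightarrow> ('a::complex_normed_vector \<Rightarrow> 'a) \<Rightarrow> bool" where
  "bounded_clinear_on E S \<longleftrightarrow>
     S ` E \<subseteq> E \<and>
     (\<forall>x\<in>E. \<forall>y\<in>E. S (x + y) = S x + S y) \<and>
     (\<forall>c. \<forall>x\<in>E. S (c *\<^sub>C x) = c *\<^sub>C S x) \<and>
     (\<exists>K. \<forall>x\<in>E. norm (S x) \<le> K * norm x)"

lemma bounded_clinear_on_UNIV: "bounded_clinear_on UNIV S \<longleftrightarrow> bounded_clinear S"
proof
  assume S: "bounded_clinear_on UNIV S"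
  then obtain K where "\<forall>x. norm (S x) \<le> K * norm x"
    by (auto simp: bounded_clinear_on_def)
  with S show "bounded_clinear S"
    by (auto simp: bounded_clinear_on_def bounded_clinear_def scaleR_scaleC mult.commute
        intro!: bounded_linear_intro[where K = K])
next
  assume S: "bounded_clinear S"
  then obtain K where "\<forall>x. norm (S x) \<le> norm x * K"
    unfolding bounded_clinear_def by (meson bounded_linear.bounded)
  then have "\<forall>x. norm (S x) \<le> K * norm x"
    by (simp add: mult.commute)
  with S show "bounded_clinear_on UNIV S"
    by (auto simp: bounded_clinear_on_def bounded_clinear_def linear_simps)
qed

text \<open>For an \<open>A\<close>-invariant closed subspace \<open>E\<close>, \<open>spectrum_on E A\<close> is the spectrum of the
  restriction of \<open>A\<close> to \<open>E\<close>, as an element of the algebra of bounded operators on \<open>E\<close>.\<close>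

definition spectrum_on :: "'a set \<Rightarrow> ('a::complex_normed_vector \<Rightarrow> 'a) \<Rightarrow> complex set" where
  "spectrum_on E A =
     {z. \<not> (\<exists>S. bounded_clinear_on E S \<and>
               (\<forall>x\<in>E. S (z *\<^sub>C x - A x) = x) \<and>
               (\<forall>x\<in>E. z *\<^sub>C S x - A (S x) = x))}"

abbreviation spectrum :: "('a::complex_normed_vector \<Rightarrow> 'a) \<Rightarrow> complex set" where
  "spectrum A \<equiv> spectrum_on UNIV A"

definition closed_invariant_subspace :: "('a::complex_normed_vector \<Rightarrow> 'a) \<Rightarrow> 'a set \<Rightarrow> bool" where
  "closed_invariant_subspace A E \<longleftrightarrow> complex_vector.subspace E \<and> closed E \<and> A ` E \<subseteq> E"

definition decomposable :: "('a::complex_normed_vector \<Rightarrow> 'a) \<Rightarrow> bool" where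
  "decomposable A \<longleftrightarrow>
     (\<forall>U W. open U \<and> open W \<and> U \<union> W = UNIV \<longrightarrow>
        (\<exists>E F. closed_invariant_subspace A E \<and> closed_invariant_subspace A F \<and>
           {x + y |x y. x \<in> E \<and> y \<in> F} = UNIV \<and>
           spectrum_on E A \<subseteq> U \<and> spectrum_on F A \<subseteq> W))"

text \<open>Integer powers; for negative exponents this is only meaningful if \<open>A\<close> is bijective.\<close>

definition op_power_int :: "('a \<Rightarrow> 'a) \<Rightarrow> int \<Rightarrow> 'a \<Rightarrow> 'a" where
  "op_power_int A n = (if n \<ge> 0 then A ^^ nat n else inv A ^^ nat (- n))"

section \<open>Local spectral theory\<close>

text \<open>Vector-valued analyticity on an open set, as complex differentiability at every point
  (the library's \<open>holomorphic_on\<close> is restricted to complex-valued functions).\<close>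

definition vector_analytic_on :: "(complex \<Rightarrow> 'a::complex_normed_vector) \<Rightarrow> complex set \<Rightarrow> bool" where
  "vector_analytic_on u U \<longleftrightarrow> (\<forall>z\<in>U. \<exists>d. (u has_derivative (\<lambda>h. h *\<^sub>C d)) (at z))"

definition local_resolvent :: "('a::complex_normed_vector \<Rightarrow> 'a) \<Rightarrow> 'a \<Rightarrow> complex set" where
  "local_resolvent A x =
     {l. \<exists>U u. open U \<and> l \<in> U \<and> vector_analytic_on u U \<and> (\<forall>z\<in>U. z *\<^sub>C u z - A (u z) = x)}"

definition local_spectrum :: "('a::complex_normed_vector \<Rightarrow> 'a) \<Rightarrow> 'a \<Rightarrow> complex set" where
  "local_spectrum A x = - local_resolvent A x"

definition local_spectral_subspace ::
    "('a::complex_normed_vector \<Rightarrow> 'a) \<Rightarrow> complex set \<Rightarrow> 'a set" where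
  "local_spectral_subspace A F = {x. local_spectrum A x \<subseteq> F}"

end

theory Submission
  imports Defs "HOL-Complex_Analysis.Complex_Analysis"
begin

text \<open>
  That a \<open>T\<close> commuting with \<open>A\<close> preserves the local spectral subspaces is immediate: \<open>T\<close> maps local
  resolvent functions to local resolvent functions. The content is the converse, which rests on two
  facts about the commutator \<open>\<delta> S = A S - S A\<close>.

  \<^emph>\<open>Decay of iterated commutators\<close> (\<open>iterated_commutator_decay\<close>). If \<open>T\<close> preserves the local
  spectral subspaces, then \<open>\<delta>\<^sup>k T\<close> decays faster than every geometric sequence. Decomposability
  allows vectors to be cut along parallel lines into pieces whose local spectrum lies in a thin
  strip, say \<open>t \<le> Re (c z) \<le> t + \<eta>\<close> with \<open>|c| = 1\<close>. On a piece, \<open>T\<close> does not move the local spectrum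
  to the right, and inside a fixed disc a half-plane is nearly a large disc with a far centre.
  So \<open>A - l\<close> acts after \<open>T\<close>, and \<open>A - m\<close> before \<open>T\<close>, with local spectral radius close to \<open>L + t\<close> and \<open>L - t\<close>,
  where \<open>m = - l\<close> has modulus \<open>L\<close>, and \<open>\<delta> + 2 L c\<^sup>*\<close> has local spectral radius close to \<open>2 L\<close> at \<open>T\<close>
  (\<open>strip_bound\<close>). In terms of \<open>1 / z\<close> this says that the generating function of the sequence
  \<open>\<delta>\<^sup>k T\<close> continues to a large disc through the origin; the discs for four directions \<open>c\<close> cover
  a disc of arbitrarily large radius about the origin.

  Two things make this work. First, decomposable operators have the single-valued extension property
  (\<open>decomposable_single_valued_extension\<close>), so that local resolvent functions glue, and the size of
  \<open>(A - l)\<^sup>n y\<close> is controlled by the local spectrum of \<open>y\<close> (\<open>local_spectral_radius\<close>). Secondly, the theory of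
  scalar holomorphic functions applies to vector-valued ones by way of functionals: the
  Hahn-Banach theorem provides enough of them, and uniform boundedness turns estimates for each
  functional and each vector into estimates in norm.

  \<^emph>\<open>A theorem of Gelfand-Hille type\<close> (\<open>conjugates_power_growth_imp_commute\<close>). Put
  \<open>\<Delta> S = A S A\<^sup>-\<^sup>1\<close>. As \<open>(\<Delta> - 1)\<^sup>k T = \<delta>\<^sup>k T A\<^sup>-\<^sup>k\<close>, the decay makes \<open>G z = (1 - z (\<Delta> - 1))\<^sup>-\<^sup>1 T\<close> an entire function
  of \<open>z\<close>. On either side of the line \<open>Re z = - 1/2\<close> it can be expanded in the powers \<open>\<Delta>\<^sup>n T\<close>, for \<open>n \<ge> 0\<close>
  on the right and \<open>n < 0\<close> on the left, and the hypothesis \<open>\<parallel>\<Delta>\<^sup>n T\<parallel> \<le> C (1 + |n|)\<^sup>\<alpha>\<close> bounds these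
  expansions. The maximum principle on large circles about \<open>- 1/2\<close> removes the
  singularity of the bounds along the line and gives \<open>G z = O(|z|\<^sup>\<alpha>)\<close>. Since \<open>\<alpha> < 1\<close>, Liouville's theorem makes
  \<open>G\<close> constant, and its linear coefficient \<open>(\<Delta> - 1) T\<close> vanishes.
\<close>

section \<open>Bounded linear functionals\<close>

definition sublinear :: "('a::real_vector \<Rightarrow> real) \<Rightarrow> bool" where
  "sublinear p \<longleftrightarrow> (\<forall>x y. p (x + y) \<le> p x + p y) \<and> (\<forall>t>0. \<forall>x. p (t *\<^sub>R x) \<le> t * p x)"

lemma sublinear_add: "sublinear p \<Longrightarrow> p (x + y) \<le> p x + p y"
  by (simp add: sublinear_def)

lemma sublinear_scale:
  assumes "sublinear p" "t > 0"
  shows "p (t *\<^sub>R x) = t * p x"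
proof (rule antisym)
  show "p (t *\<^sub>R x) \<le> t * p x"
    using assms by (simp add: sublinear_def)
  have "p (inverse t *\<^sub>R (t *\<^sub>R x)) \<le> inverse t * p (t *\<^sub>R x)"
    using assms unfolding sublinear_def by (meson positive_imp_inverse_positive)
  with assms(2) show "t * p x \<le> p (t *\<^sub>R x)"
    by (simp add: field_simps)
qed

lemma sublinear_zero: "sublinear p \<Longrightarrow> p 0 = 0"
  using sublinear_scale[of p 2 0] by simp

lemma sublinear_minus: "sublinear p \<Longrightarrow> 0 \<le> p x + p (- x)"
  using sublinear_add[of p x "- x"] sublinear_zero[of p] by simp

lemma sublinear_scale_nonneg: "sublinear p \<Longrightarrow> t \<ge> 0 \<Longrightarrow> p (t *\<^sub>R x) = t * p x"
  by (cases "t = 0") (simp_all add: sublinear_zero sublinear_scale)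

text \<open>
  Subtracting from a sublinear functional as much as possible in the direction \<open>y\<close> leaves it
  sublinear. The result lies below the given functional, and it is at most \<open>- q y\<close> at \<open>- y\<close>;
  this is the step that forces a minimal sublinear functional to be additive.
\<close>

definition lower_along :: "('a::real_vector \<Rightarrow> real) \<Rightarrow> 'a \<Rightarrow> 'a \<Rightarrow> real" where
  "lower_along q y x = (INF t\<in>{0..}. q (x + t *\<^sub>R y) - t * q y)"

lemma lower_along_le:
  assumes "sublinear q" "t \<ge> 0"
  shows "lower_along q y x \<le> q (x + t *\<^sub>R y) - t * q y"
proof -
  have "- q (- x) \<le> q (x + s *\<^sub>R y) - s * q y" if "s \<ge> 0" for s
    using sublinear_add[OF assms(1), of "x + s *\<^sub>R y" "- x"] sublinear_scale_nonneg[OF assms(1) that, of y]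
    by simp
  then have "bdd_below ((\<lambda>t. q (x + t *\<^sub>R y) - t * q y) ` {0..})"
    by (intro bdd_belowI2[where m = "- q (- x)"]) auto
  with assms(2) show ?thesis
    unfolding lower_along_def by (intro cINF_lower) auto
qed

lemma lower_along_greatest:
  "(\<And>t. t \<ge> 0 \<Longrightarrow> c \<le> q (x + t *\<^sub>R y) - t * q y) \<Longrightarrow> c \<le> lower_along q y x"
  unfolding lower_along_def by (rule cINF_greatest) auto

lemma lower_along_self_le: "sublinear q \<Longrightarrow> lower_along q y x \<le> q x"
  using lower_along_le[of q 0 y x] by simp

lemma sublinear_lower_along:
  assumes q: "sublinear q"
  shows "sublinear (lower_along q y)"
  unfolding sublinear_def
proof (intro conjI allI impI)
  fix x1 x2
  let ?r = "lower_along q y"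
  have "?r (x1 + x2) - (q (x2 + t *\<^sub>R y) - t * q y) \<le> ?r x1" if t: "t \<ge> 0" for t
  proof (rule lower_along_greatest)
    fix s :: real assume s: "s \<ge> 0"
    have "?r (x1 + x2) \<le> q (x1 + x2 + (s + t) *\<^sub>R y) - (s + t) * q y"
      using s t by (intro lower_along_le q) simp
    also have "q (x1 + x2 + (s + t) *\<^sub>R y) \<le> q (x1 + s *\<^sub>R y) + q (x2 + t *\<^sub>R y)"
      using sublinear_add[OF q, of "x1 + s *\<^sub>R y" "x2 + t *\<^sub>R y"] by (simp add: algebra_simps)
    finally show "?r (x1 + x2) - (q (x2 + t *\<^sub>R y) - t * q y) \<le> q (x1 + s *\<^sub>R y) - s * q y"
      by (simp add: algebra_simps)
  qed
  then have "?r (x1 + x2) - ?r x1 \<le> ?r x2"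
    by (intro lower_along_greatest) (simp add: algebra_simps)
  then show "?r (x1 + x2) \<le> ?r x1 + ?r x2" by simp
next
  fix s :: real and x assume s: "s > 0"
  let ?r = "lower_along q y"
  have "?r (s *\<^sub>R x) / s \<le> ?r x"
  proof (rule lower_along_greatest)
    fix t :: real assume t: "t \<ge> 0"
    have "?r (s *\<^sub>R x) \<le> q (s *\<^sub>R x + (s * t) *\<^sub>R y) - (s * t) * q y"
      using s t by (intro lower_along_le q) simp
    also have "q (s *\<^sub>R x + (s * t) *\<^sub>R y) = s * q (x + t *\<^sub>R y)"
      using sublinear_scale[OF q s, of "x + t *\<^sub>R y"] by (simp add: algebra_simps)
    finally show "?r (s *\<^sub>R x) / s \<le> q (x + t *\<^sub>R y) - t * q y"
      using s by (simp add: field_simps)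
  qed
  with s show "?r (s *\<^sub>R x) \<le> s * ?r x" by (simp add: field_simps)
qed

lemma minimal_sublinear_linear:
  assumes q: "sublinear q"
    and min: "\<And>r. sublinear r \<Longrightarrow> (\<And>x. r x \<le> q x) \<Longrightarrow> r = q"
  shows "linear q"
proof -
  have add: "q (x + y) = q x + q y" for x y
  proof (rule antisym[OF sublinear_add[OF q]])
    have "lower_along q y = q"
      by (intro min sublinear_lower_along lower_along_self_le q)
    then show "q x + q y \<le> q (x + y)"
      using lower_along_le[OF q, of 1 y x] by simp
  qed
  have minus: "q (- x) = - q x" for x
    using add[of x "- x"] sublinear_zero[OF q] by simp
  have "q (t *\<^sub>R x) = t * q x" for t x
  proof (cases "t \<ge> 0")
    case True
    then show ?thesis by (rule sublinear_scale_nonneg[OF q])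
  next
    case False
    then have "q ((- t) *\<^sub>R x) = (- t) * q x" by (intro sublinear_scale_nonneg[OF q]) simp
    then show ?thesis using minus[of "t *\<^sub>R x"] by simp
  qed
  with add show ?thesis by (intro linearI) auto
qed

text \<open>By Zorn's lemma: the pointwise infimum of a chain of sublinear functionals below \<open>p\<close> is finite, since
  \<open>- p (- x)\<close> bounds it from below, and it is subadditive, since of any two members of the chain the
  smaller one can be used for both summands.\<close>

lemma minimal_sublinear_exists:
  assumes p: "sublinear p"
  obtains m where "sublinear m" "\<And>x. m x \<le> p x"
    "\<And>r. sublinear r \<Longrightarrow> (\<And>x. r x \<le> m x) \<Longrightarrow> r = m"
proof -
  define S where "S = {q. sublinear q \<and> q \<le> p}"
  have "\<exists>m\<in>S. \<forall>q\<in>S. m \<ge> q \<longrightarrow> q = m"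
  proof (rule predicate_Zorn)
    show "partial_order_on S (relation_of (\<ge>) S)"
      by (auto simp: partial_order_on_relation_ofI)
  next
    fix \<C> assume C: "\<C> \<in> Chains (relation_of (\<ge>) S)"
    have CS: "q \<in> S" if "q \<in> \<C>" for q
      using C that unfolding Chains_def relation_of_def by auto
    have total: "q \<le> r \<or> r \<le> q" if "q \<in> \<C>" "r \<in> \<C>" for q r
      using C that unfolding Chains_def relation_of_def by auto
    show "\<exists>u\<in>S. \<forall>q\<in>\<C>. q \<ge> u"
    proof (cases "\<C> = {}")
      case True
      with p show ?thesis by (auto simp: S_def)
    next
      case False
      define u where "u x = (INF q\<in>\<C>. q x)" for x
      have "- p (- x) \<le> q x" if "q \<in> \<C>" for q x
      proof -
        have "q (- x) \<le> p (- x)" using CS[OF that] by (simp add: S_def le_fun_def)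
        moreover have "0 \<le> q x + q (- x)" using CS[OF that] by (simp add: S_def sublinear_minus)
        ultimately show ?thesis by linarith
      qed
      then have bdd: "bdd_below ((\<lambda>q. q x) ` \<C>)" for x
        by (intro bdd_belowI2[where m = "- p (- x)"])
      have le: "u x \<le> q x" if "q \<in> \<C>" for q x
        unfolding u_def by (intro cINF_lower bdd that)
      have ge: "c \<le> u x" if "\<And>q. q \<in> \<C> \<Longrightarrow> c \<le> q x" for c x
        unfolding u_def using that by (intro cINF_greatest False)
      have "sublinear u"
        unfolding sublinear_def
      proof (intro conjI allI impI)
        fix x y
        have "u (x + y) - q y \<le> u x" if q: "q \<in> \<C>" for q
        proof (rule ge)
          fix r assume r: "r \<in> \<C>"
          obtain s where s: "s \<in> \<C>" "s \<le> q" "s \<le> r"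
            using total[OF q r] q r by blast
          have "u (x + y) \<le> s x + s y"
            using le[OF s(1), of "x + y"] sublinear_add[of s x y] CS[OF s(1)] by (simp add: S_def)
          also have "\<dots> \<le> r x + q y"
            using s(2,3) by (intro add_mono) (simp_all add: le_fun_def)
          finally show "u (x + y) - q y \<le> r x" by simp
        qed
        then have "u (x + y) - u x \<le> u y"
          by (intro ge) (simp add: algebra_simps)
        then show "u (x + y) \<le> u x + u y" by simp
      next
        fix t :: real and x assume t: "t > 0"
        have "u (t *\<^sub>R x) / t \<le> u x"
        proof (rule ge)
          fix q assume q: "q \<in> \<C>"
          then have "u (t *\<^sub>R x) \<le> t * q x"
            using le[OF q, of "t *\<^sub>R x"] sublinear_scale[of q t x] CS[OF q] t by (simp add: S_def)
          with t show "u (t *\<^sub>R x) / t \<le> q x" by (simp add: field_simps)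
        qed
        with t show "u (t *\<^sub>R x) \<le> t * u x" by (simp add: field_simps)
      qed
      moreover obtain q where "q \<in> \<C>" using False by auto
      then have "u \<le> p"
        using le[of q] CS[of q] by (auto simp: S_def le_fun_def intro: order_trans)
      ultimately show ?thesis
        using le by (intro bexI[of _ u]) (auto simp: S_def le_fun_def)
    qed
  qed
  then obtain m where m: "m \<in> S" and min: "\<And>q. q \<in> S \<Longrightarrow> q \<le> m \<Longrightarrow> q = m" by blast
  show thesis
  proof
    show "sublinear m" and "\<And>x. m x \<le> p x"
      using m by (simp_all add: S_def le_fun_def)
    show "r = m" if "sublinear r" "\<And>x. r x \<le> m x" for r
      using that m by (intro min) (auto simp: S_def le_fun_def intro: order_trans)
  qed
qed

text \<open>The Hahn-Banach theorem: a minimal sublinear functional below \<open>lower_along p y\<close> is linear,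
  and its value at \<open>- y\<close> is at most \<open>- p y\<close>.\<close>

lemma Hahn_Banach_support:
  assumes p: "sublinear p"
  obtains f where "linear f" "\<And>x. f x \<le> p x" "f y = p y"
proof -
  obtain f where f: "sublinear f" "\<And>x. f x \<le> lower_along p y x"
    and min: "\<And>r. sublinear r \<Longrightarrow> (\<And>x. r x \<le> f x) \<Longrightarrow> r = f"
    using minimal_sublinear_exists[OF sublinear_lower_along[OF p, of y]] by blast
  have lin: "linear f" using f(1) min by (rule minimal_sublinear_linear)
  have le: "f x \<le> p x" for x
    using f(2) lower_along_self_le[OF p] by (rule order_trans)
  have "f (- y) \<le> lower_along p y (- y)" by (rule f(2))
  also have "\<dots> \<le> p (- y + 1 *\<^sub>R y) - 1 * p y"
    by (rule lower_along_le[OF p]) simp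
  also have "\<dots> = - p y" by (simp add: sublinear_zero[OF p])
  finally have "p y \<le> f y" by (simp add: linear_neg[OF lin])
  with le[of y] have "f y = p y" by simp
  with lin le show thesis by (rule that)
qed

lemma sublinear_infdist:
  fixes N :: "'a::real_normed_vector set"
  assumes N: "subspace N"
  shows "sublinear (\<lambda>x. infdist x N)"
  unfolding sublinear_def
proof (intro conjI allI impI)
  have N0: "0 \<in> N" "N \<noteq> {}" using subspace_0[OF N] by auto
  have ge: "c \<le> infdist x N" if "\<And>a. a \<in> N \<Longrightarrow> c \<le> dist x a" for c x
    unfolding infdist_notempty[OF N0(2)] using that by (intro cINF_greatest N0(2))
  fix x y
  have "infdist (x + y) N - dist y b \<le> infdist x N" if b: "b \<in> N" for b
  proof (rule ge)
    fix a assume a: "a \<in> N"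
    have "infdist (x + y) N \<le> dist (x + y) (a + b)"
      by (intro infdist_le subspace_add[OF N] a b)
    also have "\<dots> \<le> dist x a + dist y b" unfolding dist_norm by (rule norm_diff_triangle_ineq)
    finally show "infdist (x + y) N - dist y b \<le> dist x a" by simp
  qed
  then have "infdist (x + y) N - infdist x N \<le> infdist y N"
    by (intro ge) (simp add: algebra_simps)
  then show "infdist (x + y) N \<le> infdist x N + infdist y N" by simp
  fix t :: real assume t: "t > 0"
  have "infdist (t *\<^sub>R x) N / t \<le> infdist x N"
  proof (rule ge)
    fix a assume "a \<in> N"
    then have "infdist (t *\<^sub>R x) N \<le> dist (t *\<^sub>R x) (t *\<^sub>R a)"
      by (intro infdist_le subspace_scale[OF N])
    also have "\<dots> = t * dist x a" using t by (simp add: dist_norm flip: scaleR_diff_right)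
    finally show "infdist (t *\<^sub>R x) N / t \<le> dist x a" using t by (simp add: field_simps)
  qed
  with t show "infdist (t *\<^sub>R x) N \<le> t * infdist x N" by (simp add: field_simps)
qed

text \<open>The distance to a subspace \<open>N\<close> is sublinear, so the functional that supports it at \<open>y\<close> vanishes
  on \<open>N\<close>. For \<open>N = {0}\<close> this is the norming functional of \<open>y\<close>.\<close>

lemma functional_infdist:
  fixes N :: "'a::real_normed_vector set"
  assumes N: "subspace N"
  obtains f where "bounded_linear f" "\<And>x. x \<in> N \<Longrightarrow> f x = 0" "\<And>x. \<bar>f x\<bar> \<le> norm x"
    "f y = infdist y N"
proof -
  obtain f where lin: "linear f" and le: "\<And>x. f x \<le> infdist x N" and y: "f y = infdist y N"
    using Hahn_Banach_support[OF sublinear_infdist[OF N], of y] by metis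
  have "f x \<le> norm x" for x
    using le[of x] infdist_le[OF subspace_0[OF N], of x] by simp
  from this[of "- x" for x] this have b: "\<bar>f x\<bar> \<le> norm x" for x
    by (simp add: linear_neg[OF lin] abs_le_iff)
  have "f x = 0" if "x \<in> N" for x
    using le[of x] le[of "- x"] that subspace_neg[OF N that] by (simp add: linear_neg[OF lin])
  moreover have "bounded_linear f"
    using b lin by (intro bounded_linear_intro[where K = 1]) (auto simp: linear_add linear_scale)
  ultimately show thesis using b y by (intro that)
qed

definition complex_functional :: "('a::complex_normed_vector \<Rightarrow> complex) \<Rightarrow> bool" where
  "complex_functional \<phi> \<longleftrightarrow> bounded_linear \<phi> \<and> (\<forall>c x. \<phi> (c *\<^sub>C x) = c * \<phi> x)"

lemma complex_functional_add: "complex_functional \<phi> \<Longrightarrow> \<phi> (x + y) = \<phi> x + \<phi> y"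
  and complex_functional_scaleC: "complex_functional \<phi> \<Longrightarrow> \<phi> (c *\<^sub>C x) = c * \<phi> x"
  by (simp_all add: complex_functional_def linear_simps)

lemma bounded_linear_scaleC: "bounded_linear (\<lambda>x::'a::complex_normed_vector. c *\<^sub>C x)"
  by (rule bounded_linear_intro[where K = "cmod c"])
    (simp_all add: scaleC_add_right scaleR_scaleC scaleC_scaleC norm_scaleC mult.commute)

lemma bounded_linear_scaleC_left: "bounded_linear (\<lambda>c. c *\<^sub>C (x::'a::complex_normed_vector))"
  by (rule bounded_linear_intro[where K = "norm x"])
    (simp_all add: scaleC_add_left scaleR_scaleC[where 'a = 'a] scaleC_scaleC norm_scaleC
      scaleR_conv_of_real)

lemma complex_subspace_imp_subspace: "complex_vector.subspace N \<Longrightarrow> subspace N"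
  unfolding complex_vector.subspace_def subspace_def by (simp add: scaleR_scaleC)

text \<open>A real functional is the real part of exactly one complex functional.\<close>

lemma complexify_functional:
  fixes f :: "'a::complex_normed_vector \<Rightarrow> real"
  assumes f: "bounded_linear f"
  shows "complex_functional (\<lambda>x. Complex (f x) (- f (\<i> *\<^sub>C x)))"
  unfolding complex_functional_def
proof (intro conjI allI)
  have fi: "bounded_linear (\<lambda>x. - f (\<i> *\<^sub>C x))"
    by (intro bounded_linear_minus bounded_linear_compose[OF f] bounded_linear_scaleC)
  have eq: "(\<lambda>x. Complex (f x) (- f (\<i> *\<^sub>C x)))
      = (\<lambda>x. f x *\<^sub>R 1 + (- f (\<i> *\<^sub>C x)) *\<^sub>R \<i>)"
    by (auto simp: complex_eq_iff)
  show "bounded_linear (\<lambda>x. Complex (f x) (- f (\<i> *\<^sub>C x)))"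
    unfolding eq using f fi by (intro bounded_linear_add bounded_linear_scaleR_const)
  fix c and x :: 'a
  have f_scale: "f (r *\<^sub>R x) = r * f x" "f (x + y) = f x + f y" "f (- x) = - f x" for r x y
    using f by (simp_all add: linear_simps)
  have "c = of_real (Re c) + of_real (Im c) * \<i>"
    by (simp add: complex_eq_iff)
  then have c: "c *\<^sub>C x = Re c *\<^sub>R x + Im c *\<^sub>R (\<i> *\<^sub>C x)"
    by (metis scaleR_scaleC scaleC_scaleC scaleC_add_left)
  have "\<i> * c = of_real (Re c) * \<i> + of_real (- Im c)"
    by (simp add: complex_eq_iff)
  then have ic: "\<i> *\<^sub>C c *\<^sub>C x = Re c *\<^sub>R (\<i> *\<^sub>C x) + (- Im c) *\<^sub>R x"
    by (simp only: scaleR_scaleC scaleC_scaleC scaleC_add_left)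
  have "f (c *\<^sub>C x) = Re c * f x + Im c * f (\<i> *\<^sub>C x)"
    unfolding c by (simp only: f_scale)
  moreover have "f (\<i> *\<^sub>C c *\<^sub>C x) = Re c * f (\<i> *\<^sub>C x) - Im c * f x"
    unfolding ic by (simp only: f_scale)
  ultimately show "Complex (f (c *\<^sub>C x)) (- f (\<i> *\<^sub>C c *\<^sub>C x)) =
      c * Complex (f x) (- f (\<i> *\<^sub>C x))"
    by (simp add: complex_eq_iff)
qed

lemma separating_functional:
  fixes N :: "'a::complex_normed_vector set"
  assumes "complex_vector.subspace N" "closed N" "y \<notin> N"
  obtains \<phi> where "complex_functional \<phi>" "\<And>x. x \<in> N \<Longrightarrow> \<phi> x = 0" "\<phi> y \<noteq> 0"
proof -
  have N: "subspace N" using assms(1) by (rule complex_subspace_imp_subspace)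
  obtain f where f: "bounded_linear f" "\<And>x. x \<in> N \<Longrightarrow> f x = 0" "f y = infdist y N"
    using functional_infdist[OF N, of y] by metis
  have "infdist y N > 0"
    using assms subspace_0[OF N] by (intro infdist_pos_not_in_closed) auto
  moreover have "\<i> *\<^sub>C x \<in> N" if "x \<in> N" for x
    using assms(1) that by (simp add: complex_vector.subspace_def)
  ultimately show thesis
    using f by (intro that[OF complexify_functional[OF f(1)]]) (auto simp: complex_eq_iff)
qed

lemma eq_zero_by_functionals:
  assumes "\<And>\<phi>. complex_functional \<phi> \<Longrightarrow> \<phi> y = 0"
  shows "y = 0"
proof (rule ccontr)
  assume "y \<noteq> 0"
  then obtain \<phi> where "complex_functional \<phi>" "\<phi> y \<noteq> 0"
    using separating_functional[of "{0}" y] by auto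
  with assms show False by blast
qed

section \<open>Uniform boundedness\<close>

text \<open>By Baire's theorem, in the complete space \<open>E\<close>, one of the closed sets on which the family is bounded
  by \<open>m\<close> contains a ball of \<open>E\<close>. The operators act on the whole space, but pointwise
  bounds are available only on \<open>E\<close>.\<close>

lemma uniform_boundedness_on_subspace:
  fixes f :: "'i \<Rightarrow> 'a::banach \<Rightarrow> 'b::real_normed_vector"
  assumes E: "subspace E" "closed E"
    and f: "\<And>n. bounded_linear (f n)"
    and ptw: "\<And>x. x \<in> E \<Longrightarrow> \<exists>M. \<forall>n. norm (f n x) \<le> M"
  shows "\<exists>M>0. \<forall>n. \<forall>x\<in>E. norm (f n x) \<le> M * norm x"
proof -
  define B where "B m = E \<inter> (\<Inter>n. {x. norm (f n x) \<le> real m})" for m :: nat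
  have "closed (B m)" for m
  proof -
    have "closed {x. norm (f n x) \<le> real m}" for n
      by (intro closed_Collect_le continuous_intros linear_continuous_on f)
    then show ?thesis unfolding B_def by (intro closed_Int closed_INT E ballI)
  qed
  then have cl: "closedin (top_of_set E) (B m)" for m
    by (intro closed_subset) (auto simp: B_def)
  have "x \<in> (\<Union>m. B m)" if x: "x \<in> E" for x
  proof -
    obtain M where M: "\<And>n. norm (f n x) \<le> M" using ptw[OF x] by blast
    obtain m where "M \<le> real m" using real_arch_simple by blast
    then have "norm (f n x) \<le> real m" for n
      using M[of n] by linarith
    with x show ?thesis by (auto simp: B_def)
  qed
  then have UB: "(\<Union>m. B m) = E" by (auto simp: B_def)
  have "completely_metrizable_space (top_of_set E)"
    using E(2) by (simp add: completely_metrizable_space_closedin completely_metrizable_space_euclidean)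
  have "\<exists>m. (top_of_set E) interior_of (B m) \<noteq> {}"
  proof (rule ccontr)
    assume "\<not> ?thesis"
    then have "(top_of_set E) interior_of \<Union>(range B) = {}"
      using cl by (intro Baire_category_alt)
        (auto simp: \<open>completely_metrizable_space (top_of_set E)\<close>)
    moreover have "(top_of_set E) interior_of \<Union>(range B) = E"
      unfolding UB using interior_of_topspace[of "top_of_set E"] by simp
    ultimately show False using subspace_0[OF E(1)] by simp
  qed
  then obtain m a where "a \<in> (top_of_set E) interior_of (B m)" by blast
  then obtain V where "openin (top_of_set E) V" "a \<in> V" "V \<subseteq> B m"
    by (auto simp: interior_of_def)
  then obtain W where W: "open W" "a \<in> W" "E \<inter> W \<subseteq> B m" "a \<in> E"
    by (auto simp: openin_open)
  then obtain r where r: "r > 0" "ball a r \<subseteq> W"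
    by (meson openE)
  have aB: "norm (f n a) \<le> real m" for n
    using W by (auto simp: B_def)
  have bound: "norm (f n x) \<le> (4 * real m / r + 1) * norm x" if x: "x \<in> E" for n x
  proof (cases "x = 0")
    case True
    then show ?thesis using f[of n] by (simp add: linear_simps)
  next
    case False
    define s where "s = r / (2 * norm x)"
    have s: "s > 0" using r False by (simp add: s_def)
    have "dist a (a + s *\<^sub>R x) < r"
      using r False by (simp add: s_def dist_norm)
    moreover have "a + s *\<^sub>R x \<in> E"
      using W(4) x by (intro subspace_add subspace_scale E)
    ultimately have "a + s *\<^sub>R x \<in> B m"
      using W(3) r(2) by auto
    then have "norm (f n (a + s *\<^sub>R x)) \<le> real m"
      by (simp add: B_def)
    moreover have "f n (a + s *\<^sub>R x) = f n a + s *\<^sub>R f n x"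
      using f[of n] by (simp add: linear_simps)
    ultimately have "norm (s *\<^sub>R f n x) \<le> real m + real m"
      using aB[of n] norm_triangle_ineq4[of "f n a + s *\<^sub>R f n x" "f n a"] by simp
    then have "s * norm (f n x) \<le> 2 * real m" using s by simp
    then have "norm (f n x) \<le> 2 * real m / s" using s by (simp add: field_simps)
    also have "\<dots> = 4 * real m / r * norm x" using r False by (simp add: s_def)
    also have "\<dots> \<le> (4 * real m / r + 1) * norm x" by (intro mult_right_mono) auto
    finally show ?thesis .
  qed
  have "4 * real m / r + 1 > 0" using r by (simp add: add_nonneg_pos)
  with bound show ?thesis by blast
qed

text \<open>The vectors act as a pointwise bounded family of functionals on the real dual space, which is complete,
  and a norming functional recovers the norm of each vector.\<close>

lemma weakly_bounded_imp_bounded: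
  fixes v :: "'i \<Rightarrow> 'a::complex_normed_vector"
  assumes "\<And>\<phi>. complex_functional \<phi> \<Longrightarrow> \<exists>M. \<forall>k. cmod (\<phi> (v k)) \<le> M"
  shows "\<exists>M>0. \<forall>k. norm (v k) \<le> M"
proof -
  have ptw: "\<exists>M. \<forall>k. norm (blinfun_apply g (v k)) \<le> M" for g :: "'a \<Rightarrow>\<^sub>L real"
  proof -
    obtain M where M: "\<And>k. cmod (Complex (g (v k)) (- g (\<i> *\<^sub>C v k))) \<le> M"
      using assms[OF complexify_functional[OF blinfun.bounded_linear_right[of g]]] by blast
    have "norm (g (v k)) \<le> M" for k
      using abs_Re_le_cmod[of "Complex (g (v k)) (- g (\<i> *\<^sub>C v k))"] M[of k] by simp
    then show ?thesis by blast
  qed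
  have "\<exists>M>0. \<forall>k. \<forall>g\<in>UNIV::('a \<Rightarrow>\<^sub>L real) set. norm (blinfun_apply g (v k)) \<le> M * norm g"
  proof (rule uniform_boundedness_on_subspace[where E = UNIV and f = "\<lambda>k g. blinfun_apply g (v k)"])
    show "\<exists>M. \<forall>k. norm (blinfun_apply g (v k)) \<le> M" for g :: "'a \<Rightarrow>\<^sub>L real"
      by (rule ptw)
  qed (simp_all add: blinfun.bounded_linear_left)
  then obtain M where M: "M > 0"
      "\<And>k (g :: 'a \<Rightarrow>\<^sub>L real). norm (blinfun_apply g (v k)) \<le> M * norm g"
    by blast
  have sub0: "subspace {0::'a}" by (simp add: subspace_def)
  have "norm (v k) \<le> M" for k
  proof -
    obtain f where f: "bounded_linear f" "\<And>x. \<bar>f x\<bar> \<le> norm x" "f (v k) = infdist (v k) {0}"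
      using functional_infdist[of "{0::'a}" "v k"] by (metis sub0)
    have "norm (Blinfun f) \<le> 1"
      using f by (intro norm_blinfun_bound) (simp_all add: bounded_linear_Blinfun_apply)
    with M(1) have "M * norm (Blinfun f) \<le> M * 1" by (intro mult_left_mono) auto
    with M(2)[of "Blinfun f" k] f show ?thesis
      by (simp add: bounded_linear_Blinfun_apply)
  qed
  with M(1) show ?thesis by blast
qed

section \<open>Vector-valued analytic functions\<close>

lemma vector_analytic_subset: "vector_analytic_on u U \<Longrightarrow> V \<subseteq> U \<Longrightarrow> vector_analytic_on u V"
  by (auto simp: vector_analytic_on_def)

lemma vector_analytic_diff:
  assumes "vector_analytic_on u U" "vector_analytic_on v U"
  shows "vector_analytic_on (\<lambda>z. u z - v z) U"
  unfolding vector_analytic_on_def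
proof
  fix z assume "z \<in> U"
  then obtain d e where "(u has_derivative (\<lambda>h. h *\<^sub>C d)) (at z)"
    "(v has_derivative (\<lambda>h. h *\<^sub>C e)) (at z)"
    using assms unfolding vector_analytic_on_def by blast
  then have "((\<lambda>z. u z - v z) has_derivative (\<lambda>h. h *\<^sub>C (d - e))) (at z)"
    unfolding complex_vector.scale_right_diff_distrib by (rule has_derivative_diff)
  then show "\<exists>d. ((\<lambda>z. u z - v z) has_derivative (\<lambda>h. h *\<^sub>C d)) (at z)" ..
qed

lemma bounded_clinear_compose_analytic:
  assumes "bounded_clinear T" "vector_analytic_on u U"
  shows "vector_analytic_on (\<lambda>z. T (u z)) U"
  unfolding vector_analytic_on_def
proof
  fix z assume "z \<in> U"
  then obtain d where "(u has_derivative (\<lambda>h. h *\<^sub>C d)) (at z)"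
    using assms unfolding vector_analytic_on_def by blast
  moreover have "bounded_linear T"
    using assms(1) by (simp add: bounded_clinear_def)
  ultimately have "((\<lambda>z. T (u z)) has_derivative (\<lambda>h. T (h *\<^sub>C d))) (at z)"
    by (rule bounded_linear.has_derivative[rotated])
  then show "\<exists>d. ((\<lambda>z. T (u z)) has_derivative (\<lambda>h. h *\<^sub>C d)) (at z)"
    using assms(1) unfolding bounded_clinear_def by auto
qed

lemma complex_functional_holomorphic:
  assumes "complex_functional \<phi>" "vector_analytic_on u U" "open U"
  shows "(\<lambda>z. \<phi> (u z)) holomorphic_on U"
  unfolding holomorphic_on_open[OF assms(3)]
proof
  fix z assume "z \<in> U"
  then obtain d where "(u has_derivative (\<lambda>h. h *\<^sub>C d)) (at z)"
    using assms unfolding vector_analytic_on_def by blast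
  moreover have "bounded_linear \<phi>"
    using assms(1) by (simp add: complex_functional_def)
  ultimately have "((\<lambda>z. \<phi> (u z)) has_derivative (\<lambda>h. \<phi> (h *\<^sub>C d))) (at z)"
    by (rule bounded_linear.has_derivative[rotated])
  moreover have "(\<lambda>h. \<phi> (h *\<^sub>C d)) = (*) (\<phi> d)"
    using assms(1) by (auto simp: complex_functional_def)
  ultimately show "\<exists>f'. ((\<lambda>z. \<phi> (u z)) has_field_derivative f') (at z)"
    unfolding has_field_derivative_def by metis
qed

text \<open>A functional that vanishes on \<open>N\<close> but not at the value in question reduces this to the scalar
  identity theorem.\<close>

lemma analytic_in_subspace_continuation:
  assumes u: "vector_analytic_on u U" and U: "open U" "connected U"
    and V: "open V" "V \<subseteq> U" "V \<noteq> {}"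
    and N: "complex_vector.subspace N" "closed N"
    and VN: "\<And>z. z \<in> V \<Longrightarrow> u z \<in> N"
    and z: "z \<in> U"
  shows "u z \<in> N"
proof (rule ccontr)
  assume "u z \<notin> N"
  then obtain \<phi> where \<phi>: "complex_functional \<phi>" "\<And>x. x \<in> N \<Longrightarrow> \<phi> x = 0" "\<phi> (u z) \<noteq> 0"
    using separating_functional[OF N] by metis
  have "\<phi> (u z) = 0"
    using V U \<phi> VN z complex_functional_holomorphic[OF \<phi>(1) u U(1)]
    by (intro analytic_continuation_open[of V U "\<lambda>z. \<phi> (u z)" "\<lambda>_. 0" z]) auto
  with \<phi>(3) show False by simp
qed

section \<open>Resolvents of restrictions\<close>

lemma bounded_clinear_simps:
  assumes "bounded_clinear A"
  shows "A (x + y) = A x + A y" "A (x - y) = A x - A y" "A (- x) = - A x" "A 0 = 0"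
    "A (c *\<^sub>C x) = c *\<^sub>C A x"
  using assms by (auto simp: bounded_clinear_def linear_simps)

lemma bounded_clinear_bound:
  assumes "bounded_clinear A"
  obtains R where "R > 0" "\<And>x. norm (A x) \<le> R * norm x"
  using assms bounded_linear.pos_bounded unfolding bounded_clinear_def
  by (metis mult.commute)

lemma closed_invariant_subspaceD:
  assumes "closed_invariant_subspace A E"
  shows "complex_vector.subspace E" "closed E" "\<And>x. x \<in> E \<Longrightarrow> A x \<in> E" "0 \<in> E"
    "\<And>x y. x \<in> E \<Longrightarrow> y \<in> E \<Longrightarrow> x + y \<in> E" "\<And>x y. x \<in> E \<Longrightarrow> y \<in> E \<Longrightarrow> x - y \<in> E"
    "\<And>c x. x \<in> E \<Longrightarrow> c *\<^sub>C x \<in> E"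
  using assms
  by (auto simp: closed_invariant_subspace_def complex_vector.subspace_def
      complex_vector.subspace_diff)

lemma closed_invariant_subspace_Int:
  "closed_invariant_subspace A E \<Longrightarrow> closed_invariant_subspace A F \<Longrightarrow>
    closed_invariant_subspace A (E \<inter> F)"
  by (auto simp: closed_invariant_subspace_def complex_vector.subspace_inter)

lemma closed_invariant_subspace_UNIV: "closed_invariant_subspace A UNIV"
  by (simp add: closed_invariant_subspace_def)

text \<open>Solvability of \<open>(1 - B) y = v\<close> inside \<open>E\<close>, by the contraction principle. All resolvents below are
  obtained from it: \<open>B\<close> is \<open>A / z\<close> for large \<open>z\<close>, and \<open>(z0 - z)\<close> times the resolvent at \<open>z0\<close> for \<open>z\<close> near \<open>z0\<close>.\<close>

lemma contraction_solution:
  fixes E :: "'a::complex_banach set"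
  assumes E: "complex_vector.subspace E" "closed E" and v: "v \<in> E"
    and B: "\<And>x. x \<in> E \<Longrightarrow> B x \<in> E" "\<And>x y. x \<in> E \<Longrightarrow> y \<in> E \<Longrightarrow> B x - B y = B (x - y)"
    and q: "\<And>x. x \<in> E \<Longrightarrow> norm (B x) \<le> q * norm x" "0 \<le> q" "q < 1"
  shows "\<exists>y\<in>E. y = v + B y \<and> norm y \<le> norm v / (1 - q)"
proof -
  have "\<exists>!y\<in>E. v + B y = y"
  proof (rule Banach_fix)
    show "complete E" using E(2) by (simp add: complete_eq_closed)
    show "E \<noteq> {}" using v by auto
    show "(\<lambda>y. v + B y) ` E \<subseteq> E"
      using B(1) v E(1) by (auto simp: complex_vector.subspace_def)
    show "dist (v + B x) (v + B y) \<le> q * dist x y" if "x \<in> E" "y \<in> E" for x y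
      using that B(2)[OF that] q(1)[of "x - y"] E(1)
      by (simp add: dist_norm complex_vector.subspace_diff)
  qed (use q in auto)
  then obtain y where y: "y \<in> E" "y = v + B y" by metis
  have "norm y \<le> norm v + q * norm y"
    using norm_triangle_ineq[of v "B y"] q(1)[OF y(1)] y(2) by simp
  then have "norm y \<le> norm v / (1 - q)"
    using q by (simp add: field_simps)
  with y show ?thesis by blast
qed

text \<open>Solvability with a norm bound and injectivity suffice: the inverse is linear because
  solutions are unique.\<close>

lemma not_in_spectrum_onI:
  assumes A: "bounded_clinear A" and E: "closed_invariant_subspace A E"
    and ex: "\<And>x. x \<in> E \<Longrightarrow> \<exists>y\<in>E. z *\<^sub>C y - A y = x \<and> norm y \<le> K * norm x"
    and inj: "\<And>y. y \<in> E \<Longrightarrow> z *\<^sub>C y - A y = 0 \<Longrightarrow> y = 0"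
  shows "z \<notin> spectrum_on E A"
proof -
  note A_simps = bounded_clinear_simps[OF A] and E_simps = closed_invariant_subspaceD[OF E]
  have uniq: "y = y'" if "y \<in> E" "y' \<in> E" "z *\<^sub>C y - A y = z *\<^sub>C y' - A y'" for y y'
  proof -
    have "z *\<^sub>C (y - y') - A (y - y') = (z *\<^sub>C y - A y) - (z *\<^sub>C y' - A y')"
      by (simp add: A_simps complex_vector.scale_right_diff_distrib)
    then show ?thesis
      using inj[of "y - y'"] that E_simps(6) by simp
  qed
  obtain S where S: "\<And>x. x \<in> E \<Longrightarrow> S x \<in> E \<and> z *\<^sub>C S x - A (S x) = x \<and> norm (S x) \<le> K * norm x"
    using ex by metis
  have "bounded_clinear_on E S"
    unfolding bounded_clinear_on_def
  proof (intro conjI ballI allI)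
    show "S ` E \<subseteq> E" using S by blast
    show "S (x + y) = S x + S y" if "x \<in> E" "y \<in> E" for x y
    proof (rule uniq)
      show "z *\<^sub>C S (x + y) - A (S (x + y)) = z *\<^sub>C (S x + S y) - A (S x + S y)"
        using S[of x] S[of y] S[of "x + y"] that E_simps
        by (simp add: A_simps scaleC_add_right algebra_simps)
    qed (use that S E_simps in auto)
    show "S (c *\<^sub>C x) = c *\<^sub>C S x" if "x \<in> E" for c x
    proof (rule uniq)
      have "z *\<^sub>C (c *\<^sub>C S x) - A (c *\<^sub>C S x) = c *\<^sub>C (z *\<^sub>C S x - A (S x))"
        by (simp add: A_simps complex_vector.scale_right_diff_distrib scaleC_scaleC mult.commute)
      then show "z *\<^sub>C S (c *\<^sub>C x) - A (S (c *\<^sub>C x)) = z *\<^sub>C (c *\<^sub>C S x) - A (c *\<^sub>C S x)"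
        using S[of x] S[of "c *\<^sub>C x"] that E_simps by simp
    qed (use that S E_simps in auto)
    show "\<exists>K. \<forall>x\<in>E. norm (S x) \<le> K * norm x" using S by blast
  qed
  moreover have "S (z *\<^sub>C x - A x) = x" if "x \<in> E" for x
    by (rule uniq) (use S[of "z *\<^sub>C x - A x"] that E_simps in auto)
  ultimately show ?thesis
    unfolding spectrum_on_def using S by blast
qed

definition resolvent_on :: "'a set \<Rightarrow> ('a::complex_normed_vector \<Rightarrow> 'a) \<Rightarrow> complex \<Rightarrow> 'a \<Rightarrow> 'a" where
  "resolvent_on E A z x = (THE y. y \<in> E \<and> z *\<^sub>C y - A y = x)"

lemma injective_off_spectrum_on:
  assumes E: "complex_vector.subspace E" and "z \<notin> spectrum_on E A" "y \<in> E" "y' \<in> E"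
    "z *\<^sub>C y - A y = z *\<^sub>C y' - A y'"
  shows "y = y'"
  using assms(2-) unfolding spectrum_on_def by (smt (verit) mem_Collect_eq)

lemma resolvent_on_props:
  assumes E: "closed_invariant_subspace A E" and z: "z \<notin> spectrum_on E A"
  shows "x \<in> E \<Longrightarrow> resolvent_on E A z x \<in> E"
    "x \<in> E \<Longrightarrow> z *\<^sub>C resolvent_on E A z x - A (resolvent_on E A z x) = x"
    "y \<in> E \<Longrightarrow> z *\<^sub>C y - A y = x \<Longrightarrow> resolvent_on E A z x = y"
    "\<exists>K>0. \<forall>x\<in>E. norm (resolvent_on E A z x) \<le> K * norm x"
proof -
  note E_simps = closed_invariant_subspaceD[OF E]
  obtain S where S: "bounded_clinear_on E S" "\<And>x. x \<in> E \<Longrightarrow> z *\<^sub>C S x - A (S x) = x"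
    using z unfolding spectrum_on_def by blast
  have S_in: "S x \<in> E" if "x \<in> E" for x
    using S(1) that by (auto simp: bounded_clinear_on_def)
  show 3: "resolvent_on E A z x = y" if "y \<in> E" "z *\<^sub>C y - A y = x" for x y
    unfolding resolvent_on_def
    using that injective_off_spectrum_on[OF E_simps(1) z] by (intro the_equality) auto
  have eq: "resolvent_on E A z x = S x" if "x \<in> E" for x
    using that S S_in by (intro 3) auto
  show "x \<in> E \<Longrightarrow> resolvent_on E A z x \<in> E"
    "x \<in> E \<Longrightarrow> z *\<^sub>C resolvent_on E A z x - A (resolvent_on E A z x) = x"
    using S S_in eq by auto
  obtain K where K: "\<And>x. x \<in> E \<Longrightarrow> norm (S x) \<le> K * norm x"
    using S(1) unfolding bounded_clinear_on_def by blast
  have "norm (S x) \<le> (\<bar>K\<bar> + 1) * norm x" if "x \<in> E" for x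
    using K[OF that] by (rule order_trans) (intro mult_right_mono, auto)
  then show "\<exists>K>0. \<forall>x\<in>E. norm (resolvent_on E A z x) \<le> K * norm x"
    using eq by (intro exI[of _ "\<bar>K\<bar> + 1"]) auto
qed

lemma spectrum_on_bounded:
  fixes A :: "'a::complex_banach \<Rightarrow> 'a"
  assumes A: "bounded_clinear A" and E: "closed_invariant_subspace A E"
    and R: "\<And>x. norm (A x) \<le> R * norm x" "R > 0"
  shows "spectrum_on E A \<subseteq> cball 0 R"
proof -
  note A_simps = bounded_clinear_simps[OF A] and E_simps = closed_invariant_subspaceD[OF E]
  have "z \<notin> spectrum_on E A" if z: "cmod z > R" for z
  proof (rule not_in_spectrum_onI[OF A E])
    have z0: "z \<noteq> 0" using z R by auto
    fix x assume x: "x \<in> E"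
    have q: "R / cmod z < 1" using z R(2) by (simp add: divide_less_eq)
    have "\<exists>y\<in>E. y = inverse z *\<^sub>C x + inverse z *\<^sub>C A y \<and>
      norm y \<le> norm (inverse z *\<^sub>C x) / (1 - R / cmod z)"
    proof (rule contraction_solution[OF E_simps(1,2)])
      show "inverse z *\<^sub>C x \<in> E" using x E_simps by auto
      show "norm (inverse z *\<^sub>C A w) \<le> R / cmod z * norm w" for w
      proof -
        have "norm (inverse z *\<^sub>C A w) = inverse (cmod z) * norm (A w)"
          by (simp add: norm_scaleC norm_inverse)
        also have "\<dots> \<le> inverse (cmod z) * (R * norm w)"
          by (intro mult_left_mono R(1)) simp
        finally show ?thesis by (simp add: divide_inverse mult_ac)
      qed
      show "inverse z *\<^sub>C A w \<in> E" if "w \<in> E" for w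
        using that E_simps(3,7) by blast
      show "inverse z *\<^sub>C A w - inverse z *\<^sub>C A v = inverse z *\<^sub>C A (w - v)" for w v
        by (simp add: A_simps complex_vector.scale_right_diff_distrib)
    qed (use R(2) q in auto)
    then obtain y where y: "y \<in> E" "y = inverse z *\<^sub>C x + inverse z *\<^sub>C A y"
      "norm y \<le> norm (inverse z *\<^sub>C x) / (1 - R / cmod z)" by blast
    have "z *\<^sub>C y = z *\<^sub>C (inverse z *\<^sub>C x + inverse z *\<^sub>C A y)"
      by (rule arg_cong[OF y(2)])
    then have "z *\<^sub>C y - A y = x"
      using z0 by (simp add: scaleC_add_right scaleC_scaleC scaleC_one)
    moreover have "norm (inverse z *\<^sub>C x) / (1 - R / cmod z)
        = (inverse (cmod z) / (1 - R / cmod z)) * norm x"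
      by (simp add: norm_scaleC norm_inverse)
    ultimately show "\<exists>y\<in>E. z *\<^sub>C y - A y = x \<and> norm y \<le> (inverse (cmod z) / (1 - R / cmod z)) * norm x"
      using y(1,3) by auto
  next
    fix y assume "z *\<^sub>C y - A y = 0"
    then have "norm (z *\<^sub>C y) = norm (A y)" by simp
    with R(1)[of y] have "cmod z * norm y \<le> R * norm y" by (simp add: norm_scaleC)
    with z show "y = 0" using mult_right_less_imp_less[of R "norm y" "cmod z"] 
      by (metis mult_le_cancel_right norm_le_zero_iff not_le)
  qed
  then show ?thesis by (auto simp: not_less[symmetric])
qed

lemma resolvent_on_perturb:
  fixes A :: "'a::complex_banach \<Rightarrow> 'a"
  assumes A: "bounded_clinear A" and E: "closed_invariant_subspace A E"
    and z0: "z0 \<notin> spectrum_on E A"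
    and K: "\<And>x. x \<in> E \<Longrightarrow> norm (resolvent_on E A z0 x) \<le> K * norm x" "K > 0"
    and z: "cmod (z - z0) * K \<le> 1 / 2"
  shows "z \<notin> spectrum_on E A"
    and "x \<in> E \<Longrightarrow> norm (resolvent_on E A z x) \<le> 2 * K * norm x"
proof -
  note A_simps = bounded_clinear_simps[OF A] and E_simps = closed_invariant_subspaceD[OF E]
  note S_props = resolvent_on_props[OF E z0]
  define S where "S = resolvent_on E A z0"
  have S_diff: "S x - S y = S (x - y)" if "x \<in> E" "y \<in> E" for x y
    unfolding S_def
  proof (rule S_props(3)[symmetric])
    have "z0 *\<^sub>C (S x - S y) - A (S x - S y) = (z0 *\<^sub>C S x - A (S x)) - (z0 *\<^sub>C S y - A (S y))"
      by (simp add: A_simps complex_vector.scale_right_diff_distrib)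
    then show "z0 *\<^sub>C (resolvent_on E A z0 x - resolvent_on E A z0 y)
        - A (resolvent_on E A z0 x - resolvent_on E A z0 y) = x - y"
      using S_props(2) that by (simp add: S_def)
  qed (use that S_props E_simps in auto)
  have ex: "\<exists>y\<in>E. z *\<^sub>C y - A y = x \<and> norm y \<le> 2 * K * norm x" if x: "x \<in> E" for x
  proof -
    have "\<exists>y\<in>E. y = S x + S ((z0 - z) *\<^sub>C y) \<and> norm y \<le> norm (S x) / (1 - 1 / 2)"
    proof (rule contraction_solution[OF E_simps(1,2)])
      fix w assume w: "w \<in> E"
      have "norm (S ((z0 - z) *\<^sub>C w)) \<le> K * (cmod (z0 - z) * norm w)"
        using K(1)[of "(z0 - z) *\<^sub>C w"] w E_simps by (simp add: S_def norm_scaleC)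
      also have "\<dots> = (cmod (z - z0) * K) * norm w" by (simp add: norm_minus_commute)
      also have "\<dots> \<le> 1 / 2 * norm w" using z by (intro mult_right_mono) auto
      finally show "norm (S ((z0 - z) *\<^sub>C w)) \<le> 1 / 2 * norm w" .
    qed (use x E_simps S_props in \<open>auto simp: S_def[symmetric] S_diff complex_vector.scale_right_diff_distrib\<close>)
    then obtain y where y: "y \<in> E" "y = S x + S ((z0 - z) *\<^sub>C y)"
      "norm y \<le> norm (S x) / (1 - 1 / 2)" by blast
    have in1: "x + (z0 - z) *\<^sub>C y \<in> E" using x y E_simps by auto
    have "S x + S ((z0 - z) *\<^sub>C y) = S (x + (z0 - z) *\<^sub>C y)"
      using S_diff[of "x + (z0 - z) *\<^sub>C y" x] x y(1) E_simps
      by (metis add_diff_cancel_left' diff_add_cancel add.commute)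
    with y(2) have "y = S (x + (z0 - z) *\<^sub>C y)" by simp
    then have "z0 *\<^sub>C y - A y = x + (z0 - z) *\<^sub>C y"
      using S_props(2)[OF in1] by (simp add: S_def)
    then have "z *\<^sub>C y - A y = x"
      by (simp add: complex_vector.scale_left_diff_distrib algebra_simps)
    moreover have "norm y \<le> 2 * K * norm x"
      using y(3) K(1)[OF x] by (simp add: S_def)
    ultimately show ?thesis using y(1) by blast
  qed
  show 1: "z \<notin> spectrum_on E A"
  proof (rule not_in_spectrum_onI[OF A E ex])
    fix y assume y: "y \<in> E" "z *\<^sub>C y - A y = 0"
    then have "z0 *\<^sub>C y - A y = (z0 - z) *\<^sub>C y"
      by (simp add: complex_vector.scale_left_diff_distrib)
    then have "S ((z0 - z) *\<^sub>C y) = y"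
      using S_props(3)[OF y(1)] by (simp add: S_def)
    then have "norm y \<le> K * (cmod (z0 - z) * norm y)"
      using K(1)[of "(z0 - z) *\<^sub>C y"] y(1) E_simps by (simp add: S_def norm_scaleC)
    also have "\<dots> = (cmod (z - z0) * K) * norm y" by (simp add: norm_minus_commute)
    also have "\<dots> \<le> 1 / 2 * norm y" using z by (intro mult_right_mono) auto
    finally show "y = 0" by simp
  qed
  show "norm (resolvent_on E A z x) \<le> 2 * K * norm x" if "x \<in> E"
    using ex[OF that] resolvent_on_props(3)[OF E 1] by metis
qed

lemma open_resolvent_set_on:
  fixes A :: "'a::complex_banach \<Rightarrow> 'a"
  assumes A: "bounded_clinear A" and E: "closed_invariant_subspace A E"
  shows "open (- spectrum_on E A)"
proof (rule openI)
  fix z0 assume "z0 \<in> - spectrum_on E A"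
  then have z0: "z0 \<notin> spectrum_on E A" by simp
  obtain K where K: "K > 0" "\<And>x. x \<in> E \<Longrightarrow> norm (resolvent_on E A z0 x) \<le> K * norm x"
    using resolvent_on_props(4)[OF E z0] by blast
  have "z \<notin> spectrum_on E A" if "dist z0 z < 1 / (2 * K)" for z
  proof (rule resolvent_on_perturb(1)[OF A E z0 K(2,1)])
    have "cmod (z - z0) < 1 / (2 * K)" using that by (simp add: dist_norm norm_minus_commute)
    then show "cmod (z - z0) * K \<le> 1 / 2" using K(1) by (simp add: field_simps)
  qed
  then have "ball z0 (1 / (2 * K)) \<subseteq> - spectrum_on E A" by auto
  moreover have "1 / (2 * K) > 0" using K(1) by simp
  ultimately show "\<exists>e>0. ball z0 e \<subseteq> - spectrum_on E A" by blast
qed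

text \<open>The resolvent identity gives
  \<open>R z x - R z0 x + (z - z0) R z0 (R z0 x) = (z - z0)\<^sup>2 R z (R z0 (R z0 x))\<close>, and \<open>R z\<close> is bounded
  near \<open>z0\<close>.\<close>

lemma resolvent_on_analytic:
  fixes A :: "'a::complex_banach \<Rightarrow> 'a"
  assumes A: "bounded_clinear A" and E: "closed_invariant_subspace A E" and x: "x \<in> E"
  shows "vector_analytic_on (\<lambda>z. resolvent_on E A z x) (- spectrum_on E A)"
  unfolding vector_analytic_on_def
proof
  fix z0 assume "z0 \<in> - spectrum_on E A"
  then have z0: "z0 \<notin> spectrum_on E A" by simp
  note A_simps = bounded_clinear_simps[OF A] and E_simps = closed_invariant_subspaceD[OF E]
  obtain K where K: "K > 0" "\<And>x. x \<in> E \<Longrightarrow> norm (resolvent_on E A z0 x) \<le> K * norm x"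
    using resolvent_on_props(4)[OF E z0] by blast
  let ?R = "resolvent_on E A"
  define y where "y = ?R z0 x"
  define w where "w = ?R z0 y"
  have y: "y \<in> E" "z0 *\<^sub>C y - A y = x" and w: "w \<in> E" "z0 *\<^sub>C w - A w = y"
    unfolding y_def w_def using resolvent_on_props(1,2)[OF E z0] x by auto
  have "norm (?R z x - ?R z0 x - (z - z0) *\<^sub>C (- w)) / norm (z - z0) \<le> cmod (z - z0) * (2 * K * norm w)"
    if z: "cmod (z - z0) < 1 / (2 * K)" for z
  proof -
    have small: "cmod (z - z0) * K \<le> 1 / 2" using z K(1) by (simp add: field_simps)
    note zs = resolvent_on_perturb[OF A E z0 K(2,1) small]
    define v where "v = ?R z w"
    have v: "v \<in> E" "z *\<^sub>C v - A v = w" "norm v \<le> 2 * K * norm w"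
      unfolding v_def using resolvent_on_props(1,2)[OF E zs(1)] zs(2) w(1) by auto
    have "?R z x = y - (z - z0) *\<^sub>C w + ((z - z0) * (z - z0)) *\<^sub>C v"
    proof (rule resolvent_on_props(3)[OF E zs(1)])
      have Av: "A v = z *\<^sub>C v - w" and Aw: "A w = z0 *\<^sub>C w - y" and Ay: "A y = z0 *\<^sub>C y - x"
        using v(2) w(2) y(2) by (auto simp: algebra_simps)
      show "z *\<^sub>C (y - (z - z0) *\<^sub>C w + ((z - z0) * (z - z0)) *\<^sub>C v)
          - A (y - (z - z0) *\<^sub>C w + ((z - z0) * (z - z0)) *\<^sub>C v) = x"
        unfolding A_simps Av Aw Ay
        by (simp add: scaleC_add_right complex_vector.scale_left_diff_distrib
            complex_vector.scale_right_diff_distrib scaleC_scaleC algebra_simps)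
          (simp add: algebra_simps flip: scaleC_add_left)
    qed (use v w y E_simps in auto)
    then have "?R z x - ?R z0 x - (z - z0) *\<^sub>C (- w) = ((z - z0) * (z - z0)) *\<^sub>C v"
      by (simp add: y_def)
    then have "norm (?R z x - ?R z0 x - (z - z0) *\<^sub>C (- w)) / norm (z - z0) = cmod (z - z0) * norm v"
      by (simp add: norm_scaleC norm_mult)
    also have "\<dots> \<le> cmod (z - z0) * (2 * K * norm w)"
      using v(3) by (intro mult_left_mono) auto
    finally show ?thesis .
  qed
  moreover have "\<forall>\<^sub>F z in at z0. cmod (z - z0) < 1 / (2 * K)"
    using K(1) unfolding eventually_at dist_norm by (intro exI[of _ "1 / (2 * K)"]) auto
  ultimately have ev: "\<forall>\<^sub>F z in at z0. norm (norm (?R z x - ?R z0 x - (z - z0) *\<^sub>C (- w)) / norm (z - z0))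
      \<le> cmod (z - z0) * (2 * K * norm w)"
    by (auto elim!: eventually_mono)
  have "((\<lambda>z. cmod (z - z0) * (2 * K * norm w)) \<longlongrightarrow> cmod (z0 - z0) * (2 * K * norm w)) (at z0)"
    by (intro tendsto_intros)
  then have "((\<lambda>z. cmod (z - z0) * (2 * K * norm w)) \<longlongrightarrow> 0) (at z0)" by simp
  with ev have "((\<lambda>z. norm (?R z x - ?R z0 x - (z - z0) *\<^sub>C (- w)) / norm (z - z0)) \<longlongrightarrow> 0) (at z0)"
    by (rule Lim_null_comparison)
  then have "((\<lambda>z. ?R z x) has_derivative (\<lambda>h. h *\<^sub>C (- w))) (at z0)"
    unfolding has_derivative_iff_norm using bounded_linear_scaleC_left by blast
  then show "\<exists>d. ((\<lambda>z. ?R z x) has_derivative (\<lambda>h. h *\<^sub>C d)) (at z0)" ..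
qed

section \<open>The single-valued extension property\<close>

lemma local_resolventI:
  assumes "open U" "l \<in> U" "vector_analytic_on u U" "\<And>z. z \<in> U \<Longrightarrow> z *\<^sub>C u z - A (u z) = x"
  shows "l \<in> local_resolvent A x"
  unfolding local_resolvent_def using assms by (intro CollectI exI[of _ U] exI[of _ u]) auto

lemma local_resolventE:
  assumes "l \<in> local_resolvent A x"
  obtains U u where "open U" "l \<in> U" "vector_analytic_on u U" "\<forall>z\<in>U. z *\<^sub>C u z - A (u z) = x"
  using assms unfolding local_resolvent_def by (elim CollectE exE conjE) (rule that)

lemma spectrum_on_subset_local_spectrum:
  fixes A :: "'a::complex_banach \<Rightarrow> 'a"
  assumes A: "bounded_clinear A" and E: "closed_invariant_subspace A E" and x: "x \<in> E"
  shows "local_spectrum A x \<subseteq> spectrum_on E A"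
proof
  fix z assume "z \<in> local_spectrum A x"
  moreover have "z \<in> local_resolvent A x" if "z \<notin> spectrum_on E A"
    using that open_resolvent_set_on[OF A E] resolvent_on_analytic[OF A E x]
      resolvent_on_props(2)[OF E _ x]
    by (intro local_resolventI[of "- spectrum_on E A"]) auto
  ultimately show "z \<in> spectrum_on E A" by (auto simp: local_spectrum_def)
qed

lemma local_spectrum_diff:
  assumes A: "bounded_clinear A"
  shows "local_spectrum A (x - y) \<subseteq> local_spectrum A x \<union> local_spectrum A y"
proof -
  have "l \<in> local_resolvent A (x - y)" if l: "l \<in> local_resolvent A x" "l \<in> local_resolvent A y" for l
  proof -
    obtain U u where U: "open U" "l \<in> U" "vector_analytic_on u U" "\<forall>z\<in>U. z *\<^sub>C u z - A (u z) = x"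
      using l(1) by (rule local_resolventE)
    obtain V v where V: "open V" "l \<in> V" "vector_analytic_on v V" "\<forall>z\<in>V. z *\<^sub>C v z - A (v z) = y"
      using l(2) by (rule local_resolventE)
    have "vector_analytic_on (\<lambda>z. u z - v z) (U \<inter> V)"
      by (rule vector_analytic_diff; rule vector_analytic_subset[OF U(3)] vector_analytic_subset[OF V(3)]) auto
    moreover have "z *\<^sub>C (u z - v z) - A (u z - v z) = x - y" if "z \<in> U \<inter> V" for z
    proof -
      have "z *\<^sub>C (u z - v z) - A (u z - v z) = (z *\<^sub>C u z - A (u z)) - (z *\<^sub>C v z - A (v z))"
        by (simp add: bounded_clinear_simps[OF A] complex_vector.scale_right_diff_distrib)
      then show ?thesis using that U(4) V(4) by simp
    qed
    ultimately show ?thesis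
      using U(1,2) V(1,2) by (intro local_resolventI[of "U \<inter> V"]) auto
  qed
  then show ?thesis by (auto simp: local_spectrum_def)
qed

lemma decomposableE:
  assumes "decomposable A" "open U" "open W" "U \<union> W = UNIV"
  obtains E F where "closed_invariant_subspace A E" "closed_invariant_subspace A F"
    "\<And>x. \<exists>e\<in>E. \<exists>f\<in>F. x = e + f" "spectrum_on E A \<subseteq> U" "spectrum_on F A \<subseteq> W"
proof -
  obtain E F where EF: "closed_invariant_subspace A E" "closed_invariant_subspace A F"
    and sum: "{x + y |x y. x \<in> E \<and> y \<in> F} = UNIV" and "spectrum_on E A \<subseteq> U" "spectrum_on F A \<subseteq> W"
    using assms(1)[unfolded decomposable_def, rule_format, of U W] assms(2-4) by auto
  moreover have "\<exists>e\<in>E. \<exists>f\<in>F. x = e + f" for x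
    using sum by (fastforce simp: set_eq_iff)
  ultimately show thesis using that by blast
qed

text \<open>
  If \<open>(z - A) u z = 0\<close> near a point, split the space along two overlapping half-planes as \<open>E + F\<close>.
  To the right of the overlap, \<open>u z = e + f\<close> with \<open>(z - A) e = - (z - A) f\<close> in \<open>E \<inter> F\<close>. The
  resolvent of \<open>A\<close> on \<open>E\<close> leaves \<open>E \<inter> F\<close> invariant near infinity, and so, the half-plane
  being connected, everywhere to the right of the overlap; hence \<open>e\<close> lies in \<open>F\<close>. So \<open>u\<close> takes
  values in \<open>F\<close>, and to the left of the overlap \<open>z - A\<close> is injective on \<open>F\<close>.
\<close>

lemma decomposable_single_valued_extension:
  fixes A :: "'a::complex_banach \<Rightarrow> 'a"
  assumes A: "bounded_clinear A" and dec: "decomposable A"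
    and U: "open U" and u: "vector_analytic_on u U"
    and eq: "\<And>z. z \<in> U \<Longrightarrow> z *\<^sub>C u z - A (u z) = 0" and z0: "z0 \<in> U"
  shows "u z0 = 0"
proof -
  note A_simps = bounded_clinear_simps[OF A]
  obtain r where r: "r > 0" "ball z0 r \<subseteq> U" using U z0 by (rule openE)
  define a b where "a = Re z0 - r / 3" and "b = Re z0 + r / 3"
  have "a < b" using r by (simp add: a_def b_def)
  then have "{z. Re z < b} \<union> {z. Re z > a} = UNIV" by auto
  then obtain E F where E: "closed_invariant_subspace A E" and F: "closed_invariant_subspace A F"
    and sum: "\<And>x. \<exists>e\<in>E. \<exists>f\<in>F. x = e + f"
    and \<sigma>E: "spectrum_on E A \<subseteq> {z. Re z < b}" and \<sigma>F: "spectrum_on F A \<subseteq> {z. Re z > a}"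
    using decomposableE[OF dec open_halfspace_Re_lt open_halfspace_Re_gt] by metis
  note E_simps = closed_invariant_subspaceD[OF E] and F_simps = closed_invariant_subspaceD[OF F]
  have EF: "closed_invariant_subspace A (E \<inter> F)"
    using E F by (rule closed_invariant_subspace_Int)
  obtain R where R: "R > 0" "\<And>x. norm (A x) \<le> R * norm x"
    using bounded_clinear_bound[OF A] by blast
  have res: "resolvent_on E A z v \<in> E \<inter> F" if v: "v \<in> E \<inter> F" and z: "Re z > b" for v z
  proof (rule analytic_in_subspace_continuation[where U = "{z. Re z > b}" and V = "{z. Re z > max b R}"
        and u = "\<lambda>z. resolvent_on E A z v"])
    show "vector_analytic_on (\<lambda>z. resolvent_on E A z v) {z. Re z > b}"
      using v \<sigma>E by (intro vector_analytic_subset[OF resolvent_on_analytic[OF A E]]) auto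
    show "open {z. Re z > max b R}" by (rule open_halfspace_Re_gt)
    have "complex_of_real (max b R + 1) \<in> {z. Re z > max b R}" by (simp add: max_def)
    then show "{z. Re z > max b R} \<noteq> {}" by blast
    fix z assume "z \<in> {z. Re z > max b R}"
    then have zE: "z \<notin> spectrum_on E A" and "cmod z > R"
      using \<sigma>E complex_Re_le_cmod[of z] by auto
    then have "z \<notin> spectrum_on (E \<inter> F) A"
      using spectrum_on_bounded[OF A EF R(2,1)] by auto
    note EFv = resolvent_on_props(1,2)[OF EF this v]
    have "resolvent_on E A z v = resolvent_on (E \<inter> F) A z v"
      using EFv by (intro resolvent_on_props(3)[OF E zE]) auto
    then show "resolvent_on E A z v \<in> E \<inter> F" using EFv by simp
  qed (use z closed_invariant_subspaceD(1,2)[OF EF] in \<open>auto simp: open_halfspace_Re_gt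
      intro!: convex_connected convex_halfspace_Re_gt\<close>)
  have inF: "u z \<in> F" if z: "z \<in> ball z0 r" "Re z > b" for z
  proof -
    obtain e f where ef: "e \<in> E" "f \<in> F" "u z = e + f"
      using sum by blast
    have "z *\<^sub>C e - A e = - (z *\<^sub>C f - A f)"
      using eq[of z] z r(2) ef(3) by (auto simp: A_simps scaleC_add_right algebra_simps add_eq_0_iff)
    moreover have "z *\<^sub>C e - A e \<in> E" "0 - (z *\<^sub>C f - A f) \<in> F"
      using ef E_simps by (auto intro!: F_simps)
    ultimately have "z *\<^sub>C e - A e \<in> E \<inter> F" by simp
    moreover have "resolvent_on E A z (z *\<^sub>C e - A e) = e"
      using \<sigma>E z ef by (intro resolvent_on_props(3)[OF E]) auto
    ultimately have "e \<in> F" using res[of "z *\<^sub>C e - A e" z] z by auto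
    with ef F_simps show ?thesis by auto
  qed
  have uB: "vector_analytic_on u (ball z0 r)" using u r(2) by (rule vector_analytic_subset)
  have uF: "u z \<in> F" if "z \<in> ball z0 r" for z
  proof (rule analytic_in_subspace_continuation[OF uB _ _ _ _ _ F_simps(1,2) _ that])
    show "open (ball z0 r \<inter> {z. Re z > b})" by (intro open_Int open_ball open_halfspace_Re_gt)
    have "z0 + of_real (r / 2) \<in> ball z0 r \<inter> {z. Re z > b}"
      using r by (simp add: dist_norm b_def)
    then show "ball z0 r \<inter> {z. Re z > b} \<noteq> {}" by blast
  qed (use inF in auto)
  have "u z0 \<in> {0}"
  proof (rule analytic_in_subspace_continuation[OF uB])
    show "open (ball z0 r \<inter> {z. Re z < a})" by (intro open_Int open_ball open_halfspace_Re_lt)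
    have "z0 - of_real (r / 2) \<in> ball z0 r \<inter> {z. Re z < a}"
      using r by (simp add: dist_norm a_def)
    then show "ball z0 r \<inter> {z. Re z < a} \<noteq> {}" by blast
    fix z assume z: "z \<in> ball z0 r \<inter> {z. Re z < a}"
    then have "z \<notin> spectrum_on F A" using \<sigma>F by auto
    from injective_off_spectrum_on[OF F_simps(1) this, of "u z" 0]
    show "u z \<in> {0}" using z uF eq r(2) F_simps by (auto simp: A_simps)
  qed (use r in auto)
  then show ?thesis by simp
qed

text \<open>By the single-valued extension property, local solutions agree where they are both defined, so
  choosing one for each point gives a function that is locally equal to any of them.\<close>

lemma local_resolvent_function:
  fixes A :: "'a::complex_banach \<Rightarrow> 'a"
  assumes A: "bounded_clinear A" and dec: "decomposable A"
  obtains u where "vector_analytic_on u (local_resolvent A x)"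
    "\<And>z. z \<in> local_resolvent A x \<Longrightarrow> z *\<^sub>C u z - A (u z) = x"
proof -
  have "\<forall>l\<in>local_resolvent A x. \<exists>U u. open U \<and> l \<in> U \<and> vector_analytic_on u U \<and>
      (\<forall>z\<in>U. z *\<^sub>C u z - A (u z) = x)"
    by (auto simp: local_resolvent_def)
  then obtain U v where Uv: "\<And>l. l \<in> local_resolvent A x \<Longrightarrow>
      open (U l) \<and> l \<in> U l \<and> vector_analytic_on (v l) (U l) \<and> (\<forall>z\<in>U l. z *\<^sub>C v l z - A (v l z) = x)"
    by metis
  define u where "u z = v z z" for z
  have agree: "v l z = u z" if l: "l \<in> local_resolvent A x" and z: "z \<in> U l" for l z
  proof -
    have z': "z \<in> local_resolvent A x"
      using Uv[OF l] z by (intro local_resolventI[of "U l" _ "v l"]) auto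
    have "v l z - v z z = 0"
    proof (rule decomposable_single_valued_extension[OF A dec, where U = "U l \<inter> U z"
          and u = "\<lambda>w. v l w - v z w"])
      show "open (U l \<inter> U z)" by (simp add: open_Int Uv l z')
      show "vector_analytic_on (\<lambda>w. v l w - v z w) (U l \<inter> U z)"
      proof (rule vector_analytic_diff)
        show "vector_analytic_on (v l) (U l \<inter> U z)"
          by (rule vector_analytic_subset[of _ "U l"]) (simp_all add: Uv l)
        show "vector_analytic_on (v z) (U l \<inter> U z)"
          by (rule vector_analytic_subset[of _ "U z"]) (simp_all add: Uv z')
      qed
      show "w *\<^sub>C (v l w - v z w) - A (v l w - v z w) = 0" if "w \<in> U l \<inter> U z" for w
      proof -
        have "w *\<^sub>C (v l w - v z w) - A (v l w - v z w)
            = (w *\<^sub>C v l w - A (v l w)) - (w *\<^sub>C v z w - A (v z w))"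
          by (simp add: bounded_clinear_simps[OF A] complex_vector.scale_right_diff_distrib)
        also have "\<dots> = x - x" using that Uv[OF l] Uv[OF z'] by (metis IntD1 IntD2)
        finally show ?thesis by simp
      qed
    qed (simp add: z z' Uv)
    then show ?thesis by (simp add: u_def)
  qed
  show thesis
  proof (rule that[of u])
    show "vector_analytic_on u (local_resolvent A x)"
      unfolding vector_analytic_on_def
    proof
      fix l assume l: "l \<in> local_resolvent A x"
      then obtain d where "(v l has_derivative (\<lambda>h. h *\<^sub>C d)) (at l)"
        using Uv[OF l] unfolding vector_analytic_on_def by blast
      then have "(u has_derivative (\<lambda>h. h *\<^sub>C d)) (at l)"
        using Uv[OF l] agree[OF l]
        by (intro has_derivative_transform_within_open[of "v l" _ l UNIV "U l" u]) auto
      then show "\<exists>d. (u has_derivative (\<lambda>h. h *\<^sub>C d)) (at l)" ..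
    qed
    show "z *\<^sub>C u z - A (u z) = x" if "z \<in> local_resolvent A x" for z
      using Uv[OF that] by (simp add: u_def)
  qed
qed


section \<open>Bounded operators\<close>

lemma bounded_clinearI:
  assumes "\<And>x y. f (x + y) = f x + f y" "\<And>c x. f (c *\<^sub>C x) = c *\<^sub>C f x" "\<And>x. norm (f x) \<le> K * norm x"
  shows "bounded_clinear f"
  using assms unfolding bounded_clinear_def
  by (auto intro!: bounded_linear_intro[where K = K] simp: scaleR_scaleC mult.commute)

lemma bounded_clinear_id: "bounded_clinear (\<lambda>x. x)"
  by (rule bounded_clinearI[where K = 1]) auto

lemma bounded_clinear_scaleC: "bounded_clinear (\<lambda>x. c *\<^sub>C x)"
  by (rule bounded_clinearI[where K = "cmod c"])
    (auto simp: scaleC_add_right scaleC_scaleC norm_scaleC mult.commute)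

lemma bounded_clinear_compose: "bounded_clinear f \<Longrightarrow> bounded_clinear g \<Longrightarrow> bounded_clinear (\<lambda>x. f (g x))"
  unfolding bounded_clinear_def by (auto intro: bounded_linear_compose)

lemma bounded_clinear_add: "bounded_clinear f \<Longrightarrow> bounded_clinear g \<Longrightarrow> bounded_clinear (\<lambda>x. f x + g x)"
  unfolding bounded_clinear_def by (auto intro: bounded_linear_add simp: scaleC_add_right)

lemma bounded_clinear_sub: "bounded_clinear f \<Longrightarrow> bounded_clinear g \<Longrightarrow> bounded_clinear (\<lambda>x. f x - g x)"
  unfolding bounded_clinear_def
  by (auto intro: bounded_linear_sub simp: complex_vector.scale_right_diff_distrib)

lemma bounded_clinear_funpow: "bounded_clinear f \<Longrightarrow> bounded_clinear (f ^^ n)"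
proof (induction n)
  case 0
  then show ?case using bounded_clinear_id by (simp add: id_def)
next
  case (Suc n)
  then show ?case using bounded_clinear_compose[of f "f ^^ n"] by (simp add: o_def)
qed

lemma bounded_clinear_shift: "bounded_clinear A \<Longrightarrow> bounded_clinear (\<lambda>x. A x - l *\<^sub>C x)"
  by (intro bounded_clinear_sub bounded_clinear_scaleC)

lemma funpow_norm_le:
  fixes B :: "'a::real_normed_vector \<Rightarrow> 'a"
  assumes "\<And>x. norm (B x) \<le> K * norm x" "K \<ge> 0"
  shows "norm ((B ^^ n) x) \<le> K ^ n * norm x"
proof (induction n)
  case (Suc n)
  have "norm ((B ^^ Suc n) x) \<le> K * norm ((B ^^ n) x)" by (simp add: assms(1))
  also have "\<dots> \<le> K * (K ^ n * norm x)" by (intro mult_left_mono Suc assms(2))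
  finally show ?case by (simp add: mult_ac)
qed simp

lemma complex_functional_bound:
  assumes "complex_functional \<phi>"
  obtains K where "K > 0" "\<And>x. cmod (\<phi> x) \<le> K * norm x"
  using assms bounded_linear.pos_bounded unfolding complex_functional_def
  by (metis mult.commute)

section \<open>The local spectral radius\<close>

text \<open>Only the expansion near the origin has to be known; Taylor's theorem extends it to the whole disc,
  where the terms of the convergent series are bounded.\<close>

lemma holomorphic_series_coeff_bound:
  assumes h: "h holomorphic_on ball 0 r" and r0: "0 < r0"
    and ser: "\<And>w. cmod w < r0 \<Longrightarrow> (\<lambda>n. c n * w ^ n) sums h w"
    and r1: "0 < r1" "r1 < r"
  shows "\<exists>M>0. \<forall>n. cmod (c n) \<le> M / r1 ^ n"
proof -
  have "\<forall>\<^sub>F w in nhds 0. (\<lambda>n. c n * w ^ n) sums h w"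
    using ser r0 unfolding eventually_nhds_metric by (intro exI[of _ r0]) auto
  then have "h has_fps_expansion Abs_fps c"
    by (intro has_fps_expansionI) simp
  then have c: "c n = (deriv ^^ n) h 0 / fact n" for n
    using fps_nth_fps_expansion[of h "Abs_fps c" n] by simp
  have "(\<lambda>n. (deriv ^^ n) h 0 / fact n * (of_real r1 - 0) ^ n) sums h (of_real r1)"
    using r1 by (intro holomorphic_power_series[OF h]) auto
  then have "summable (\<lambda>n. c n * of_real r1 ^ n)"
    unfolding c by (auto simp: sums_iff)
  then have "Bseq (\<lambda>n. c n * of_real r1 ^ n)"
    by (intro convergent_imp_Bseq) (auto dest!: summable_LIMSEQ_zero simp: convergent_def)
  then obtain M where "M > 0" "\<And>n. cmod (c n * of_real r1 ^ n) \<le> M"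
    unfolding Bseq_def by blast
  then show ?thesis
    using r1 by (intro exI[of _ M]) (auto simp: norm_mult norm_power field_simps)
qed

text \<open>The Neumann series of the local resolvent function in the variable \<open>w = 1 / (z - l)\<close>.\<close>

lemma Neumann_series_functional:
  fixes B :: "'a::complex_banach \<Rightarrow> 'a"
  assumes B: "bounded_clinear B" and K: "\<And>x. norm (B x) \<le> K * norm x" "K > 0" and \<phi>: "complex_functional \<phi>"
    and u: "u = w *\<^sub>C y + w *\<^sub>C B u" and w: "cmod w * K < 1"
  shows "(\<lambda>k. w ^ Suc k * \<phi> ((B ^^ k) y)) sums \<phi> u"
proof -
  note \<phi>_simps = complex_functional_add[OF \<phi>] complex_functional_scaleC[OF \<phi>]
  note Bn_simps = bounded_clinear_simps[OF bounded_clinear_funpow[OF B]]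
  have part: "\<phi> u = (\<Sum>k<n. w ^ Suc k * \<phi> ((B ^^ k) y)) + w ^ n * \<phi> ((B ^^ n) u)" for n
  proof (induction n)
    case (Suc n)
    have "(B ^^ n) u = (B ^^ n) (w *\<^sub>C y + w *\<^sub>C B u)" using u by (rule arg_cong)
    also have "\<dots> = w *\<^sub>C (B ^^ n) y + w *\<^sub>C (B ^^ Suc n) u"
      by (simp add: Bn_simps funpow_swap1)
    finally have "\<phi> ((B ^^ n) u) = w * \<phi> ((B ^^ n) y) + w * \<phi> ((B ^^ Suc n) u)"
      by (simp only: \<phi>_simps)
    with Suc show ?case by (simp add: algebra_simps)
  qed simp
  obtain C where C: "C > 0" "\<And>x. cmod (\<phi> x) \<le> C * norm x"
    using complex_functional_bound[OF \<phi>] by blast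
  have "norm (w ^ n * \<phi> ((B ^^ n) u)) \<le> (C * norm u) * (cmod w * K) ^ n" for n
  proof -
    have "cmod (\<phi> ((B ^^ n) u)) \<le> C * (K ^ n * norm u)"
      using C(2)[of "(B ^^ n) u"] funpow_norm_le[of B K n u] K C(1)
      by (meson mult_left_mono less_imp_le order_trans)
    then have "cmod w ^ n * cmod (\<phi> ((B ^^ n) u)) \<le> cmod w ^ n * (C * (K ^ n * norm u))"
      by (intro mult_left_mono) auto
    then show ?thesis by (simp add: norm_mult norm_power power_mult_distrib mult_ac)
  qed
  then have "\<forall>\<^sub>F n in sequentially. norm (w ^ n * \<phi> ((B ^^ n) u)) \<le> (C * norm u) * (cmod w * K) ^ n"
    by (rule always_eventually[OF allI])
  moreover have "(\<lambda>n. (C * norm u) * (cmod w * K) ^ n) \<longlonglongrightarrow> (C * norm u) * 0"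
    using w K(2) by (intro tendsto_mult_left LIMSEQ_power_zero) (simp add: abs_mult)
  then have "(\<lambda>n. (C * norm u) * (cmod w * K) ^ n) \<longlonglongrightarrow> 0" by simp
  ultimately have "(\<lambda>n. w ^ n * \<phi> ((B ^^ n) u)) \<longlonglongrightarrow> 0"
    by (rule Lim_null_comparison)
  then have "(\<lambda>n. \<phi> u - w ^ n * \<phi> ((B ^^ n) u)) \<longlonglongrightarrow> \<phi> u - 0"
    by (intro tendsto_diff tendsto_const)
  moreover have "(\<lambda>n. \<phi> u - w ^ n * \<phi> ((B ^^ n) u)) = (\<lambda>n. \<Sum>k<n. w ^ Suc k * \<phi> ((B ^^ k) y))"
  proof
    fix n
    show "\<phi> u - w ^ n * \<phi> ((B ^^ n) u) = (\<Sum>k<n. w ^ Suc k * \<phi> ((B ^^ k) y))"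
      using part[of n] by (simp add: algebra_simps)
  qed
  ultimately show ?thesis unfolding sums_def by simp
qed

text \<open>
  Composed with a functional, the local resolvent function is analytic in \<open>w = 1 / (z - l)\<close> on a
  disc about the origin, and its Taylor coefficients are the values of the functional at
  \<open>(A - l)\<^sup>k y\<close>. Cauchy's estimate gives a bound for each functional, hence a bound in norm.
\<close>

lemma local_spectral_radius:
  fixes A :: "'a::complex_banach \<Rightarrow> 'a"
  assumes A: "bounded_clinear A" and dec: "decomposable A"
    and y: "local_spectrum A y \<subseteq> cball l \<rho>" and \<rho>: "0 \<le> \<rho>" "\<rho> < \<rho>'"
  shows "\<exists>M>0. \<forall>n. norm (((\<lambda>x. A x - l *\<^sub>C x) ^^ n) y) \<le> M * \<rho>' ^ n"
proof -
  define B where "B = (\<lambda>x. A x - l *\<^sub>C x)"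
  have B: "bounded_clinear B" unfolding B_def by (rule bounded_clinear_shift[OF A])
  obtain K where K: "K > 0" "\<And>x. norm (B x) \<le> K * norm x"
    using bounded_clinear_bound[OF B] by blast
  obtain u where u: "vector_analytic_on u (local_resolvent A y)"
    "\<And>z. z \<in> local_resolvent A y \<Longrightarrow> z *\<^sub>C u z - A (u z) = y"
    using local_resolvent_function[OF A dec] by metis
  have in_res: "z \<in> local_resolvent A y" if "dist l z > \<rho>" for z
    using y that by (auto simp: local_spectrum_def)
  \<comment> \<open>Any \<open>r\<close> strictly between \<open>1 / \<rho>'\<close> and \<open>1 / \<rho>\<close> would do; this form covers \<open>\<rho> = 0\<close>.\<close>
  define r where "r = 2 / (\<rho> + \<rho>')"
  have r: "r > 0" "1 / \<rho>' < r" using \<rho> by (auto simp: r_def field_simps)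
  have far: "dist l (l + 1 / w) > \<rho>" if "w \<noteq> 0" "cmod w < r" for w
  proof -
    have "\<rho> < 1 / r" using \<rho> by (simp add: r_def)
    also have "\<dots> < 1 / cmod w" using that r by (simp add: frac_less2)
    finally show ?thesis by (simp add: dist_norm norm_divide)
  qed
  have "\<exists>M. \<forall>n. cmod (\<phi> ((1 / \<rho>' ^ n) *\<^sub>R (B ^^ n) y)) \<le> M" if \<phi>: "complex_functional \<phi>" for \<phi>
  proof -
    define h where "h w = (if w = 0 then 0 else \<phi> (u (l + 1 / w)))" for w
    define c where "c n = (case n of 0 \<Rightarrow> 0 | Suc k \<Rightarrow> \<phi> ((B ^^ k) y))" for n
    define r0 where "r0 = min r (1 / K)"
    have r0: "r0 > 0" using r K by (simp add: r0_def)
    have ser: "(\<lambda>n. c n * w ^ n) sums h w" if w: "cmod w < r0" for w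
    proof (cases "w = 0")
      case True
      have "(\<lambda>n. c n * 0 ^ n) = (\<lambda>n. 0)" by (auto simp: c_def split: nat.splits)
      with True show ?thesis by (simp add: h_def)
    next
      case False
      define v where "v = u (l + 1 / w)"
      have "(l + 1 / w) *\<^sub>C v - A v = y"
        unfolding v_def using w False by (intro u in_res far) (auto simp: r0_def)
      then have "(1 / w) *\<^sub>C v = y + B v"
        by (simp add: B_def scaleC_add_left algebra_simps)
      then have "w *\<^sub>C (1 / w) *\<^sub>C v = w *\<^sub>C (y + B v)" by simp
      then have "v = w *\<^sub>C y + w *\<^sub>C B v"
        using False by (simp add: scaleC_scaleC scaleC_one scaleC_add_right)
      moreover have "cmod w * K < 1" using w K(1) by (simp add: r0_def field_simps)
      ultimately have "(\<lambda>k. w ^ Suc k * \<phi> ((B ^^ k) y)) sums \<phi> v"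
        by (intro Neumann_series_functional[OF B K(2,1) \<phi>])
      then have "(\<lambda>k. c (Suc k) * w ^ Suc k) sums \<phi> v"
        by (simp add: c_def mult.commute)
      then have "(\<lambda>k. c k * w ^ k) sums (\<phi> v + c 0 * w ^ 0)"
        by (rule sums_Suc)
      with False show ?thesis by (simp add: c_def h_def v_def)
    qed
    have "h holomorphic_on (ball 0 r0 \<union> (ball 0 r - {0}))"
    proof (rule holomorphic_on_Un)
      show "h holomorphic_on ball 0 r0"
        using ser by (intro power_series_holomorphic[where a = c]) auto
      have img: "(\<lambda>w. l + 1 / w) ` (ball 0 r - {0}) \<subseteq> {z. dist l z > \<rho>}"
        using far by auto
      have "(\<lambda>z. \<phi> (u z)) holomorphic_on {z. dist l z > \<rho>}"
      proof (rule complex_functional_holomorphic[OF \<phi>])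
        show "vector_analytic_on u {z. dist l z > \<rho>}"
          using in_res by (intro vector_analytic_subset[OF u(1)]) auto
        show "open {z. dist l z > \<rho>}"
          by (intro open_Collect_less continuous_intros)
      qed
      then have "((\<lambda>z. \<phi> (u z)) \<circ> (\<lambda>w. l + 1 / w)) holomorphic_on (ball 0 r - {0})"
        using img by (intro holomorphic_on_compose_gen[of _ _ _ "{z. dist l z > \<rho>}"] holomorphic_intros) auto
      then show "h holomorphic_on (ball 0 r - {0})"
        by (rule holomorphic_transform) (auto simp: h_def)
    qed auto
    also have "ball 0 r0 \<union> (ball 0 r - {0}) = ball (0::complex) r"
      using r0 by (auto simp: r0_def)
    finally obtain M where M: "M > 0" "\<And>n. cmod (c n) \<le> M / (1 / \<rho>') ^ n"
      using holomorphic_series_coeff_bound[OF _ r0 ser, of r "1 / \<rho>'"] r \<rho> by auto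
    have "cmod (\<phi> ((1 / \<rho>' ^ n) *\<^sub>R (B ^^ n) y)) \<le> M * \<rho>'" for n
    proof -
      have "cmod (\<phi> ((B ^^ n) y)) \<le> M * \<rho>' * \<rho>' ^ n"
        using M(2)[of "Suc n"] by (simp add: c_def field_simps)
      moreover have "\<phi> ((1 / \<rho>' ^ n) *\<^sub>R (B ^^ n) y) = (1 / \<rho>' ^ n) *\<^sub>R \<phi> ((B ^^ n) y)"
        using \<phi> by (simp add: complex_functional_def linear_simps)
      ultimately show ?thesis using \<rho> by (simp add: field_simps)
    qed
    then show ?thesis by blast
  qed
  then obtain M where M: "M > 0" "\<And>n. norm ((1 / \<rho>' ^ n) *\<^sub>R (B ^^ n) y) \<le> M"
    using weakly_bounded_imp_bounded[of "\<lambda>n. (1 / \<rho>' ^ n) *\<^sub>R (B ^^ n) y"] by blast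
  have "norm ((B ^^ n) y) \<le> M * \<rho>' ^ n" for n
    using M(2)[of n] \<rho> by (simp add: field_simps)
  with M(1) show ?thesis unfolding B_def by blast
qed

section \<open>Commutators and strips\<close>

definition commutator_plus :: "('a \<Rightarrow> 'a) \<Rightarrow> complex \<Rightarrow> ('a \<Rightarrow> 'a) \<Rightarrow> ('a::complex_normed_vector \<Rightarrow> 'a)" where
  "commutator_plus A \<beta> S = (\<lambda>x. A (S x) - S (A x) + \<beta> *\<^sub>C S x)"

lemma bounded_clinear_commutator_plus:
  "bounded_clinear A \<Longrightarrow> bounded_clinear S \<Longrightarrow> bounded_clinear (commutator_plus A \<beta> S)"
  unfolding commutator_plus_def
  by (intro bounded_clinear_add bounded_clinear_sub bounded_clinear_compose[of A S]
      bounded_clinear_compose[of S A] bounded_clinear_compose[OF bounded_clinear_scaleC])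

lemma bounded_clinear_commutator_plus_funpow:
  "bounded_clinear A \<Longrightarrow> bounded_clinear S \<Longrightarrow> bounded_clinear ((commutator_plus A \<beta> ^^ n) S)"
  by (induction n) (simp_all add: bounded_clinear_commutator_plus)

text \<open>Within a fixed large disc, a half-plane is nearly a disc with a far away centre.\<close>

lemma half_plane_subset_disc:
  fixes z c :: complex
  assumes "cmod z \<le> R" "cmod c = 1" "Re (c * z) \<le> b" "R\<^sup>2 \<le> 2 * L * \<eta>" "0 \<le> L" "0 \<le> L + b + \<eta>"
  shows "cmod (z + of_real L * cnj c) \<le> L + b + \<eta>"
proof -
  have "c * cnj c = 1" using assms(2) by (simp add: complex_norm_square[symmetric])
  then have "c * (z + of_real L * cnj c) = c * z + of_real L"
    by (simp add: algebra_simps)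
  then have eq: "cmod (z + of_real L * cnj c) = cmod (c * z + of_real L)"
    using assms(2) by (metis norm_mult mult_1)
  have "(cmod (c * z + of_real L))\<^sup>2 = (cmod (c * z))\<^sup>2 + 2 * L * Re (c * z) + L\<^sup>2"
    by (simp only: cmod_power2) (simp add: power2_eq_square algebra_simps)
  also have "(cmod (c * z))\<^sup>2 \<le> R\<^sup>2"
    using assms(1,2) by (intro power_mono) (auto simp: norm_mult)
  also have "2 * L * Re (c * z) \<le> 2 * L * b"
    using assms(3,5) by (intro mult_left_mono) auto
  finally have "(cmod (c * z + of_real L))\<^sup>2 \<le> 2 * L * \<eta> + 2 * L * b + L\<^sup>2"
    using assms(4) by linarith
  also have "\<dots> \<le> (L + b + \<eta>)\<^sup>2"
    using zero_le_power2[of "b + \<eta>"] by (simp add: power2_eq_square algebra_simps)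
  finally show ?thesis unfolding eq by (rule power2_le_imp_le) (rule assms(6))
qed

lemma local_spectrum_bounded:
  fixes A :: "'a::complex_banach \<Rightarrow> 'a"
  assumes "bounded_clinear A" "\<And>x. norm (A x) \<le> R * norm x" "R > 0"
  shows "local_spectrum A x \<subseteq> cball 0 R"
  using spectrum_on_subset_local_spectrum[OF assms(1) closed_invariant_subspace_UNIV, of x]
    spectrum_on_bounded[OF assms(1) closed_invariant_subspace_UNIV assms(2,3)] by blast

text \<open>
  With \<open>l = - L c\<^sup>*\<close> and \<open>m = L c\<^sup>*\<close>, the operation \<open>S \<mapsto> A S - S A + 2 L c\<^sup>* S\<close> is
  \<open>S \<mapsto> (A - l) S - S (A - m)\<close>. Within a fixed disc and for large \<open>L\<close>, the half-planes
  \<open>Re (c z) \<le> t + \<eta>\<close> and \<open>Re (c z) \<ge> t\<close> almost lie in the discs about \<open>l\<close> and \<open>m\<close> of radii \<open>L + t\<close> and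
  \<open>L - t\<close>, and these radii have sum \<open>2 L\<close>.
\<close>

lemma strip_piece_bound:
  fixes A T :: "'a::complex_banach \<Rightarrow> 'a"
  assumes A: "bounded_clinear A" and T: "bounded_clinear T" and dec: "decomposable A"
    and inv: "\<And>F. closed F \<Longrightarrow> T ` local_spectral_subspace A F \<subseteq> local_spectral_subspace A F"
    and R: "\<And>x. norm (A x) \<le> R * norm x" "R > 0" and c: "cmod c = 1"
    and \<eta>: "\<eta> > 0" and L: "R\<^sup>2 \<le> 2 * L * \<eta>" "R \<le> L" and t: "- R \<le> t" "t \<le> R"
    and E: "closed_invariant_subspace A E" "E \<subseteq> local_spectral_subspace A {z. Re (c * z) \<le> t + \<eta>}"
    and e: "e \<in> E" "e \<in> local_spectral_subspace A {z. Re (c * z) \<ge> t}"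
  shows "\<exists>M. \<forall>n. norm ((commutator_plus A (2 * of_real L * cnj c) ^^ n) T e) \<le> M * (2 * L + 5 * \<eta>) ^ n"
proof -
  define l m where "l = - (of_real L * cnj c)" and "m = of_real L * cnj c"
  define P Q where "P = (\<lambda>x. A x - l *\<^sub>C x)" and "Q = (\<lambda>x. A x - m *\<^sub>C x)"
  define r1 r2 where "r1 = L + t + 3 * \<eta>" and "r2 = L - t + 2 * \<eta>"
  have r: "r1 > 0" "r2 > 0" "r1 + r2 = 2 * L + 5 * \<eta>"
    using \<eta> L(2) t by (auto simp: r1_def r2_def)
  note E_simps = closed_invariant_subspaceD[OF E(1)]
  have P: "bounded_clinear P" and Q: "bounded_clinear Q"
    unfolding P_def Q_def using A by (auto intro: bounded_clinear_shift)
  note P_simps = bounded_clinear_simps[OF bounded_clinear_funpow[OF P]]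
  have bdd: "local_spectrum A x \<subseteq> cball 0 R" for x
    by (rule local_spectrum_bounded[OF A R])
  have "\<exists>M>0. \<forall>i. norm ((P ^^ i) (T y)) \<le> M * r1 ^ i" if y: "y \<in> E" for y
  proof -
    have "closed {z. Re (c * z) \<le> t + \<eta>}"
      by (intro closed_Collect_le continuous_intros)
    from inv[OF this] E(2) y have "local_spectrum A (T y) \<subseteq> {z. Re (c * z) \<le> t + \<eta>}"
      unfolding local_spectral_subspace_def by blast
    have "local_spectrum A (T y) \<subseteq> cball l (L + (t + \<eta>) + \<eta>)"
    proof
      fix z assume z: "z \<in> local_spectrum A (T y)"
      have "cmod (z + of_real L * cnj c) \<le> L + (t + \<eta>) + \<eta>"
        using z bdd[of "T y"] \<open>local_spectrum A (T y) \<subseteq> {z. Re (c * z) \<le> t + \<eta>}\<close> c L t R(2) \<eta>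
        by (intro half_plane_subset_disc[of _ R]) auto
      then show "z \<in> cball l (L + (t + \<eta>) + \<eta>)"
        by (simp add: l_def dist_norm norm_minus_commute)
    qed
    then show ?thesis
      unfolding P_def using \<eta> L t by (intro local_spectral_radius[OF A dec]) (auto simp: r1_def)
  qed
  then have "\<exists>M>0. \<forall>i. \<forall>y\<in>E. norm ((1 / r1 ^ i) *\<^sub>R (P ^^ i) (T y)) \<le> M * norm y"
  proof (intro uniform_boundedness_on_subspace[where f = "\<lambda>i y. (1 / r1 ^ i) *\<^sub>R (P ^^ i) (T y)"])
    show "subspace E" using E_simps(1) by (rule complex_subspace_imp_subspace)
    show "bounded_linear (\<lambda>y. (1 / r1 ^ i) *\<^sub>R (P ^^ i) (T y))" for i
      using bounded_clinear_compose[OF bounded_clinear_funpow[OF P] T]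
      by (intro bounded_linear_const_scaleR) (auto simp: bounded_clinear_def)
    fix y assume "y \<in> E"
    then obtain M where "\<And>i. norm ((P ^^ i) (T y)) \<le> M * r1 ^ i"
      using \<open>\<And>y. y \<in> E \<Longrightarrow> \<exists>M>0. \<forall>i. norm ((P ^^ i) (T y)) \<le> M * r1 ^ i\<close> by blast
    then show "\<exists>M. \<forall>i. norm ((1 / r1 ^ i) *\<^sub>R (P ^^ i) (T y)) \<le> M"
      using r by (intro exI[of _ M]) (simp add: field_simps)
  qed (rule E_simps(2))
  then obtain M1 where "M1 > 0" "\<And>i y. y \<in> E \<Longrightarrow> norm ((1 / r1 ^ i) *\<^sub>R (P ^^ i) (T y)) \<le> M1 * norm y"
    by blast
  then have M1: "M1 > 0" "\<And>i y. y \<in> E \<Longrightarrow> norm ((P ^^ i) (T y)) \<le> M1 * r1 ^ i * norm y"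
    using r by (auto simp: field_simps)
  have "local_spectrum A e \<subseteq> cball m (L + (- t) + \<eta>)"
  proof
    fix z assume z: "z \<in> local_spectrum A e"
    have "cmod (z + of_real L * cnj (- c)) \<le> L + (- t) + \<eta>"
      using z bdd[of e] e(2) c L t R(2) \<eta>
      by (intro half_plane_subset_disc[of _ R]) (auto simp: local_spectral_subspace_def)
    then show "z \<in> cball m (L + (- t) + \<eta>)"
      by (simp add: m_def dist_norm norm_minus_commute)
  qed
  then have "\<exists>M>0. \<forall>n. norm ((Q ^^ n) e) \<le> M * r2 ^ n"
    unfolding Q_def using \<eta> L t by (intro local_spectral_radius[OF A dec]) (auto simp: r2_def)
  then obtain M2 where M2: "M2 > 0" "\<And>j. norm ((Q ^^ j) e) \<le> M2 * r2 ^ j" by blast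
  \<comment> \<open>The estimate of \<open>P\<^sup>i T\<close> is uniform only on \<open>E\<close>, so \<open>Q\<^sup>j e\<close> must stay in \<open>E\<close>.\<close>
  have Q_in: "(Q ^^ j) e \<in> E" for j
    by (induction j) (use e(1) E_simps in \<open>auto simp: Q_def\<close>)
  define W where "W n = (commutator_plus A (2 * of_real L * cnj c) ^^ n) T" for n
  have W_clin: "bounded_clinear (W n)" for n
    unfolding W_def by (rule bounded_clinear_commutator_plus_funpow[OF A T])
  have W_Suc: "W (Suc n) x = P (W n x) - W n (Q x)" for n x
  proof -
    have "2 * of_real L * cnj c = m - l" by (simp add: m_def l_def)
    then have "W (Suc n) x = A (W n x) - W n (A x) + (m - l) *\<^sub>C W n x"
      by (simp add: W_def commutator_plus_def)
    then show ?thesis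
      by (simp add: P_def Q_def bounded_clinear_simps[OF W_clin] complex_vector.scale_left_diff_distrib)
  qed
  \<comment> \<open>As \<open>W (n + 1) = P W n - W n Q\<close>, this is the binomial expansion of \<open>W n\<close>, whose terms
      are \<open>P\<^sup>i T Q\<^sup>j\<close>; proving it for all \<open>i\<close> and \<open>j\<close> at once avoids binomial coefficients.\<close>
  have "norm ((P ^^ i) (W n ((Q ^^ j) e))) \<le> M1 * M2 * r1 ^ i * r2 ^ j * (r1 + r2) ^ n" for i j n
  proof (induction n arbitrary: i j)
    case 0
    have "norm ((P ^^ i) (T ((Q ^^ j) e))) \<le> M1 * r1 ^ i * norm ((Q ^^ j) e)"
      by (rule M1(2)[OF Q_in])
    also have "\<dots> \<le> M1 * r1 ^ i * (M2 * r2 ^ j)"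
      using M1(1) r by (intro mult_left_mono M2) auto
    finally show ?case by (simp add: W_def mult_ac)
  next
    case (Suc n)
    have "(P ^^ i) (W (Suc n) ((Q ^^ j) e))
        = (P ^^ Suc i) (W n ((Q ^^ j) e)) - (P ^^ i) (W n ((Q ^^ Suc j) e))"
      by (simp add: W_Suc P_simps funpow_swap1)
    also have "norm \<dots> \<le> norm ((P ^^ Suc i) (W n ((Q ^^ j) e))) + norm ((P ^^ i) (W n ((Q ^^ Suc j) e)))"
      by (rule norm_triangle_ineq4)
    also have "\<dots> \<le> M1 * M2 * r1 ^ Suc i * r2 ^ j * (r1 + r2) ^ n + M1 * M2 * r1 ^ i * r2 ^ Suc j * (r1 + r2) ^ n"
      by (intro add_mono Suc)
    also have "\<dots> = M1 * M2 * r1 ^ i * r2 ^ j * (r1 + r2) ^ Suc n"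
      by (simp add: algebra_simps)
    finally show ?case .
  qed
  from this[of 0 _ 0] show ?thesis
    unfolding r(3) W_def by (intro exI[of _ "M1 * M2"]) simp
qed

text \<open>
  Cutting along lines \<open>Re (c z) = t\<close> for increasing \<open>t\<close> writes every vector as a sum of pieces as
  in \<open>strip_piece_bound\<close>: what remains to the right of a cut is a vector in the local spectral
  subspace of a smaller half-plane.
\<close>

lemma strip_bound:
  fixes A T :: "'a::complex_banach \<Rightarrow> 'a"
  assumes A: "bounded_clinear A" and T: "bounded_clinear T" and dec: "decomposable A"
    and inv: "\<And>F. closed F \<Longrightarrow> T ` local_spectral_subspace A F \<subseteq> local_spectral_subspace A F"
    and R: "\<And>x. norm (A x) \<le> R * norm x" "R > 0" and c: "cmod c = 1"
    and \<eta>: "\<eta> > 0" and L: "R\<^sup>2 \<le> 2 * L * \<eta>" "R \<le> L"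
  shows "\<exists>M. \<forall>n. norm ((commutator_plus A (2 * of_real L * cnj c) ^^ n) T x) \<le> M * (2 * L + 5 * \<eta>) ^ n"
    (is "?bounded x")
proof -
  have bounded_add: "?bounded (x + y)" if xy: "?bounded x" "?bounded y" for x y
  proof -
    define W where "W n = (commutator_plus A (2 * of_real L * cnj c) ^^ n) T" for n
    have W: "W n (x + y) = W n x + W n y" for n x y
      unfolding W_def by (rule bounded_clinear_simps[OF bounded_clinear_commutator_plus_funpow[OF A T]])
    obtain M M' where M: "\<And>n. norm (W n x) \<le> M * (2 * L + 5 * \<eta>) ^ n" "\<And>n. norm (W n y) \<le> M' * (2 * L + 5 * \<eta>) ^ n"
      using xy unfolding W_def by blast
    have "norm (W n (x + y)) \<le> (M + M') * (2 * L + 5 * \<eta>) ^ n" for n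
      unfolding W using norm_triangle_ineq[of "W n x" "W n y"] M[of n] by (simp add: algebra_simps)
    then show ?thesis unfolding W_def by blast
  qed
  have bdd: "local_spectrum A x \<subseteq> cball 0 R" for x
    by (rule local_spectrum_bounded[OF A R])
  have Re_le: "\<bar>Re (c * z)\<bar> \<le> R" if "z \<in> cball 0 R" for z
    using abs_Re_le_cmod[of "c * z"] that c by (simp add: norm_mult)
  have rightmost: "?bounded x" if t: "- R \<le> t" "t \<le> R" "R \<le> t + \<eta>"
    and x: "x \<in> local_spectral_subspace A {z. Re (c * z) \<ge> t}" for t x
  proof -
    have "UNIV \<subseteq> local_spectral_subspace A {z. Re (c * z) \<le> t + \<eta>}"
      using bdd Re_le t(3) by (fastforce simp: local_spectral_subspace_def)
    from strip_piece_bound[OF A T dec inv R c \<eta> L t(1,2) closed_invariant_subspace_UNIV this UNIV_I x]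
    show ?thesis .
  qed
  have strips: "?bounded x" if "- R \<le> t" "t \<le> R" "R \<le> t + \<eta> + real k * (\<eta> / 2)"
      "x \<in> local_spectral_subspace A {z. Re (c * z) \<ge> t}" for k t x
    using that
  proof (induction k arbitrary: t x)
    case (0 t x)
    then show ?case by (intro rightmost[of t]) auto
  next
    case (Suc k t x)
    show ?case
    proof (cases "t + \<eta> \<ge> R")
      case True
      with Suc.prems show ?thesis by (intro rightmost[of t])
    next
      case False
      have "{z. Re (c * z) < t + \<eta>} \<union> {z. Re (c * z) > t + \<eta> / 2} = UNIV" using \<eta> by auto
      moreover have "open {z. Re (c * z) < t + \<eta>}" "open {z. Re (c * z) > t + \<eta> / 2}"
        by (intro open_Collect_less continuous_intros)+
      ultimately obtain E F where E: "closed_invariant_subspace A E" and F: "closed_invariant_subspace A F"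
        and sum: "\<And>x. \<exists>e\<in>E. \<exists>f\<in>F. x = e + f"
        and \<sigma>: "spectrum_on E A \<subseteq> {z. Re (c * z) < t + \<eta>}" "spectrum_on F A \<subseteq> {z. Re (c * z) > t + \<eta> / 2}"
        using decomposableE[OF dec] by metis
      obtain e f where ef: "e \<in> E" "f \<in> F" "x = e + f" using sum by blast
      have EX: "E \<subseteq> local_spectral_subspace A {z. Re (c * z) \<le> t + \<eta>}"
        using spectrum_on_subset_local_spectrum[OF A E] \<sigma>(1)
        by (fastforce simp: local_spectral_subspace_def)
      have f: "f \<in> local_spectral_subspace A {z. Re (c * z) \<ge> t + \<eta> / 2}"
        using spectrum_on_subset_local_spectrum[OF A F ef(2)] \<sigma>(2)
        by (fastforce simp: local_spectral_subspace_def)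
      have "e = x - f" using ef(3) by simp
      then have e: "e \<in> local_spectral_subspace A {z. Re (c * z) \<ge> t}"
        using local_spectrum_diff[OF A, of x f] f Suc.prems(4) \<eta>
        by (fastforce simp: local_spectral_subspace_def)
      have "?bounded e"
        by (rule strip_piece_bound[OF A T dec inv R c \<eta> L Suc.prems(1,2) E EX ef(1) e])
      moreover have "?bounded f"
        using Suc.prems(1-3) False \<eta> by (intro Suc.IH[OF _ _ _ f]) (auto simp: field_simps)
      ultimately show ?thesis unfolding ef(3) by (rule bounded_add)
    qed
  qed
  obtain k where "2 * R / (\<eta> / 2) \<le> real k" using real_arch_simple by blast
  then have "R \<le> - R + \<eta> + real k * (\<eta> / 2)" using \<eta> by (simp add: field_simps)
  moreover have "x \<in> local_spectral_subspace A {z. Re (c * z) \<ge> - R}"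
    using bdd[of x] Re_le by (fastforce simp: local_spectral_subspace_def)
  ultimately show ?thesis using R(2) by (intro strips[of "- R" k]) auto
qed

section \<open>Power series and their continuations\<close>

text \<open>With \<open>q = w / (1 + \<beta> w)\<close> the equation reads \<open>g n = v n / (1 + \<beta> w) + q g (n + 1)\<close>. Iterating it expands
  \<open>g 0\<close> in powers of \<open>q\<close>.\<close>

lemma iterated_functional_equation:
  fixes g v :: "nat \<Rightarrow> complex"
  assumes rec: "\<And>n. (1 + \<beta> * w) * g n = v n + w * g (Suc n)"
    and bound: "\<And>n. cmod (g n) \<le> M * K ^ n" and K: "K \<ge> 0"
    and nz: "1 + \<beta> * w \<noteq> 0" and small: "cmod (w / (1 + \<beta> * w)) * K < 1"
  shows "(\<lambda>n. v n * (w / (1 + \<beta> * w)) ^ n) sums ((1 + \<beta> * w) * g 0)"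
proof -
  define b where "b = 1 + \<beta> * w"
  define q where "q = w / b"
  have w: "w = b * q" using nz by (simp add: q_def b_def)
  have part: "(\<Sum>k<n. v k * q ^ k) = b * g 0 - b * (q ^ n * g n)" for n
  proof (induction n)
    case (Suc n)
    have v: "v n = b * g n - (b * q) * g (Suc n)"
      using rec[of n] unfolding b_def[symmetric] w[symmetric] by (simp add: algebra_simps)
    show ?case
      unfolding sum.lessThan_Suc Suc.IH v by (simp add: algebra_simps)
  qed simp
  have "\<forall>\<^sub>F n in sequentially. norm (q ^ n * g n) \<le> M * (cmod q * K) ^ n"
  proof (rule always_eventually[OF allI])
    fix n
    have "cmod q ^ n * cmod (g n) \<le> cmod q ^ n * (M * K ^ n)"
      by (intro mult_left_mono bound) simp
    then show "norm (q ^ n * g n) \<le> M * (cmod q * K) ^ n"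
      by (simp add: norm_mult norm_power power_mult_distrib mult_ac)
  qed
  moreover have "(\<lambda>n. M * (cmod q * K) ^ n) \<longlonglongrightarrow> M * 0"
    using small K unfolding q_def b_def
    by (intro tendsto_mult_left LIMSEQ_power_zero) (simp add: abs_mult)
  then have "(\<lambda>n. M * (cmod q * K) ^ n) \<longlonglongrightarrow> 0" by simp
  ultimately have "(\<lambda>n. q ^ n * g n) \<longlonglongrightarrow> 0" by (rule Lim_null_comparison)
  then have "(\<lambda>n. b * g 0 - b * (q ^ n * g n)) \<longlonglongrightarrow> b * g 0 - b * 0"
    by (intro tendsto_diff tendsto_const tendsto_mult_left)
  then show ?thesis
    unfolding sums_def b_def[symmetric] q_def[symmetric] part by simp
qed

text \<open>If \<open>s k\<close> and \<open>s' k\<close> stand for \<open>d\<^sup>k x\<close> and \<open>(d + \<beta>) d\<^sup>k x\<close>, this is \<open>(1 + \<beta> w) y = x + w (d + \<beta>) y\<close> for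
  \<open>y = (1 - w d)\<^sup>-\<^sup>1 x\<close>.\<close>

lemma shifted_power_series:
  fixes s s' :: "nat \<Rightarrow> complex"
  assumes "\<And>k. s' k = s (Suc k) + \<beta> * s k" and sm: "summable (\<lambda>k. s k * w ^ k)"
  shows "(1 + \<beta> * w) * (\<Sum>k. s k * w ^ k) = s 0 + w * (\<Sum>k. s' k * w ^ k)"
proof -
  have S: "(\<lambda>k. s k * w ^ k) sums (\<Sum>k. s k * w ^ k)" using sm by (rule summable_sums)
  then have "(\<lambda>k. s (Suc k) * w ^ Suc k) sums ((\<Sum>k. s k * w ^ k) - s 0)"
    using sums_Suc_iff[of "\<lambda>k. s k * w ^ k" "(\<Sum>k. s k * w ^ k) - s 0"] by simp
  then have "(\<lambda>k. s (Suc k) * w ^ Suc k + \<beta> * w * (s k * w ^ k)) sums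
      ((\<Sum>k. s k * w ^ k) - s 0 + \<beta> * w * (\<Sum>k. s k * w ^ k))"
    by (intro sums_add sums_mult S)
  moreover have "s (Suc k) * w ^ Suc k + \<beta> * w * (s k * w ^ k) = w * (s' k * w ^ k)" for k
    by (simp add: assms(1) algebra_simps)
  ultimately have *: "(\<lambda>k. w * (s' k * w ^ k)) sums
      ((\<Sum>k. s k * w ^ k) - s 0 + \<beta> * w * (\<Sum>k. s k * w ^ k))" by simp
  have "w * (\<Sum>k. s' k * w ^ k) = (\<Sum>k. s k * w ^ k) - s 0 + \<beta> * w * (\<Sum>k. s k * w ^ k)"
  proof (cases "w = 0")
    case True
    then show ?thesis using sums_unique[OF S] by simp
  next
    case False
    then have "summable (\<lambda>k. s' k * w ^ k)" using * summable_mult_D[of w "\<lambda>k. s' k * w ^ k"]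
      by (auto simp: sums_iff)
    then show ?thesis using sums_unique[OF *] by (simp add: suminf_mult)
  qed
  then show ?thesis by (simp add: algebra_simps)
qed

lemma power_series_bounded_by_geometric:
  fixes s :: "nat \<Rightarrow> complex"
  assumes "\<And>k. cmod (s k) \<le> C * K ^ k" "cmod w * K < 1" "K \<ge> 0"
  shows "summable (\<lambda>k. s k * w ^ k)" "cmod (\<Sum>k. s k * w ^ k) \<le> C / (1 - cmod w * K)"
proof -
  have le: "norm (s k * w ^ k) \<le> C * (cmod w * K) ^ k" for k
    using mult_right_mono[OF assms(1)[of k], of "cmod w ^ k"]
    by (simp add: norm_mult norm_power power_mult_distrib mult_ac)
  have geo: "(\<lambda>k. C * (cmod w * K) ^ k) sums (C * (1 / (1 - cmod w * K)))"
    using assms(2,3) by (intro sums_mult geometric_sums) (simp add: abs_mult)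
  show "summable (\<lambda>k. s k * w ^ k)"
    by (rule summable_comparison_test'[OF sums_summable[OF geo], of 0]) (rule le)
  then show "cmod (\<Sum>k. s k * w ^ k) \<le> C / (1 - cmod w * K)"
    using norm_suminf_le[OF le sums_summable[OF geo]] sums_unique[OF geo] by simp
qed

text \<open>The array stands for \<open>s n k = (d + \<beta>)\<^sup>n d\<^sup>k x\<close>, and both series are, up to the factor
  \<open>1 + \<beta> w\<close>, expansions of \<open>(1 - w d)\<^sup>-\<^sup>1 x\<close>, in the powers of \<open>d + \<beta>\<close> and of \<open>d\<close>: the Euler transform of power series.\<close>

lemma Euler_transform:
  fixes s :: "nat \<Rightarrow> nat \<Rightarrow> complex"
  assumes rec: "\<And>n k. s (Suc n) k = s n (Suc k) + \<beta> * s n k"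
    and bound: "\<And>n k. cmod (s n k) \<le> C * K ^ (n + k)" and K: "K \<ge> 0"
    and w: "cmod w * K < 1" "1 + \<beta> * w \<noteq> 0" "cmod (w / (1 + \<beta> * w)) * K < 1"
  shows "(\<lambda>n. s n 0 * (w / (1 + \<beta> * w)) ^ n) sums ((1 + \<beta> * w) * (\<Sum>k. s 0 k * w ^ k))"
proof (rule iterated_functional_equation[where K = K and M = "C / (1 - cmod w * K)"
      and g = "\<lambda>n. \<Sum>k. s n k * w ^ k" and v = "\<lambda>n. s n 0"])
  have b: "cmod (s n k) \<le> (C * K ^ n) * K ^ k" for n k
    using bound[of n k] by (simp add: power_add mult_ac)
  note ser = power_series_bounded_by_geometric[OF b w(1) K]
  show "(1 + \<beta> * w) * (\<Sum>k. s n k * w ^ k) = s n 0 + w * (\<Sum>k. s (Suc n) k * w ^ k)" for n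
    by (rule shifted_power_series[OF rec ser(1)])
  show "cmod (\<Sum>k. s n k * w ^ k) \<le> C / (1 - cmod w * K) * K ^ n" for n
    using ser(2)[of n] by simp
qed (use K w in auto)

text \<open>Convexity makes the intersection of two of the sets connected, and so agreement near the common
  point \<open>a\<close> propagates to it.\<close>

lemma holomorphic_glue_convex:
  fixes S :: "'i \<Rightarrow> complex set"
  assumes S: "\<And>i. i \<in> I \<Longrightarrow> open (S i)" "\<And>i. i \<in> I \<Longrightarrow> convex (S i)" "\<And>i. i \<in> I \<Longrightarrow> a \<in> S i"
    and f: "\<And>i. i \<in> I \<Longrightarrow> f i holomorphic_on S i"
    and \<delta>: "\<And>i. i \<in> I \<Longrightarrow> \<delta> i > 0" "\<And>i w. i \<in> I \<Longrightarrow> w \<in> ball a (\<delta> i) \<Longrightarrow> w \<in> S i \<Longrightarrow> f i w = g w"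
  obtains F where "F holomorphic_on (\<Union>i\<in>I. S i)" "\<And>i w. i \<in> I \<Longrightarrow> w \<in> S i \<Longrightarrow> F w = f i w"
proof -
  have agree: "f i w = f j w" if ij: "i \<in> I" "j \<in> I" and w: "w \<in> S i \<inter> S j" for i j w
  proof (rule analytic_continuation_open[of "S i \<inter> S j \<inter> ball a (min (\<delta> i) (\<delta> j))" "S i \<inter> S j"
        "f i" "f j"])
    show "open (S i \<inter> S j \<inter> ball a (min (\<delta> i) (\<delta> j)))" "open (S i \<inter> S j)"
      using S ij by auto
    have "a \<in> S i \<inter> S j \<inter> ball a (min (\<delta> i) (\<delta> j))" using S ij \<delta> by auto
    then show "S i \<inter> S j \<inter> ball a (min (\<delta> i) (\<delta> j)) \<noteq> {}" by blast
    show "connected (S i \<inter> S j)" using S ij by (intro convex_connected convex_Int)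
    show "f i holomorphic_on S i \<inter> S j"
      by (rule holomorphic_on_subset[OF f[OF ij(1)]]) auto
    show "f j holomorphic_on S i \<inter> S j"
      by (rule holomorphic_on_subset[OF f[OF ij(2)]]) auto
    show "f i z = f j z" if "z \<in> S i \<inter> S j \<inter> ball a (min (\<delta> i) (\<delta> j))" for z
      using \<delta>(2)[of i z] \<delta>(2)[of j z] ij that by simp
  qed (use w in auto)
  define F where "F w = f (SOME i. i \<in> I \<and> w \<in> S i) w" for w
  have F: "F w = f i w" if "i \<in> I" "w \<in> S i" for i w
  proof -
    have "(SOME i. i \<in> I \<and> w \<in> S i) \<in> I \<and> w \<in> S (SOME i. i \<in> I \<and> w \<in> S i)"
      using that by (intro someI[of "\<lambda>i. i \<in> I \<and> w \<in> S i" i]) auto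
    then show ?thesis unfolding F_def using that by (intro agree) auto
  qed
  have "F holomorphic_on (\<Union>i\<in>I. S i)"
  proof (rule holomorphic_on_UN_open)
    show "F holomorphic_on S i" if "i \<in> I" for i
      using f[OF that] by (rule holomorphic_transform) (use F that in auto)
  qed (use S in auto)
  then show thesis using F by (rule that)
qed

text \<open>For \<open>\<beta> \<noteq> 0\<close> the ratio of the distances to \<open>0\<close> and to \<open>- 1 / \<beta>\<close> is bounded by a number below one, which describes
  a disc of Apollonius. It is the region where the expansion of \<open>Euler_transform\<close> converges if its coefficients grow like \<open>\<rho>\<^sup>n\<close>.\<close>

lemma Apollonius_disc:
  fixes \<beta> :: complex
  assumes "cmod \<beta> < \<rho>"
  obtains p r where "{w. cmod w * \<rho> < cmod (1 + \<beta> * w)} = ball p r"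
proof -
  \<comment> \<open>Squaring and completing the square: the condition is \<open>k |w|\<^sup>2 - 2 Re (\<beta> w) < 1\<close>.\<close>
  define k where "k = \<rho>\<^sup>2 - (cmod \<beta>)\<^sup>2"
  have k: "k > 0" using assms by (simp add: k_def power_strict_mono)
  have scale: "k * a - 2 * b < 1 \<longleftrightarrow> a - 2 * b / k < 1 / k" for a b
  proof -
    have "a - 2 * b / k = (k * a - 2 * b) / k"
      using k by (simp add: field_simps)
    then show ?thesis using k by (simp add: divide_less_cancel)
  qed
  have "cmod w * \<rho> < cmod (1 + \<beta> * w) \<longleftrightarrow> cmod (cnj \<beta> / of_real k - w) < sqrt (1 / k + (cmod \<beta>)\<^sup>2 / k\<^sup>2)" for w
  proof -
    have \<rho>: "\<rho> \<ge> 0" using assms norm_ge_zero[of \<beta>] by linarith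
    have "cmod w * \<rho> < cmod (1 + \<beta> * w) \<longleftrightarrow> (cmod w * \<rho>)\<^sup>2 < (cmod (1 + \<beta> * w))\<^sup>2"
      using \<rho> by (auto intro: power_strict_mono power2_less_imp_less)
    also have "(cmod (1 + \<beta> * w))\<^sup>2 = 1 + 2 * Re (\<beta> * w) + (cmod \<beta>)\<^sup>2 * (cmod w)\<^sup>2"
    proof -
      have "(cmod (1 + \<beta> * w))\<^sup>2 = 1 + 2 * Re (\<beta> * w) + (cmod (\<beta> * w))\<^sup>2"
        by (simp only: cmod_power2) (simp add: power2_eq_square algebra_simps)
      then show ?thesis by (simp add: norm_mult power_mult_distrib)
    qed
    also have "(cmod w * \<rho>)\<^sup>2 < \<dots> \<longleftrightarrow> k * (cmod w)\<^sup>2 - 2 * Re (\<beta> * w) < 1"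
      by (simp add: k_def power_mult_distrib algebra_simps)
    also have "\<dots> \<longleftrightarrow> (cmod w)\<^sup>2 - 2 * Re (\<beta> * w) / k < 1 / k"
      by (rule scale)
    also have "\<dots> \<longleftrightarrow> (cmod (cnj \<beta> / of_real k - w))\<^sup>2 < 1 / k + (cmod \<beta>)\<^sup>2 / k\<^sup>2"
    proof -
      have "(cmod (cnj \<beta> / of_real k - w))\<^sup>2 = (cmod (cnj \<beta> / of_real k))\<^sup>2 - 2 * Re (\<beta> * w) / k + (cmod w)\<^sup>2"
        by (simp only: cmod_power2)
          (simp add: power2_eq_square algebra_simps add_divide_distrib diff_divide_distrib)
      also have "(cmod (cnj \<beta> / of_real k))\<^sup>2 = (cmod \<beta>)\<^sup>2 / k\<^sup>2"
        by (simp add: norm_divide power_divide)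
      finally show ?thesis by auto
    qed
    also have "\<dots> \<longleftrightarrow> cmod (cnj \<beta> / of_real k - w) < sqrt (1 / k + (cmod \<beta>)\<^sup>2 / k\<^sup>2)"
      using real_sqrt_less_iff[of "(cmod (cnj \<beta> / of_real k - w))\<^sup>2"] by simp
    finally show ?thesis .
  qed
  then have "{w. cmod w * \<rho> < cmod (1 + \<beta> * w)}
      = ball (cnj \<beta> / of_real k) (sqrt (1 / k + (cmod \<beta>)\<^sup>2 / k\<^sup>2))"
    unfolding ball_def dist_norm by (rule Collect_cong)
  then show thesis by (rule that)
qed

section \<open>An entire function with two-sided power growth\<close>

text \<open>The parameter \<open>R\<close> is the radius of the circle on which the estimate is used. The majorant is linear
  in \<open>x\<close>, so that series with these coefficients can be summed in closed form.\<close>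

lemma powr_le_linear:
  fixes \<alpha> R :: real
  assumes "0 \<le> \<alpha>" "\<alpha> < 1" "R \<ge> 1" "x \<ge> 1"
  shows "x powr \<alpha> \<le> R powr \<alpha> + R powr \<alpha> / R * x"
proof (cases "x \<le> R")
  case True
  then have "x powr \<alpha> \<le> R powr \<alpha>" using assms by (intro powr_mono2) auto
  moreover have "0 \<le> R powr \<alpha> / R * x" using assms by simp
  ultimately show ?thesis by linarith
next
  case False
  have "x powr \<alpha> = x powr (\<alpha> - 1) * x" using assms by (simp add: powr_diff)
  also have "\<dots> \<le> R powr (\<alpha> - 1) * x"
    using assms False by (intro mult_right_mono powr_mono2') auto
  also have "R powr (\<alpha> - 1) = R powr \<alpha> / R" using assms by (simp add: powr_diff)
  finally show ?thesis by (simp add: add_increasing)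
qed

text \<open>
  To the right of the line \<open>Re z = - 1/2\<close> the quotient \<open>z / (1 + z)\<close> lies in the unit disc and
  iterating the functional equation gives a convergent series for \<open>G 0\<close>. Its size blows up at
  the line like \<open>(Re z + 1/2)\<^sup>-\<^sup>2\<close> at worst, which the factor
  \<open>(z + 1/2)\<^sup>2 + R\<^sup>2\<close>, of modulus \<open>2 R (Re z + 1/2)\<close> on the circle of radius \<open>R\<close> about \<open>- 1/2\<close>, compensates.
\<close>

lemma half_plane_growth:
  fixes G :: "nat \<Rightarrow> complex \<Rightarrow> complex" and p :: "nat \<Rightarrow> complex"
  assumes hol: "G 0 holomorphic_on UNIV"
    and rec: "\<And>n z. (1 + z) * G n z = p n + z * G (Suc n) z"
    and K: "K \<ge> 0" "\<And>z. \<exists>M. \<forall>n. cmod (G n z) \<le> M * K ^ n"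
    and p: "\<And>n. cmod (p n) \<le> C * real (Suc n) powr \<alpha>" and C: "C \<ge> 0" and \<alpha>: "0 \<le> \<alpha>" "\<alpha> < 1"
    and R: "R \<ge> 1" and z: "cmod (z + 1 / 2) = R" "Re z > - 1 / 2"
  shows "(cmod ((z + 1 / 2)\<^sup>2 + of_real (R\<^sup>2)))\<^sup>2 * cmod (G 0 z) \<le> 40 * C * (R ^ 4 * R powr \<alpha>)"
proof -
  have p_le: "cmod (p n) \<le> C * R powr \<alpha> + C * R powr \<alpha> / R * real (Suc n)" if "R \<ge> 1" for n R
  proof -
    have "C * real (Suc n) powr \<alpha> \<le> C * (R powr \<alpha> + R powr \<alpha> / R * real (Suc n))"
      using C by (intro mult_left_mono powr_le_linear \<alpha> that) auto
    with p[of n] show ?thesis by (simp add: algebra_simps)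
  qed
  have maj: "(\<lambda>n. (C * R powr \<alpha> + C * R powr \<alpha> / R * real (Suc n)) * r ^ n) sums
      (C * R powr \<alpha> * (1 / (1 - r)) + C * R powr \<alpha> / R * (1 / (1 - r)\<^sup>2))" if "0 \<le> r" "r < 1" for r R :: real
  proof -
    have "(\<lambda>n. C * R powr \<alpha> * r ^ n + C * R powr \<alpha> / R * (of_nat (Suc n) * r ^ n)) sums
        (C * R powr \<alpha> * (1 / (1 - r)) + C * R powr \<alpha> / R * (1 / (1 - r)\<^sup>2))"
      using that by (intro sums_add sums_mult geometric_sums geometric_deriv_sums) auto
    then show ?thesis by (simp only: distrib_right mult.assoc)
  qed
  have term_le: "norm (p n * t ^ n) \<le> (C * R powr \<alpha> + C * R powr \<alpha> / R * real (Suc n)) * cmod t ^ n"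
    if "R \<ge> 1" for n t R
    using mult_right_mono[OF p_le[OF that], of "cmod t ^ n" n] by (simp add: norm_mult norm_power)
  define f where "f t = (\<Sum>n. p n * t ^ n)" for t
  have f_sums: "(\<lambda>n. p n * t ^ n) sums f t" if "cmod t < 1" for t
    unfolding f_def
  proof (intro summable_sums summable_comparison_test'[OF sums_summable[OF maj[of "cmod t" 1]], of 0])
    show "norm (p n * t ^ n) \<le> (C * 1 powr \<alpha> + C * 1 powr \<alpha> / 1 * real (Suc n)) * cmod t ^ n" for n
      by (rule term_le) simp
  qed (use that in auto)
  have f_hol: "f holomorphic_on ball 0 1"
    using f_sums by (intro power_series_holomorphic[where a = p]) auto
  have quot: "1 + z \<noteq> 0" "cmod (z / (1 + z)) < 1" "cmod z < cmod (1 + z)"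
    "(cmod (1 + z))\<^sup>2 - (cmod z)\<^sup>2 = 2 * (Re z + 1 / 2)" if "Re z > - 1 / 2" for z
  proof -
    show sq: "(cmod (1 + z))\<^sup>2 - (cmod z)\<^sup>2 = 2 * (Re z + 1 / 2)"
      by (simp only: cmod_power2) (simp add: power2_eq_square algebra_simps)
    with that have "(cmod z)\<^sup>2 < (cmod (1 + z))\<^sup>2" by simp
    then show lt: "cmod z < cmod (1 + z)" by (rule power_less_imp_less_base) simp
    then show "1 + z \<noteq> 0" using norm_ge_zero[of z] by fastforce
    with lt show "cmod (z / (1 + z)) < 1" by (simp add: norm_divide divide_less_eq)
  qed
  have rep: "(1 + z) * G 0 z = f (z / (1 + z))" if z: "Re z > - 1 / 2" for z
  proof (rule analytic_continuation_open[of "ball 0 (1 / (K + 2))" "{z. Re z > - 1 / 2}"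
        "\<lambda>z. (1 + z) * G 0 z" "\<lambda>z. f (z / (1 + z))"])
    have K2: "1 / (K + 2) \<le> 1 / 2" using K(1) by (simp add: field_simps)
    have Re_small: "Re w > - 1 / 2" if "w \<in> ball 0 (1 / (K + 2))" for w
      using abs_Re_le_cmod[of w] that K2 by simp
    then show "ball 0 (1 / (K + 2)) \<subseteq> {z. Re z > - 1 / 2}" by blast
    show "ball (0::complex) (1 / (K + 2)) \<noteq> {}" using K(1) by simp
    show "open {z. Re z > - 1 / 2}" by (rule open_halfspace_Re_gt)
    show "connected {z. Re z > - 1 / 2}" by (intro convex_connected convex_halfspace_Re_gt)
    show "(\<lambda>z. (1 + z) * G 0 z) holomorphic_on {z. Re z > - 1 / 2}"
      by (intro holomorphic_intros holomorphic_on_subset[OF hol]) auto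
    have "(f \<circ> (\<lambda>z. z / (1 + z))) holomorphic_on {z. Re z > - 1 / 2}"
      using quot by (intro holomorphic_on_compose_gen[OF _ f_hol] holomorphic_intros) auto
    then show "(\<lambda>z. f (z / (1 + z))) holomorphic_on {z. Re z > - 1 / 2}" by (simp add: o_def)
    fix w :: complex assume w: "w \<in> ball 0 (1 / (K + 2))"
    note q = quot[OF Re_small[OF w]]
    have "cmod w * (K + 2) < 1" using w K(1) by (simp add: field_simps)
    then have "cmod w * K + cmod w * 2 < 1" by (simp only: distrib_left)
    then have "cmod w * K < 1 - cmod w" using norm_ge_zero[of w] by linarith
    also have "\<dots> \<le> cmod (1 + w)" using norm_diff_ineq[of 1 w] by simp
    finally have "cmod (w / (1 + w)) * K < 1"
      using q(1) by (simp add: norm_divide field_simps)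
    moreover obtain M where "\<And>n. cmod (G n w) \<le> M * K ^ n" using K(2) by blast
    ultimately have "(\<lambda>n. p n * (w / (1 + w)) ^ n) sums ((1 + w) * G 0 w)"
      using iterated_functional_equation[of 1 w "\<lambda>n. G n w" p M K] rec q(1) K(1) by simp
    with f_sums[OF q(2)] show "(1 + w) * G 0 w = f (w / (1 + w))" by (rule sums_unique2[symmetric])
  qed (use z in auto)
  define a b x where "a = cmod z" and "b = cmod (1 + z)" and "x = Re z + 1 / 2"
  note q = quot[OF z(2)]
  have x: "0 < x" "x \<le> R"
    using z abs_Re_le_cmod[of "z + 1 / 2"] by (auto simp: x_def)
  have ab: "0 \<le> a" "a < b" "b\<^sup>2 - a\<^sup>2 = 2 * x" using q by (auto simp: a_def b_def x_def)
  have b_le: "b \<le> 2 * R"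
    using norm_triangle_ineq[of "z + 1 / 2" "1 / 2"] z(1) R by (simp add: b_def add.commute)
  define r where "r = a / b"
  have r: "0 \<le> r" "r < 1" using ab by (auto simp: r_def)
  define s where "s = 1 / (1 - r)"
  have s_eq: "s = b * (a + b) / (2 * x)"
  proof -
    have "s = b / (b - a)" using ab by (simp add: s_def r_def field_simps)
    also have "\<dots> = b * (a + b) / ((b - a) * (a + b))" using ab by simp
    also have "(b - a) * (a + b) = 2 * x" using ab(3) by (simp add: power2_eq_square algebra_simps)
    finally show ?thesis .
  qed
  have s_le: "s \<le> b * (2 * R / x)"
  proof -
    have "b * (a + b) / (2 * x) \<le> b * (4 * R) / (2 * x)"
      using ab b_le x by (intro divide_right_mono mult_left_mono) auto
    then show ?thesis unfolding s_eq using x by (simp add: field_simps)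
  qed
  have s_pos: "s > 0" using r by (simp add: s_def)
  have "b * cmod (G 0 z) = cmod (f (z / (1 + z)))"
    using rep[OF z(2)] by (metis b_def norm_mult)
  also have "\<dots> \<le> C * R powr \<alpha> * (1 / (1 - r)) + C * R powr \<alpha> / R * (1 / (1 - r)\<^sup>2)"
  proof -
    have "cmod (z / (1 + z)) = r" by (simp add: r_def a_def b_def norm_divide)
    then have le: "norm (p n * (z / (1 + z)) ^ n) \<le> (C * R powr \<alpha> + C * R powr \<alpha> / R * real (Suc n)) * r ^ n" for n
      using term_le[OF R, of n "z / (1 + z)"] by simp
    show ?thesis
      unfolding f_def sums_unique[OF maj[OF r, of R]]
      by (rule norm_suminf_le[OF le sums_summable[OF maj[OF r, of R]]])
  qed
  also have "\<dots> = C * R powr \<alpha> * s + C * R powr \<alpha> / R * s\<^sup>2"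
    by (simp add: s_def power_divide)
  also have "\<dots> \<le> C * R powr \<alpha> * (b * (2 * R / x)) + C * R powr \<alpha> / R * (b * (2 * R / x))\<^sup>2"
    using s_le s_pos C R by (intro add_mono mult_left_mono power_mono) auto
  also have "\<dots> = b * (C * R powr \<alpha> * (2 * R / x + b * (4 * R / x\<^sup>2)))"
    using R x by (simp add: field_simps power2_eq_square)
  finally have "cmod (G 0 z) \<le> C * R powr \<alpha> * (2 * R / x + b * (4 * R / x\<^sup>2))"
    using ab by (simp add: mult_le_cancel_left_pos)
  also have "\<dots> \<le> C * R powr \<alpha> * (2 * R / x + 2 * R * (4 * R / x\<^sup>2))"
    using C R b_le by (intro mult_left_mono add_left_mono mult_right_mono) auto
  finally have G_le: "cmod (G 0 z) \<le> C * R powr \<alpha> * (2 * R / x + 8 * R\<^sup>2 / x\<^sup>2)"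
    by (simp add: power2_eq_square mult_ac)
  define e where "e = z + 1 / 2"
  have e: "cmod e = R" "Re e = x" using z by (auto simp: e_def x_def)
  have "of_real (R\<^sup>2) = e * cnj e"
    using complex_norm_square[of e] e(1) by simp
  then have "e\<^sup>2 + of_real (R\<^sup>2) = e * (e + cnj e)" by (simp add: power2_eq_square algebra_simps)
  also have "e + cnj e = of_real (2 * x)" using e(2) by (simp add: complex_eq_iff)
  finally have "cmod (e\<^sup>2 + of_real (R\<^sup>2)) = R * (2 * x)"
    using e x by (simp add: norm_mult)
  then have "(cmod ((z + 1 / 2)\<^sup>2 + of_real (R\<^sup>2)))\<^sup>2 = 4 * R\<^sup>2 * x\<^sup>2"
    unfolding e_def by (simp add: power_mult_distrib)
  then have "(cmod ((z + 1 / 2)\<^sup>2 + of_real (R\<^sup>2)))\<^sup>2 * cmod (G 0 z)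
      \<le> 4 * R\<^sup>2 * x\<^sup>2 * (C * R powr \<alpha> * (2 * R / x + 8 * R\<^sup>2 / x\<^sup>2))"
    using G_le by (metis mult_left_mono zero_le_power2 mult_nonneg_nonneg zero_le_numeral)
  also have "\<dots> = C * R powr \<alpha> * (8 * R ^ 3 * x + 32 * R ^ 4)"
    using x by (simp add: field_simps power2_eq_square power3_eq_cube power4_eq_xxxx)
  also have "\<dots> \<le> C * R powr \<alpha> * (8 * R ^ 3 * R + 32 * R ^ 4)"
    using C x R by (intro mult_left_mono add_right_mono) auto
  also have "\<dots> = 40 * C * (R ^ 4 * R powr \<alpha>)"
    by (simp add: power3_eq_cube power4_eq_xxxx algebra_simps)
  finally show ?thesis .
qed

text \<open>Multiplied by \<open>((z + 1/2)\<^sup>2 + R\<^sup>2)\<^sup>2\<close> the function satisfies an estimate on the whole circle of radius \<open>R\<close> about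
  \<open>- 1/2\<close>, because the factor vanishes at the two points where nothing is assumed. On the disc of
  half the radius the factor is at least of order \<open>R\<^sup>4\<close>, so the maximum principle gives \<open>O(R\<^sup>\<alpha>)\<close> there.\<close>

lemma entire_constant_of_growth:
  fixes H :: "complex \<Rightarrow> complex"
  assumes hol: "H holomorphic_on UNIV" and \<alpha>: "\<alpha> < 1" and K: "K \<ge> 0"
    and growth: "\<And>R z. R \<ge> 1 \<Longrightarrow> cmod (z + 1 / 2) = R \<Longrightarrow> Re z \<noteq> - 1 / 2 \<Longrightarrow>
      (cmod ((z + 1 / 2)\<^sup>2 + of_real (R\<^sup>2)))\<^sup>2 * cmod (H z) \<le> K * (R ^ 4 * R powr \<alpha>)"
  shows "H z = H (- 1 / 2)"
proof -
  define h where "h e = H (e - 1 / 2)" for e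
  have h: "h holomorphic_on S" for S
    unfolding h_def by (intro holomorphic_on_compose_gen[OF _ hol, unfolded o_def] holomorphic_intros) auto
  have h_le: "cmod (h e) \<le> 2 * K * R powr \<alpha>" if R: "R \<ge> 1" and e: "cmod e \<le> R / 2" for R e
  proof -
    define f where "f e = (e\<^sup>2 + of_real (R\<^sup>2))\<^sup>2 * h e" for e
    have f_hol: "f holomorphic_on S" for S
      unfolding f_def by (intro holomorphic_intros h)
    have "cmod (f e) \<le> K * (R ^ 4 * R powr \<alpha>)"
    proof (rule maximum_modulus_frontier[of f "cball 0 R"])
      fix w :: complex assume "w \<in> frontier (cball 0 R)"
      then have w: "cmod w = R" by simp
      show "cmod (f w) \<le> K * (R ^ 4 * R powr \<alpha>)"
      proof (cases "Re w = 0")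
        case True
        have "R\<^sup>2 = (Im w)\<^sup>2" using w True cmod_power2[of w] by simp
        then have "w\<^sup>2 = - of_real (R\<^sup>2)"
          using True by (simp add: complex_eq_iff power2_eq_square)
        then have "f w = 0" by (simp add: f_def)
        then show ?thesis using K R by simp
      next
        case False
        then show ?thesis using growth[OF R, of "w - 1 / 2"] w
          by (simp add: f_def h_def norm_mult norm_power)
      qed
    qed (use R e in \<open>auto intro: holomorphic_on_imp_continuous_on[OF f_hol] f_hol\<close>)
    moreover have "R ^ 4 / 2 \<le> (cmod (e\<^sup>2 + of_real (R\<^sup>2)))\<^sup>2"
    proof -
      have "R\<^sup>2 * (3 / 4) \<le> R\<^sup>2 - (cmod e)\<^sup>2"
        using power_mono[OF e, of 2] by (simp add: power_divide)
      also have "\<dots> \<le> cmod (e\<^sup>2 + of_real (R\<^sup>2))"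
        using norm_diff_ineq[of "of_real (R\<^sup>2)" "e\<^sup>2"] by (simp add: norm_power add.commute)
      finally have "(R\<^sup>2 * (3 / 4))\<^sup>2 \<le> (cmod (e\<^sup>2 + of_real (R\<^sup>2)))\<^sup>2" by (rule power_mono) simp
      moreover have "R ^ 4 / 2 \<le> (R\<^sup>2 * (3 / 4))\<^sup>2" by (simp add: power_mult_distrib power_divide)
      ultimately show ?thesis by linarith
    qed
    then have "R ^ 4 / 2 * cmod (h e) \<le> cmod (f e)"
      unfolding f_def norm_mult norm_power by (rule mult_right_mono) simp
    ultimately have "R ^ 4 / 2 * cmod (h e) \<le> K * (R ^ 4 * R powr \<alpha>)" by linarith
    also have "\<dots> = R ^ 4 / 2 * (2 * K * R powr \<alpha>)" by simp
    finally have "R ^ 4 / 2 * cmod (h e) \<le> R ^ 4 / 2 * (2 * K * R powr \<alpha>)" .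
    then show ?thesis using R by (simp add: mult_le_cancel_left_pos)
  qed
  have "(deriv ^^ n) h 0 = 0" if n: "0 < n" for n
  proof -
    have "cmod ((deriv ^^ n) h 0) \<le> (fact n * 2 * K * 2 ^ n) * R powr (\<alpha> - 1)" if R: "R \<ge> 1" for R
    proof -
      have "cmod ((deriv ^^ n) h 0) \<le> fact n * (2 * K * R powr \<alpha>) / (R / 2) ^ n"
        using R h_le by (intro Cauchy_inequality holomorphic_on_imp_continuous_on h) auto
      also have "\<dots> = (fact n * 2 * K * 2 ^ n) * (R powr \<alpha> / R ^ n)"
        by (simp add: power_divide)
      also have "\<dots> \<le> (fact n * 2 * K * 2 ^ n) * (R powr \<alpha> / R ^ 1)"
        using R K n by (intro mult_left_mono divide_left_mono power_increasing) auto
      also have "R powr \<alpha> / R ^ 1 = R powr (\<alpha> - 1)" using R by (simp add: powr_diff)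
      finally show ?thesis .
    qed
    then have "\<forall>\<^sub>F R in at_top. cmod ((deriv ^^ n) h 0) \<le> (fact n * 2 * K * 2 ^ n) * R powr (\<alpha> - 1)"
      by (rule eventually_mono[OF eventually_ge_at_top[of 1]])
    moreover have "((\<lambda>R. (fact n * 2 * K * 2 ^ n) * R powr (\<alpha> - 1)) \<longlongrightarrow> (fact n * 2 * K * 2 ^ n) * 0) at_top"
      using \<alpha> by (intro tendsto_mult_left tendsto_neg_powr filterlim_ident) auto
    ultimately have "cmod ((deriv ^^ n) h 0) \<le> (fact n * 2 * K * 2 ^ n) * 0"
      by (intro tendsto_lowerbound[where F = at_top]) auto
    then show ?thesis by simp
  qed
  then have "h (z + 1 / 2) = h 0"
    by (intro holomorphic_fun_eq_const_on_connected[OF h[of UNIV]]) auto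
  then show ?thesis by (simp add: h_def)
qed

text \<open>The reflection \<open>z \<mapsto> - 1 - z\<close> in the point \<open>- 1/2\<close> turns the functional equation for \<open>j\<close> into the one
  for \<open>- j\<close>, up to a shift of \<open>p\<close> by one, so \<open>half_plane_growth\<close> applies on both sides of the line.\<close>

lemma two_sided_functional_equation_constant:
  fixes G :: "int \<Rightarrow> complex \<Rightarrow> complex" and p :: "int \<Rightarrow> complex"
  assumes hol: "G 0 holomorphic_on UNIV"
    and rec: "\<And>j z. (1 + z) * G j z = p j + z * G (j + 1) z"
    and K: "K \<ge> 0" "\<And>z. \<exists>M. \<forall>j. cmod (G j z) \<le> M * K ^ nat \<bar>j\<bar>"
    and p: "\<And>j. cmod (p j) \<le> C * (1 + real_of_int \<bar>j\<bar>) powr \<alpha>" and C: "C \<ge> 0" and \<alpha>: "0 \<le> \<alpha>" "\<alpha> < 1"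
  shows "G 0 z = G 0 (- 1 / 2)"
proof (rule entire_constant_of_growth[OF hol \<alpha>(2), of "40 * (2 * C)"])
  fix R :: real and z assume R: "R \<ge> 1" and z: "cmod (z + 1 / 2) = R" "Re z \<noteq> - 1 / 2"
  show "(cmod ((z + 1 / 2)\<^sup>2 + of_real (R\<^sup>2)))\<^sup>2 * cmod (G 0 z) \<le> 40 * (2 * C) * (R ^ 4 * R powr \<alpha>)"
  proof (cases "Re z > - 1 / 2")
    case True
    have "(cmod ((z + 1 / 2)\<^sup>2 + of_real (R\<^sup>2)))\<^sup>2 * cmod (G (int 0) z) \<le> 40 * (2 * C) * (R ^ 4 * R powr \<alpha>)"
    proof (rule half_plane_growth[where G = "\<lambda>n. G (int n)" and p = "\<lambda>n. p (int n)" and K = K,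
          OF _ _ K(1) _ _ _ \<alpha> R z(1) True])
      show "(1 + z) * G (int n) z = p (int n) + z * G (int (Suc n)) z" for n z
        using rec[of z "int n"] by (simp add: add.commute)
      show "\<exists>M. \<forall>n. cmod (G (int n) z) \<le> M * K ^ n" for z
        using K(2)[of z] by (metis abs_of_nat nat_int)
      show "cmod (p (int n)) \<le> 2 * C * real (Suc n) powr \<alpha>" for n
      proof -
        have "cmod (p (int n)) \<le> C * real (Suc n) powr \<alpha>"
          using p[of "int n"] by simp
        also have "\<dots> \<le> 2 * C * real (Suc n) powr \<alpha>"
          using C by (intro mult_right_mono) auto
        finally show ?thesis .
      qed
    qed (use hol C in auto)
    then show ?thesis by simp
  next
    case False
    let ?z = "- 1 - z"
    have "(cmod ((?z + 1 / 2)\<^sup>2 + of_real (R\<^sup>2)))\<^sup>2 * cmod (G (- int 0) (- 1 - ?z)) \<le> 40 * (2 * C) * (R ^ 4 * R powr \<alpha>)"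
    proof (rule half_plane_growth[where G = "\<lambda>n z. G (- int n) (- 1 - z)" and p = "\<lambda>n. p (- int n - 1)"
          and K = K, OF _ _ K(1) _ _ _ \<alpha> R])
      show "(\<lambda>z. G (- int 0) (- 1 - z)) holomorphic_on UNIV"
      proof -
        have "(G 0 \<circ> (\<lambda>z. - 1 - z)) holomorphic_on UNIV"
          by (rule holomorphic_on_compose_gen[OF _ hol]) (auto intro!: holomorphic_intros)
        then show ?thesis by (simp add: o_def)
      qed
      show "(1 + z) * G (- int n) (- 1 - z) = p (- int n - 1) + z * G (- int (Suc n)) (- 1 - z)" for n z
      proof -
        have minus_Suc: "- int (Suc n) = - int n - 1" by simp
        have reflect: "(1 + z) * a = b + z * c" if "(1 + (- 1 - z)) * c = b + (- 1 - z) * a" for a b c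
          using that by algebra
        have "(1 + (- 1 - z)) * G (- int n - 1) (- 1 - z)
            = p (- int n - 1) + (- 1 - z) * G (- int n) (- 1 - z)"
          using rec[of "- 1 - z" "- int n - 1"] by simp
        then show ?thesis unfolding minus_Suc by (rule reflect)
      qed
      show "\<exists>M. \<forall>n. cmod (G (- int n) (- 1 - z)) \<le> M * K ^ n" for z
        using K(2)[of "- 1 - z"] by (metis abs_minus_cancel abs_of_nat nat_int)
      show "cmod (p (- int n - 1)) \<le> 2 * C * real (Suc n) powr \<alpha>" for n
      proof -
        have "cmod (p (- int n - 1)) \<le> C * (real n + 2) powr \<alpha>"
          using p[of "- int n - 1"] by (simp add: add.commute abs_if)
        also have "\<dots> \<le> C * (2 * real (Suc n)) powr \<alpha>"
          using C \<alpha> by (intro mult_left_mono powr_mono2) auto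
        also have "\<dots> = C * (2 powr \<alpha> * real (Suc n) powr \<alpha>)"
          by (simp only: powr_mult)
        also have "\<dots> \<le> C * (2 powr 1 * real (Suc n) powr \<alpha>)"
          using C \<alpha> by (intro mult_left_mono mult_right_mono powr_mono) auto
        finally show ?thesis by (simp add: mult_ac)
      qed
      have "?z + 1 / 2 = - (z + 1 / 2)" by simp
      then show "cmod (?z + 1 / 2) = R" using z(1) by (metis norm_minus_cancel)
      show "Re ?z > - 1 / 2" using False z(2) by simp
    qed (use C in auto)
    moreover have "(?z + 1 / 2)\<^sup>2 = (z + 1 / 2)\<^sup>2" by (simp add: power2_eq_square algebra_simps)
    ultimately show ?thesis by simp
  qed
qed (use C in auto)

section \<open>Decay of iterated commutators\<close>

text \<open>Both operations are polynomials in left and right multiplication by \<open>A\<close>, which commute.\<close>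

lemma commutator_plus_commute:
  assumes A: "bounded_clinear A"
  shows "(commutator_plus A \<beta> ^^ n) (commutator_plus A \<gamma> S) = commutator_plus A \<gamma> ((commutator_plus A \<beta> ^^ n) S)"
proof (induction n)
  case (Suc n)
  have "commutator_plus A \<beta> (commutator_plus A \<gamma> S) = commutator_plus A \<gamma> (commutator_plus A \<beta> S)" for S
    unfolding commutator_plus_def
    by (rule ext) (simp add: bounded_clinear_simps[OF A] scaleC_add_right scaleC_scaleC
        complex_vector.scale_right_diff_distrib algebra_simps)
  with Suc show ?case by simp
qed simp

lemma commutator_plus_funpow_Suc:
  assumes "bounded_clinear A"
  shows "(commutator_plus A \<beta> ^^ Suc n) ((commutator_plus A 0 ^^ k) S) x =
    (commutator_plus A \<beta> ^^ n) ((commutator_plus A 0 ^^ Suc k) S) x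
      + \<beta> *\<^sub>C (commutator_plus A \<beta> ^^ n) ((commutator_plus A 0 ^^ k) S) x"
proof -
  have "commutator_plus A \<beta> V x = commutator_plus A 0 V x + \<beta> *\<^sub>C V x" for V
    by (simp add: commutator_plus_def)
  then show ?thesis by (simp add: commutator_plus_commute[OF assms])
qed

lemma norm_commutator_plus_le:
  assumes A: "\<And>x. norm (A x) \<le> R * norm x" "R \<ge> 0" and S: "\<And>x. norm (S x) \<le> s * norm x" "s \<ge> 0"
    and K: "2 * R + cmod \<beta> \<le> K"
  shows "norm (commutator_plus A \<beta> S x) \<le> (s * K) * norm x"
proof -
  have "norm (commutator_plus A \<beta> S x) \<le> norm (A (S x)) + norm (S (A x)) + cmod \<beta> * norm (S x)"
    unfolding commutator_plus_def
    using norm_triangle_ineq[of "A (S x) - S (A x)" "\<beta> *\<^sub>C S x"] norm_triangle_ineq4[of "A (S x)" "S (A x)"]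
    by (simp add: norm_scaleC)
  also have "norm (A (S x)) \<le> R * (s * norm x)"
    using A(1)[of "S x"] mult_left_mono[OF S(1)[of x] A(2)] by linarith
  also have "norm (S (A x)) \<le> s * (R * norm x)"
    using S(1)[of "A x"] mult_left_mono[OF A(1)[of x] S(2)] by linarith
  also have "cmod \<beta> * norm (S x) \<le> cmod \<beta> * (s * norm x)"
    by (intro mult_left_mono S) simp
  also have "R * (s * norm x) + s * (R * norm x) + cmod \<beta> * (s * norm x) = (2 * R + cmod \<beta>) * (s * norm x)"
    by (simp add: algebra_simps)
  also have "\<dots> \<le> K * (s * norm x)"
    using K S(2) by (intro mult_right_mono) auto
  finally show ?thesis by (simp add: mult_ac)
qed

lemma norm_commutator_plus_funpow_le:
  assumes A: "\<And>x. norm (A x) \<le> R * norm x" "R \<ge> 0" and S: "\<And>x. norm (S x) \<le> s * norm x" "s \<ge> 0"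
    and K: "2 * R + cmod \<beta> \<le> K"
  shows "norm ((commutator_plus A \<beta> ^^ n) S x) \<le> (s * K ^ n) * norm x"
proof (induction n arbitrary: x)
  case (Suc n)
  have "K \<ge> 0" using K A(2) norm_ge_zero[of \<beta>] by linarith
  then have "norm (commutator_plus A \<beta> ((commutator_plus A \<beta> ^^ n) S) x) \<le> (s * K ^ n * K) * norm x"
    using S(2) by (intro norm_commutator_plus_le[OF A Suc.IH _ K]) auto
  then show ?case by (simp add: mult_ac)
qed (use S in simp)

text \<open>
  The generating function of the iterated commutators, composed with a functional, continues
  from a neighbourhood of the origin to a disc for each of the four directions \<open>c\<close>, by the
  Euler transform, whose coefficients \<open>strip_bound\<close> controls. The discs contain the origin, so the continuations agree, and
  together they cover a disc about the origin whose radius grows without bound as the strips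
  become thinner.
\<close>

lemma iterated_commutator_functional_decay:
  fixes A T :: "'a::complex_banach \<Rightarrow> 'a"
  assumes A: "bounded_clinear A" and T: "bounded_clinear T" and dec: "decomposable A"
    and inv: "\<And>F. closed F \<Longrightarrow> T ` local_spectral_subspace A F \<subseteq> local_spectral_subspace A F"
    and \<phi>: "complex_functional \<phi>" and \<epsilon>: "\<epsilon> > 0"
  shows "\<exists>M>0. \<forall>k. cmod (\<phi> ((commutator_plus A 0 ^^ k) T x)) \<le> M * \<epsilon> ^ k"
proof -
  obtain R where R: "R > 0" "\<And>x. norm (A x) \<le> R * norm x"
    using bounded_clinear_bound[OF A] by blast
  obtain t where t: "t > 0" "\<And>x. norm (T x) \<le> t * norm x"
    using bounded_clinear_bound[OF T] by blast
  obtain C where C: "C > 0" "\<And>x. cmod (\<phi> x) \<le> C * norm x"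
    using complex_functional_bound[OF \<phi>] by blast
  \<comment> \<open>With this \<open>\<eta>\<close> the four discs cover the disc of radius \<open>2 / \<epsilon>\<close>; the first two entries of the
      maximum are what \<open>strip_bound\<close> asks for, and the third makes \<open>\<rho>\<^sup>2 - 4 L\<^sup>2\<close> at most \<open>\<epsilon> L\<close>.\<close>
  define \<eta> where "\<eta> = \<epsilon> / 25"
  define L where "L = max R (max (R\<^sup>2 / (2 * \<eta>)) (5 * \<eta>))"
  have \<eta>: "\<eta> > 0" using \<epsilon> by (simp add: \<eta>_def)
  have L: "R \<le> L" "5 * \<eta> \<le> L" "L > 0" using R by (auto simp: L_def)
  have "R\<^sup>2 / (2 * \<eta>) \<le> L" by (simp add: L_def)
  then have L2: "R\<^sup>2 \<le> 2 * L * \<eta>" using \<eta> by (simp add: field_simps)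
  define \<rho> where "\<rho> = 2 * L + 5 * \<eta>"
  have \<rho>: "\<rho> > 2 * L" "\<rho> > 0" using \<eta> L by (auto simp: \<rho>_def)
  define \<beta> where "\<beta> c = 2 * of_real L * cnj c" for c
  define I where "I = {1, - 1, \<i>, - \<i>}"
  have I: "cmod c = 1" if "c \<in> I" for c using that by (auto simp: I_def)
  have \<beta>_norm: "cmod (\<beta> c) = 2 * L" if "c \<in> I" for c
    using I[OF that] L by (simp add: \<beta>_def norm_mult)
  define s where "s c n k = \<phi> ((commutator_plus A (\<beta> c) ^^ n) ((commutator_plus A 0 ^^ k) T) x)" for c n k
  define d where "d k = \<phi> ((commutator_plus A 0 ^^ k) T x)" for k
  define K where "K = 2 * R + 2 * L"
  have K: "K > 0" using R L by (simp add: K_def)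
  have s0: "s c 0 k = d k" for c k by (simp add: s_def d_def)
  have s_Suc: "s c (Suc n) k = s c n (Suc k) + \<beta> c * s c n k" for c n k
    unfolding s_def commutator_plus_funpow_Suc[OF A] complex_functional_add[OF \<phi>]
      complex_functional_scaleC[OF \<phi>] ..
  have s_le: "cmod (s c n k) \<le> (C * t * norm x) * K ^ (n + k)" if c: "c \<in> I" for c n k
  proof -
    have 1: "norm ((commutator_plus A 0 ^^ k) T y) \<le> (t * K ^ k) * norm y" for y
      using R t L by (intro norm_commutator_plus_funpow_le[of A R]) (auto simp: K_def)
    have "norm ((commutator_plus A (\<beta> c) ^^ n) ((commutator_plus A 0 ^^ k) T) x) \<le> (t * K ^ k * K ^ n) * norm x"
      using R t L K \<beta>_norm[OF c] 1
      by (intro norm_commutator_plus_funpow_le[of A R]) (auto simp: K_def)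
    then have "C * norm ((commutator_plus A (\<beta> c) ^^ n) ((commutator_plus A 0 ^^ k) T) x)
        \<le> C * ((t * K ^ k * K ^ n) * norm x)"
      using C(1) by (intro mult_left_mono) auto
    with C(2)[of "(commutator_plus A (\<beta> c) ^^ n) ((commutator_plus A 0 ^^ k) T) x"]
    show ?thesis by (simp add: s_def power_add mult_ac)
  qed
  have v_le: "\<exists>M. \<forall>n. cmod (s c n 0) \<le> M * \<rho> ^ n" if c: "c \<in> I" for c
  proof -
    obtain M where M: "\<And>n. norm ((commutator_plus A (\<beta> c) ^^ n) T x) \<le> M * \<rho> ^ n"
      using strip_bound[OF A T dec inv R(2,1) I[OF c] \<eta> L2 L(1), of x] unfolding \<beta>_def \<rho>_def by blast
    have "cmod (s c n 0) \<le> (C * M) * \<rho> ^ n" for n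
      using order_trans[OF C(2) mult_left_mono[OF M[of n] less_imp_le[OF C(1)]]]
      by (simp add: s_def mult.assoc)
    then show ?thesis by blast
  qed
  define S where "S c = {w. cmod w * \<rho> < cmod (1 + \<beta> c * w)}" for c
  define f where "f c w = (\<Sum>n. s c n 0 * (w / (1 + \<beta> c * w)) ^ n) / (1 + \<beta> c * w)" for c w
  define g where "g w = (\<Sum>k. d k * w ^ k)" for w
  define \<delta> where "\<delta> = 1 / (K + 2 * L)"
  have \<delta>: "\<delta> > 0" using K L by (simp add: \<delta>_def)
  have d_sums: "(\<lambda>k. d k * w ^ k) sums g w" if w: "cmod w < \<delta>" for w
  proof -
    have "cmod w * (K + 2 * L) < 1" using w K L by (simp add: \<delta>_def field_simps)
    moreover have "cmod w * K \<le> cmod w * (K + 2 * L)" using L by (intro mult_left_mono) auto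
    ultimately have "cmod w * K < 1" by linarith
    moreover have "cmod (d k) \<le> (C * t * norm x) * K ^ k" for k
      using s_le[of 1 0 k] by (simp add: s0 I_def)
    ultimately show ?thesis
      unfolding g_def using K by (intro summable_sums power_series_bounded_by_geometric(1)) auto
  qed
  have fg: "f c w = g w" if c: "c \<in> I" and w: "cmod w < \<delta>" "w \<in> S c" for c w
  proof -
    have small: "cmod w * (K + 2 * L) < 1" using w K L by (simp add: \<delta>_def field_simps)
    moreover have "cmod w * K \<le> cmod w * (K + 2 * L)" using L by (intro mult_left_mono) auto
    ultimately have wK: "cmod w * K < 1" by linarith
    have "0 \<le> cmod w * \<rho>" using \<rho> by simp
    also have "\<dots> < cmod (1 + \<beta> c * w)" using w(2) by (simp add: S_def)
    finally have pos: "cmod (1 + \<beta> c * w) > 0" .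
    then have nz: "1 + \<beta> c * w \<noteq> 0" by simp
    have "cmod w * K < 1 - cmod (\<beta> c * w)"
      using small \<beta>_norm[OF c] by (simp add: norm_mult algebra_simps)
    also have "\<dots> \<le> cmod (1 + \<beta> c * w)" using norm_diff_ineq[of 1 "\<beta> c * w"] by simp
    finally have "cmod (w / (1 + \<beta> c * w)) * K < 1"
      using pos by (simp add: norm_divide field_simps)
    then have "(\<lambda>n. s c n 0 * (w / (1 + \<beta> c * w)) ^ n) sums ((1 + \<beta> c * w) * (\<Sum>k. s c 0 k * w ^ k))"
      using K by (intro Euler_transform[OF s_Suc s_le[OF c] _ wK nz]) auto
    then show ?thesis using nz by (simp add: f_def g_def s0 sums_iff)
  qed
  have S_disc: "\<exists>p r. S c = ball p r" if "c \<in> I" for c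
    using Apollonius_disc[of "\<beta> c" \<rho>] \<beta>_norm[OF that] \<rho>(1) unfolding S_def by metis
  have S_open: "open (S c)" and S_convex: "convex (S c)" if "c \<in> I" for c
    using S_disc[OF that] by auto
  have S_0: "0 \<in> S c" for c by (simp add: S_def)
  have f_hol: "f c holomorphic_on S c" if c: "c \<in> I" for c
  proof -
    obtain M where M: "\<And>n. cmod (s c n 0) \<le> M * \<rho> ^ n" using v_le[OF c] by blast
    define P where "P q = (\<Sum>n. s c n 0 * q ^ n)" for q
    have "(\<lambda>n. s c n 0 * q ^ n) sums P q" if "cmod q < 1 / \<rho>" for q
      unfolding P_def using that \<rho>
      by (intro summable_sums power_series_bounded_by_geometric(1)[OF M]) (auto simp: field_simps)
    then have P: "P holomorphic_on ball 0 (1 / \<rho>)"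
      by (intro power_series_holomorphic[where a = "\<lambda>n. s c n 0"]) auto
    have S: "1 + \<beta> c * w \<noteq> 0" "w / (1 + \<beta> c * w) \<in> ball 0 (1 / \<rho>)" if "w \<in> S c" for w
    proof -
      have lt: "cmod w * \<rho> < cmod (1 + \<beta> c * w)" using that by (simp add: S_def)
      moreover have "0 \<le> cmod w * \<rho>" using \<rho> by simp
      ultimately have pos: "cmod (1 + \<beta> c * w) > 0" by linarith
      then show "1 + \<beta> c * w \<noteq> 0" by simp
      show "w / (1 + \<beta> c * w) \<in> ball 0 (1 / \<rho>)"
        using lt pos \<rho> by (simp add: norm_divide field_simps)
    qed
    have "(P \<circ> (\<lambda>w. w / (1 + \<beta> c * w))) holomorphic_on S c"
      using S by (intro holomorphic_on_compose_gen[OF _ P] holomorphic_intros) auto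
    then have "(\<lambda>w. P (w / (1 + \<beta> c * w)) / (1 + \<beta> c * w)) holomorphic_on S c"
      using S by (intro holomorphic_intros) (auto simp: o_def)
    then show ?thesis unfolding f_def P_def .
  qed
  obtain F where F: "F holomorphic_on (\<Union>c\<in>I. S c)" "\<And>c w. c \<in> I \<Longrightarrow> w \<in> S c \<Longrightarrow> F w = f c w"
  proof (rule holomorphic_glue_convex[where I = I and S = S and f = f and g = g and \<delta> = "\<lambda>_. \<delta>" and a = 0])
    show "f c w = g w" if "c \<in> I" "w \<in> ball 0 \<delta>" "w \<in> S c" for c w
      using fg that by simp
  qed (use S_open S_convex S_0 f_hol \<delta> in auto)
  have "ball 0 (2 / \<epsilon>) \<subseteq> (\<Union>c\<in>I. S c)"
  proof
    fix w :: complex assume "w \<in> ball 0 (2 / \<epsilon>)"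
    then have w: "\<epsilon> * cmod w \<le> 2" using \<epsilon> by (simp add: field_simps)
    \<comment> \<open>One of the four directions makes an angle of at most \<open>\<pi> / 4\<close> with \<open>w\<close>.\<close>
    have "\<exists>c\<in>I. cmod w \<le> 2 * Re (cnj c * w)"
      using cmod_le[of w] by (auto simp: I_def abs_if split: if_splits)
    then obtain c where c: "c \<in> I" "cmod w \<le> 2 * Re (cnj c * w)" by blast
    have "(cmod w * \<rho>)\<^sup>2 = 4 * L\<^sup>2 * (cmod w)\<^sup>2 + (4 * L * (5 * \<eta>) + (5 * \<eta>) * (5 * \<eta>)) * (cmod w)\<^sup>2"
      by (simp add: \<rho>_def power2_eq_square algebra_simps)
    also have "(4 * L * (5 * \<eta>) + (5 * \<eta>) * (5 * \<eta>)) * (cmod w)\<^sup>2 \<le> (4 * L * (5 * \<eta>) + L * (5 * \<eta>)) * (cmod w)\<^sup>2"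
      using L(2) \<eta> by (intro mult_right_mono add_left_mono) auto
    also have "\<dots> = L * cmod w * (\<epsilon> * cmod w)" by (simp add: \<eta>_def power2_eq_square)
    also have "\<dots> \<le> L * cmod w * 2" using w L by (intro mult_left_mono) auto
    also have "\<dots> \<le> L * (2 * Re (cnj c * w)) * 2" using c L by (intro mult_right_mono mult_left_mono) auto
    also have "\<dots> = 2 * Re (\<beta> c * w)"
    proof -
      have "\<beta> c * w = of_real (2 * L) * (cnj c * w)" by (simp add: \<beta>_def)
      then have "Re (\<beta> c * w) = 2 * L * Re (cnj c * w)" by (simp only: Re_complex_of_real Im_complex_of_real times_complex.simps)
      then show ?thesis by simp
    qed
    also have "4 * L\<^sup>2 * (cmod w)\<^sup>2 = (cmod (\<beta> c * w))\<^sup>2"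
      by (simp add: norm_mult \<beta>_norm[OF c(1)] power_mult_distrib)
    also have "(cmod (\<beta> c * w))\<^sup>2 + 2 * Re (\<beta> c * w) < 1 + 2 * Re (\<beta> c * w) + (cmod (\<beta> c * w))\<^sup>2" by simp
    also have "\<dots> = (cmod (1 + \<beta> c * w))\<^sup>2"
      by (simp only: cmod_power2) (simp add: power2_eq_square algebra_simps)
    finally have "(cmod w * \<rho>)\<^sup>2 < (cmod (1 + \<beta> c * w))\<^sup>2" by simp
    then have "cmod w * \<rho> < cmod (1 + \<beta> c * w)" by (rule power2_less_imp_less) simp
    with c(1) show "w \<in> (\<Union>c\<in>I. S c)" by (auto simp: S_def)
  qed
  then have F_hol: "F holomorphic_on ball 0 (2 / \<epsilon>)" by (rule holomorphic_on_subset[OF F(1)])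
  have "1 \<in> I" by (simp add: I_def)
  obtain r where r: "r > 0" "ball 0 r \<subseteq> S 1"
    using S_open[OF \<open>1 \<in> I\<close>] S_0 by (meson openE)
  have "(\<lambda>k. d k * w ^ k) sums F w" if "cmod w < min r \<delta>" for w
    using d_sums[of w] fg[OF \<open>1 \<in> I\<close>, of w] F(2)[OF \<open>1 \<in> I\<close>, of w] r(2) that by auto
  then obtain M where "M > 0" "\<And>k. cmod (d k) \<le> M / (1 / \<epsilon>) ^ k"
    using holomorphic_series_coeff_bound[OF F_hol, of "min r \<delta>" d "1 / \<epsilon>"] r \<delta> \<epsilon>
    by (auto simp: divide_strict_right_mono)
  then show ?thesis using \<epsilon> unfolding d_def by (auto simp: power_divide)
qed

text \<open>Uniform boundedness is used twice, over the functionals and over the vectors.\<close>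

lemma iterated_commutator_decay:
  fixes A T :: "'a::complex_banach \<Rightarrow> 'a"
  assumes A: "bounded_clinear A" and T: "bounded_clinear T" and dec: "decomposable A"
    and inv: "\<And>F. closed F \<Longrightarrow> T ` local_spectral_subspace A F \<subseteq> local_spectral_subspace A F"
    and \<epsilon>: "\<epsilon> > 0"
  shows "\<exists>M>0. \<forall>k x. norm ((commutator_plus A 0 ^^ k) T x) \<le> M * \<epsilon> ^ k * norm x"
proof -
  define f where "f k x = (1 / \<epsilon> ^ k) *\<^sub>R (commutator_plus A 0 ^^ k) T x" for k x
  have "\<exists>M>0. \<forall>k. \<forall>x\<in>UNIV. norm (f k x) \<le> M * norm x"
  proof (rule uniform_boundedness_on_subspace)
    show "bounded_linear (f k)" for k
      unfolding f_def using bounded_clinear_commutator_plus_funpow[OF A T]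
      by (intro bounded_linear_const_scaleR) (auto simp: bounded_clinear_def)
    fix x
    have "\<exists>M>0. \<forall>k. norm (f k x) \<le> M"
    proof (rule weakly_bounded_imp_bounded)
      fix \<phi> :: "'a \<Rightarrow> complex" assume \<phi>: "complex_functional \<phi>"
      obtain M where M: "\<And>k. cmod (\<phi> ((commutator_plus A 0 ^^ k) T x)) \<le> M * \<epsilon> ^ k"
        using iterated_commutator_functional_decay[OF A T dec inv \<phi> \<epsilon>] by blast
      have "cmod (\<phi> (f k x)) \<le> M" for k
      proof -
        have "\<phi> (f k x) = (1 / \<epsilon> ^ k) *\<^sub>R \<phi> ((commutator_plus A 0 ^^ k) T x)"
          unfolding f_def using \<phi> by (simp add: complex_functional_def linear_simps)
        with M[of k] \<epsilon> show ?thesis by (simp add: field_simps)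
      qed
      then show "\<exists>M. \<forall>k. cmod (\<phi> (f k x)) \<le> M" by blast
    qed
    then show "\<exists>M. \<forall>k. norm (f k x) \<le> M" by blast
  qed auto
  then obtain M where M: "M > 0" "\<And>k x. norm (f k x) \<le> M * norm x" by blast
  have "norm ((commutator_plus A 0 ^^ k) T x) \<le> M * \<epsilon> ^ k * norm x" for k x
    using M(2)[of k x] \<epsilon> by (simp add: f_def field_simps)
  with M(1) show ?thesis by blast
qed

section \<open>Integer powers and the commutation theorem\<close>

lemma bounded_clinear_inv:
  assumes A: "bounded_clinear A" and 0: "0 \<notin> spectrum A"
  shows "bij A" "bounded_clinear (inv A)"
proof -
  obtain S where S: "bounded_clinear S" "\<And>x. S (- A x) = x" "\<And>x. - A (S x) = x"
    using 0 unfolding spectrum_on_def by (auto simp: bounded_clinear_on_UNIV)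
  have AS: "A (- S x) = x" for x using S(3)[of x] by (simp add: bounded_clinear_simps[OF A])
  have SA: "- S (A x) = x" for x using S(2)[of x] by (simp add: bounded_clinear_simps[OF S(1)])
  show "bij A" using AS SA by (intro o_bij[of "\<lambda>x. - S x"]) (auto simp: o_def)
  have "inv A = (\<lambda>x. - S x)"
    using AS SA by (intro inv_equality) auto
  moreover have "bounded_clinear (\<lambda>x. - S x)"
    using bounded_clinear_compose[OF bounded_clinear_scaleC S(1), of "- 1"]
    by (simp add: scaleC_one)
  ultimately show "bounded_clinear (inv A)" by simp
qed

lemma op_power_int_add_1:
  assumes "bij A"
  shows "op_power_int A (j + 1) x = op_power_int A j (A x)"
    and "op_power_int A (j + 1) x = A (op_power_int A j x)"
proof -
  have inv: "inv A (A x) = x" "A (inv A x) = x" for x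
    using assms by (simp_all add: bij_is_inj bij_is_surj surj_f_inv_f)
  consider n where "j = int n" | n where "j = - int (Suc n)"
    by (cases j rule: int_cases) auto
  then have "op_power_int A (j + 1) x = op_power_int A j (A x) \<and> op_power_int A (j + 1) x = A (op_power_int A j x)"
  proof cases
    case (1 n)
    then have "nat (j + 1) = Suc n" by simp
    with 1 show ?thesis by (simp add: op_power_int_def funpow_swap1)
  next
    case (2 n)
    then have "op_power_int A j = inv A ^^ Suc n" by (simp add: op_power_int_def nat_add_distrib)
    moreover have "op_power_int A (j + 1) = inv A ^^ n"
    proof (cases "n = 0")
      case True
      with 2 show ?thesis by (simp add: op_power_int_def)
    next
      case False
      with 2 have "\<not> j + 1 \<ge> 0" "nat (- (j + 1)) = n" by auto
      then show ?thesis by (simp only: op_power_int_def if_False)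
    qed
    ultimately show ?thesis using inv by (simp add: funpow_swap1) (metis inv(1) funpow_swap1)
  qed
  then show "op_power_int A (j + 1) x = op_power_int A j (A x)"
    and "op_power_int A (j + 1) x = A (op_power_int A j x)" by auto
qed

lemma bounded_clinear_op_power_int:
  "bounded_clinear A \<Longrightarrow> bounded_clinear (inv A) \<Longrightarrow> bounded_clinear (op_power_int A j)"
  by (simp add: op_power_int_def bounded_clinear_funpow)

lemma norm_op_power_int_le:
  fixes A :: "'a::real_normed_vector \<Rightarrow> 'a"
  assumes "\<And>x. norm (A x) \<le> K * norm x" "\<And>x. norm (inv A x) \<le> K * norm x" "K \<ge> 0"
  shows "norm (op_power_int A j x) \<le> K ^ nat \<bar>j\<bar> * norm x"
  using funpow_norm_le[of A K "nat j" x] funpow_norm_le[of "inv A" K "nat (- j)" x] assms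
  by (auto simp: op_power_int_def)

lemma commuting_preserves_local_spectral_subspace:
  assumes T: "bounded_clinear T" and comm: "A \<circ> T = T \<circ> A"
  shows "T ` local_spectral_subspace A F \<subseteq> local_spectral_subspace A F"
proof -
  have "l \<in> local_resolvent A (T x)" if l: "l \<in> local_resolvent A x" for l x
  proof -
    obtain U u where U: "open U" "l \<in> U" "vector_analytic_on u U" "\<forall>z\<in>U. z *\<^sub>C u z - A (u z) = x"
      using l by (rule local_resolventE)
    show ?thesis
    proof (rule local_resolventI[OF U(1,2) bounded_clinear_compose_analytic[OF T U(3)]])
      fix z assume "z \<in> U"
      then have "T x = T (z *\<^sub>C u z - A (u z))" using U(4) by simp
      also have "\<dots> = z *\<^sub>C T (u z) - A (T (u z))"
        using comm by (simp add: bounded_clinear_simps[OF T] fun_eq_iff)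
      finally show "z *\<^sub>C T (u z) - A (T (u z)) = T x" by simp
    qed
  qed
  then show ?thesis by (auto simp: local_spectral_subspace_def local_spectrum_def)
qed

text \<open>
  The power series \<open>G j\<close> is \<open>(1 - z (\<Delta> - 1))\<^sup>-\<^sup>1\<close> applied to \<open>\<Delta>\<^sup>j T\<close>, where \<open>\<Delta> S = A S A\<^sup>-\<^sup>1\<close>, evaluated at a
  vector and a functional. It is entire since \<open>(\<Delta> - 1)\<^sup>k T\<close> is an iterated commutator times
  \<open>A\<^sup>-\<^sup>k\<close>, and the functional equation expresses that \<open>\<Delta> (\<Delta>\<^sup>j T) = \<Delta>\<^sup>j\<^sup>+\<^sup>1 T\<close>.
\<close>

lemma conjugates_power_growth_imp_commute:
  fixes A T :: "'a::complex_banach \<Rightarrow> 'a"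
  assumes A: "bounded_clinear A" and T: "bounded_clinear T" and bij: "bij A" and Ai: "bounded_clinear (inv A)"
    and decay: "\<And>\<epsilon>. \<epsilon> > 0 \<Longrightarrow> \<exists>M>0. \<forall>k x. norm ((commutator_plus A 0 ^^ k) T x) \<le> M * \<epsilon> ^ k * norm x"
    and growth: "\<And>n x. norm (op_power_int A n (T (op_power_int A (- n) x)))
        \<le> C * (1 + real_of_int \<bar>n\<bar>) powr \<alpha> * norm x"
    and C: "C \<ge> 0" and \<alpha>: "0 \<le> \<alpha>" "\<alpha> < 1"
  shows "A \<circ> T = T \<circ> A"
proof -
  obtain K1 where K1: "K1 > 0" "\<And>x. norm (A x) \<le> K1 * norm x"
    using bounded_clinear_bound[OF A] by blast
  obtain K2 where K2: "K2 > 0" "\<And>x. norm (inv A x) \<le> K2 * norm x"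
    using bounded_clinear_bound[OF Ai] by blast
  define K where "K = max 1 (max K1 K2)"
  have K: "K \<ge> 1" by (simp add: K_def)
  have A_le: "norm (A x) \<le> K * norm x" and Ai_le: "norm (inv A x) \<le> K * norm x" for x
  proof -
    have "K1 * norm x \<le> K * norm x" "K2 * norm x \<le> K * norm x"
      by (intro mult_right_mono; simp add: K_def)+
    then show "norm (A x) \<le> K * norm x" "norm (inv A x) \<le> K * norm x"
      using K1(2)[of x] K2(2)[of x] by linarith+
  qed
  note pow = op_power_int_add_1[OF bij]
  have pow_le: "norm (op_power_int A j x) \<le> K ^ nat \<bar>j\<bar> * norm x" for j x
    using K by (intro norm_op_power_int_le A_le Ai_le) auto
  note pow_simps = bounded_clinear_simps[OF bounded_clinear_op_power_int[OF A Ai]]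
  define D where "D k = (commutator_plus A 0 ^^ k) T" for k
  have D_Suc: "A (D k y) = D (Suc k) y + D k (A y)" for k y
    by (simp add: D_def commutator_plus_def)
  have "D 1 y = 0" for y
  proof (rule eq_zero_by_functionals)
    fix \<phi> :: "'a \<Rightarrow> complex" assume \<phi>: "complex_functional \<phi>"
    obtain B where B: "B > 0" "\<And>x. cmod (\<phi> x) \<le> B * norm x"
      using complex_functional_bound[OF \<phi>] by blast
    \<comment> \<open>The linear coefficient of \<open>G 0\<close> is \<open>\<phi> ((\<Delta> - 1) T x)\<close>, which is \<open>\<phi> (D 1 y)\<close> for \<open>x = A y\<close>.\<close>
    define x where "x = A y"
    define a where "a j k = \<phi> (op_power_int A j (D k (op_power_int A (- int k - j) x)))" for j k
    have a_Suc: "a (j + 1) k = a j (Suc k) + 1 * a j k" for j k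
    proof -
      define v where "v = op_power_int A (- int k - (j + 1)) x"
      have "op_power_int A (- int k - j) x = A v"
        using pow(2)[of "- int k - (j + 1)" x] by (simp add: v_def)
      moreover have "- int (Suc k) - j = - int k - (j + 1)" by simp
      ultimately have "a j (Suc k) + 1 * a j k = \<phi> (op_power_int A j (D (Suc k) v)) + \<phi> (op_power_int A j (D k (A v)))"
        by (simp only: a_def v_def mult_1)
      also have "\<dots> = \<phi> (op_power_int A j (A (D k v)))"
        by (simp add: D_Suc pow_simps complex_functional_add[OF \<phi>])
      also have "\<dots> = a (j + 1) k" by (simp add: a_def v_def pow(1))
      finally show ?thesis ..
    qed
    have a_le: "\<exists>M. \<forall>j k. cmod (a j k) \<le> (M * (K\<^sup>2) ^ nat \<bar>j\<bar>) * (\<epsilon> * K) ^ k" if \<epsilon>: "\<epsilon> > 0" for \<epsilon>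
    proof -
      obtain M where M: "M > 0" "\<And>k x. norm (D k x) \<le> M * \<epsilon> ^ k * norm x"
        using decay[OF \<epsilon>] unfolding D_def by blast
      have "cmod (a j k) \<le> ((B * M * norm x) * (K\<^sup>2) ^ nat \<bar>j\<bar>) * (\<epsilon> * K) ^ k" for j k
      proof -
        let ?v = "op_power_int A (- int k - j) x"
        have "norm ?v \<le> K ^ nat \<bar>- int k - j\<bar> * norm x" by (rule pow_le)
        also have "\<dots> \<le> K ^ (nat \<bar>j\<bar> + k) * norm x"
          using K by (intro mult_right_mono power_increasing) auto
        finally have v: "norm ?v \<le> K ^ (nat \<bar>j\<bar> + k) * norm x" .
        have "cmod (a j k) \<le> B * norm (op_power_int A j (D k ?v))"
          unfolding a_def by (rule B(2))
        also have "\<dots> \<le> B * (K ^ nat \<bar>j\<bar> * norm (D k ?v))"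
          using B(1) by (intro mult_left_mono pow_le) auto
        also have "\<dots> \<le> B * (K ^ nat \<bar>j\<bar> * (M * \<epsilon> ^ k * norm ?v))"
          using B(1) K by (intro mult_left_mono M(2)) auto
        also have "\<dots> \<le> B * (K ^ nat \<bar>j\<bar> * (M * \<epsilon> ^ k * (K ^ (nat \<bar>j\<bar> + k) * norm x)))"
          using B(1) M(1) K \<epsilon> by (intro mult_left_mono v) auto
        also have "\<dots> = ((B * M * norm x) * (K\<^sup>2) ^ nat \<bar>j\<bar>) * (\<epsilon> * K) ^ k"
          by (simp add: power_add power_mult_distrib power2_eq_square mult_ac)
        finally show ?thesis .
      qed
      then show ?thesis by blast
    qed
    define G where "G j z = (\<Sum>k. a j k * z ^ k)" for j z
    have series: "summable (\<lambda>k. a j k * z ^ k) \<and> (\<exists>M. \<forall>j. cmod (G j z) \<le> M * (K\<^sup>2) ^ nat \<bar>j\<bar>)" for j z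
    proof -
      \<comment> \<open>A rate at which the series converges at \<open>z\<close> for every \<open>j\<close>, so that its sum is of order \<open>K\<^sup>2\<^sup>|\<^sup>j\<^sup>|\<close>.\<close>
      define \<epsilon> where "\<epsilon> = 1 / (2 * K * (cmod z + 1))"
      have pos: "cmod z + 1 > 0" using norm_ge_zero[of z] by linarith
      have \<epsilon>: "\<epsilon> > 0" unfolding \<epsilon>_def using K pos by (intro divide_pos_pos mult_pos_pos) auto
      have "\<epsilon> * K = 1 / (2 * (cmod z + 1))" using K by (simp add: \<epsilon>_def)
      then have "cmod z * (\<epsilon> * K) = cmod z / (2 * (cmod z + 1))" by simp
      also have "\<dots> < 1"
      proof -
        have "t / (2 * (t + 1)) < 1" if "t \<ge> 0" for t :: real
          using that by (simp add: divide_less_eq)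
        then show ?thesis using norm_ge_zero[of z] .
      qed
      finally have small: "cmod z * (\<epsilon> * K) < 1" .
      obtain M where M: "\<And>j k. cmod (a j k) \<le> (M * (K\<^sup>2) ^ nat \<bar>j\<bar>) * (\<epsilon> * K) ^ k"
        using a_le[OF \<epsilon>] by blast
      have "0 \<le> \<epsilon> * K" using \<epsilon> K by simp
      note ser = power_series_bounded_by_geometric[OF M small this]
      have "cmod (G j z) \<le> M / (1 - cmod z * (\<epsilon> * K)) * (K\<^sup>2) ^ nat \<bar>j\<bar>" for j
        using ser(2)[of j] by (simp add: G_def)
      with ser(1) show ?thesis by blast
    qed
    have G_sums: "(\<lambda>k. a j k * z ^ k) sums G j z" for j z
      unfolding G_def using series by (intro summable_sums) auto
    have const: "G 0 z = G 0 (- 1 / 2)" for z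
    proof (rule two_sided_functional_equation_constant[OF _ _ _ _ _ _ \<alpha>])
      have "G 0 holomorphic_on ball 0 r" for r
        using G_sums[of 0] by (intro power_series_holomorphic[where a = "a 0"]) simp
      then have "G 0 field_differentiable at z" for z
        by (rule holomorphic_on_imp_differentiable_at[of _ "ball 0 (cmod z + 1)"]) auto
      then show "G 0 holomorphic_on UNIV"
        by (simp add: holomorphic_on_def field_differentiable_at_within)
      show "(1 + z) * G j z = a j 0 + z * G (j + 1) z" for j z
        using shifted_power_series[of "a (j + 1)" "a j" 1 z] a_Suc series by (simp add: G_def)
      show "\<exists>M. \<forall>j. cmod (G j z) \<le> M * (K\<^sup>2) ^ nat \<bar>j\<bar>" for z
        using series by blast
      show "cmod (a j 0) \<le> (B * C * norm x) * (1 + real_of_int \<bar>j\<bar>) powr \<alpha>" for j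
      proof -
        have "cmod (a j 0) \<le> B * norm (op_power_int A j (T (op_power_int A (- j) x)))"
          using B(2) by (simp add: a_def D_def)
        also have "\<dots> \<le> B * (C * (1 + real_of_int \<bar>j\<bar>) powr \<alpha> * norm x)"
          using B(1) by (intro mult_left_mono growth) auto
        finally show ?thesis by (simp add: mult_ac)
      qed
    qed (use B C in auto)
    have "(\<lambda>k. a 0 k * z ^ k) sums G 0 (- 1 / 2)" for z
      using G_sums[of 0 z] const[of z] by simp
    then have "(\<lambda>_. G 0 (- 1 / 2)) has_fps_expansion Abs_fps (a 0)"
      by (intro has_fps_expansionI) simp
    from fps_nth_fps_expansion[OF this, of 1] have "a 0 1 = 0" by simp
    moreover have "op_power_int A (- 1) x = y"
      using pow(1)[of "- 1" y] by (simp add: x_def op_power_int_def)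
    ultimately show "\<phi> (D 1 y) = 0"
      by (simp add: a_def op_power_int_def)
  qed
  then show ?thesis by (auto simp: D_def commutator_plus_def fun_eq_iff)
qed
theorem proposition3p2:
  fixes A T :: "'a::complex_banach \<Rightarrow> 'a" and \<alpha> C :: real
  assumes "bounded_clinear A" and "bounded_clinear T"
    and "decomposable A" and "spectrum A \<subseteq> {z. Re z > 0}"
    and "0 \<le> \<alpha>" and "\<alpha> < 1" and "C > 0"
    and "\<And>n::int. onorm (op_power_int A n \<circ> T \<circ> op_power_int A (- n))
                   \<le> C * (1 + real_of_int \<bar>n\<bar>) powr \<alpha>"
  shows "A \<circ> T = T \<circ> A \<longleftrightarrow>
    (\<forall>F. closed F \<longrightarrow> T ` local_spectral_subspace A F \<subseteq> local_spectral_subspace A F)"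
proof
  assume "A \<circ> T = T \<circ> A"
  then show "\<forall>F. closed F \<longrightarrow> T ` local_spectral_subspace A F \<subseteq> local_spectral_subspace A F"
    using commuting_preserves_local_spectral_subspace[OF assms(2)] by blast
next
  assume inv: "\<forall>F. closed F \<longrightarrow> T ` local_spectral_subspace A F \<subseteq> local_spectral_subspace A F"
  have "0 \<notin> spectrum A" using assms(4) by auto
  note Ai = bounded_clinear_inv[OF assms(1) this]
  show "A \<circ> T = T \<circ> A"
  proof (rule conjugates_power_growth_imp_commute[OF assms(1,2) Ai _ _ _ assms(5,6)])
    show "\<exists>M>0. \<forall>k x. norm ((commutator_plus A 0 ^^ k) T x) \<le> M * \<epsilon> ^ k * norm x" if "\<epsilon> > 0" for \<epsilon>
      by (rule iterated_commutator_decay[OF assms(1-3) inv[rule_format] that])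
    fix n x
    have "bounded_clinear (op_power_int A n \<circ> T \<circ> op_power_int A (- n))"
      unfolding o_def
      by (rule bounded_clinear_compose[OF bounded_clinear_op_power_int[OF assms(1) Ai(2)]
            bounded_clinear_compose[OF assms(2) bounded_clinear_op_power_int[OF assms(1) Ai(2)]]])
    then have "bounded_linear (op_power_int A n \<circ> T \<circ> op_power_int A (- n))"
      unfolding bounded_clinear_def by (rule conjunct1)
    from onorm[OF this, of x]
    have "norm ((op_power_int A n \<circ> T \<circ> op_power_int A (- n)) x)
        \<le> onorm (op_power_int A n \<circ> T \<circ> op_power_int A (- n)) * norm x" .
    also have "\<dots> \<le> C * (1 + real_of_int \<bar>n\<bar>) powr \<alpha> * norm x"
      by (intro mult_right_mono assms(8)) simp
    finally show "norm (op_power_int A n (T (op_power_int A (- n) x))) \<le> C * (1 + real_of_int \<bar>n\<bar>) powr \<alpha> * norm x"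
      by simp
  qed (use assms(7) in simp)
qed

end
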